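(* Let $\mathbf D$ be an oriented $(2,3,5)$ distribution on a connected $5$-manifold $M$ and $\sigma$ a nonzero almost Einstein scale of $\mathbf c_{\mathbf D}$. For any $\mathbf D'\in\mathcal D[\mathbf D;\sigma]$, the conformal Killing fields $\xi$ and $\xi'$ respectively determined by $(\mathbf D,\sigma)$ and $(\mathbf D',\sigma)$ coincide. In particular, $\xi$, the line field $\mathbf L\subset TM|_{M_\xi}$ spanned by its restriction to $M_\xi:=\{x\in M:\xi_x\neq0\}$, and the orthogonal hyperplane field $\mathbf C:=\mathbf L^\perp\subset TM|_{M_\xi}$ depend only on the family $\mathcal D[\mathbf D;\sigma]$ and not on $\mathbf D$.
   Context: Signature $(p,q)$ means $p$ positive, $q$ negative directions. Tractors. Let $\mathbf c$ be a conformal structure of signature $(2,3)$ on an oriented $5$-manifold $M$. $\mathcal E[1]$ is the positive $10$th root of $(\Lambda^5TM)^2$, $\mathcal E[w]$ its powers, $B[w]:=B\otimes\mathcal E[w]$, $\mathbf g\in\Gamma(S^2T^*M[2])$ the conformal metric (raises/lowers indices). A comma denotes the Levi-Civita derivative of a chosen $g\in\mathbf c$, and $\mathsf P_{ab}=\frac13(R_{ab}-\frac18R^c{}_cg_{ab})$. The standard tractor bundle $\mathcal V$ (rank $7$) is, for each $g\in\mathbf c$, identified with $\mathcal E[1]\oplus TM[-1]\oplus\mathcal E[-1]\ni(\sigma,\mu^a,\rho)$; for $\hat g=\Omega^2g$, $\Upsilon=d\log\Omega$, the identifications are related by $(\sigma,\mu^a,\rho)\mapsto(\sigma,\mu^a+\Upsilon^a\sigma,\rho-\Upsilon_b\mu^b-\frac12\Upsilon_b\Upsilon^b\sigma)$.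 It carries the tractor metric $H$ of signature $(3,4)$, $H(\mathbb S,\mathbb S)=2\sigma\rho+\mu_a\mu^a$, an orientation induced by that of $M$, and the normal tractor connection $\nabla^{\mathcal V}_b(\sigma,\mu^a,\rho)=(\sigma_{,b}-\mu_b,\ \mu^a{}_{,b}+\mathsf P^a{}_b\sigma+\delta^a{}_b\rho,\ \rho_{,b}-\mathsf P_{bc}\mu^c)$. In a splitting let $Y_A,X_A,Z_A{}^a$ be the dual (lowered) inclusions, so that a tractor $3$-form is uniquely $\Phi=Y\wedge\phi+\chi+Y\wedge X\wedge\theta+X\wedge\psi$; $\phi\in\Lambda^2T^*M[3]$ is independent of the splitting and called the projecting part. The orientation of $\mathcal V$ is that of $Y\wedge X\wedge\epsilon_{\mathbf g}$. $\mathrm G_2$-structures. A $\mathrm G_2$-structure on a $7$-dimensional real vector space is a $3$-form $\Phi$ which in some basis $(E_a)$ with dual basis $(e^a)$ equals $-e^{147}+\sqrt2e^{156}+\sqrt2e^{237}+e^{245}+e^{346}$. It induces a bilinear form $H_\Phi$ with $H_\Phi(E_1,E_7)=H_\Phi(E_2,E_5)=H_\Phi(E_3,E_6)=1$, $H_\Phi(E_4,E_4)=-1$, other pairings zero, and the orientation of $-e^{1234567}$. A compatible tractor $\mathrm G_2$-structure is $\Phi\in\Gamma(\Lambda^3\mathcal V^* )$, fibrewise a $\mathrm G_2$-structure inducing $H$ and the orientation. $(2,3,5)$ distributions: $2$-plane distributions $\mathbf D$ on a $5$-manifold with $[\mathbf D,\mathbf D]$ of rank $3$ and $[\mathbf D,[\mathbf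 D,\mathbf D]]=TM$; oriented if the bundle $\mathbf D$ is (then $M$ is oriented). Nurowski's oriented conformal structure $\mathbf c_{\mathbf D}$ is characterized by: $\mathbf c=\mathbf c_{\mathbf D}$ iff $\mathbf c$ admits a (then unique) parallel compatible tractor $\mathrm G_2$-structure $\Phi$ whose projecting part $\phi$, viewed as a weighted bivector, is decomposable, nowhere zero and spans the oriented distribution $\mathbf D$. Almost Einstein scale: $\sigma\in\Gamma(\mathcal E[1])$ with trace-free part of $\sigma_{,ab}+\mathsf P_{ab}\sigma$ zero; these correspond bijectively to parallel standard tractors $\mathbb S=(\sigma,\sigma^{,a},-\frac15(\sigma_{,b}{}^b+\mathsf P^b{}_b\sigma))$. Family. For nonzero $\sigma$ with $\mathbb S$ scaled so that $\varepsilon:=-H(\mathbb S,\mathbb S)\in\{-1,0,1\}$, $\mathcal D[\mathbf D;\sigma]$ is the family of oriented $(2,3,5)$ distributions $\mathbf D'$ (all with $\mathbf c_{\mathbf D'}=\mathbf c_{\mathbf D}$) spanned by the projecting parts of the parallel compatible tractor $\mathrm G_2$-structures $\Phi'=\Phi+\bar A\,\mathbb S\lrcorner(\mathbb S^\flat\wedge\Phi)+B\,\mathbb S\lrcorner{*_\Phi\Phi}$, $-\varepsilon\bar A^2+2\bar A+B^2=0$. The conformal Killing field determined by $(\mathbf D,\sigma)$ is $\xi^a:=-\phi^{ab}\sigma_{,b}+\frac14\phi^{ab}{}_{,b}\sigma$ (independent of $g\in\mathbf c_{\mathbf D}$), $\phi$ the projecting part of the $\Phi$ of $\mathbf D$.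 *)

theory Defs
  imports "HOL-Analysis.Analysis" "HOL-Combinatorics.Permutations"
begin

text \<open>
  A geometric object on a manifold is given by its components in each chart of a fixed atlas,
  together with the transformation law between charts. The manifold is a whole
  type \<open>'m\<close>. Component functions take a chart and a point; their values matter only for charts
  of the atlas and points of the chart domain.
\<close>

section \<open>Smooth maps and charts\<close>

primrec Ck_on :: "nat \<Rightarrow> (real ^ 'n) set \<Rightarrow> (real ^ 'n \<Rightarrow> 'b::real_normed_vector) \<Rightarrow> bool" where
  "Ck_on 0 S f = continuous_on S f"
| "Ck_on (Suc k) S f = ((\<forall>x\<in>S. f differentiable (at x)) \<and>
     (\<forall>i. Ck_on k S (\<lambda>x. frechet_derivative f (at x) (axis i 1))))"

text \<open>Used for open sets only.\<close>

definition smooth_on :: "(real ^ 'n) set \<Rightarrow> (real ^ 'n \<Rightarrow> 'b::real_normed_vector) \<Rightarrow> bool" where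
  "smooth_on S f \<longleftrightarrow> (\<forall>k. Ck_on k S f)"

type_synonym 'm chart = "'m set \<times> ('m \<Rightarrow> real ^ 5)"

abbreviation dom :: "'m chart \<Rightarrow> 'm set" where "dom \<equiv> fst"
abbreviation coord :: "'m chart \<Rightarrow> 'm \<Rightarrow> real ^ 5" where "coord \<equiv> snd"

definition chart_inv :: "'m chart \<Rightarrow> real ^ 5 \<Rightarrow> 'm" where
  "chart_inv \<kappa> = inv_into (dom \<kappa>) (coord \<kappa>)"

definition chart_smooth ::
    "'m chart \<Rightarrow> 'm set \<Rightarrow> ('m \<Rightarrow> 'b::real_normed_vector) \<Rightarrow> bool" where
  "chart_smooth \<kappa> W f \<longleftrightarrow> smooth_on (coord \<kappa> ` W) (f \<circ> chart_inv \<kappa>)"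

text \<open>Derivative in the direction with components \<open>v\<close>, and the coordinate partial derivatives.\<close>

definition dird ::
    "'m chart \<Rightarrow> ('m \<Rightarrow> 'b::real_normed_vector) \<Rightarrow> real ^ 5 \<Rightarrow> 'm \<Rightarrow> 'b" where
  "dird \<kappa> f v p = frechet_derivative (f \<circ> chart_inv \<kappa>) (at (coord \<kappa> p)) v"

definition pd :: "'m chart \<Rightarrow> ('m \<Rightarrow> 'b::real_normed_vector) \<Rightarrow> 5 \<Rightarrow> 'm \<Rightarrow> 'b" where
  "pd \<kappa> f b p = dird \<kappa> f (axis b 1) p"

definition jac :: "'m chart \<Rightarrow> 'm chart \<Rightarrow> 'm \<Rightarrow> real ^ 5 ^ 5" where
  "jac \<kappa> \<kappa>' p = matrix (\<lambda>v. dird \<kappa> (coord \<kappa>') v p)"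

definition oriented_atlas :: "'m::topological_space chart set \<Rightarrow> bool" where
  "oriented_atlas A \<longleftrightarrow>
     (\<Union>\<kappa>\<in>A. dom \<kappa>) = UNIV \<and>
     (\<forall>\<kappa>\<in>A. open (dom \<kappa>) \<and> open (coord \<kappa> ` dom \<kappa>) \<and>
        homeomorphism (dom \<kappa>) (coord \<kappa> ` dom \<kappa>) (coord \<kappa>) (chart_inv \<kappa>)) \<and>
     (\<forall>\<kappa>\<in>A. \<forall>\<kappa>'\<in>A. chart_smooth \<kappa> (dom \<kappa> \<inter> dom \<kappa>') (coord \<kappa>') \<and>
        (\<forall>p\<in>dom \<kappa> \<inter> dom \<kappa>'. det (jac \<kappa> \<kappa>' p) > 0))"

definition smooth_fun :: "'m chart set \<Rightarrow> ('m \<Rightarrow> real) \<Rightarrow> bool" where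
  "smooth_fun A f \<longleftrightarrow> (\<forall>\<kappa>\<in>A. chart_smooth \<kappa> (dom \<kappa>) f)"

section \<open>Conformal structures and weighted Levi-Civita derivatives\<close>

type_synonym 'm metric = "'m chart \<Rightarrow> 'm \<Rightarrow> real ^ 5 ^ 5"
type_synonym 'm density = "'m chart \<Rightarrow> 'm \<Rightarrow> real"
type_synonym 'm vfield = "'m chart \<Rightarrow> 'm \<Rightarrow> real ^ 5"

definition has_signature :: "nat \<Rightarrow> nat \<Rightarrow> real ^ 'n ^ 'n \<Rightarrow> bool" where
  "has_signature r s G \<longleftrightarrow> transpose G = G \<and> r + s = CARD('n) \<and>
     (\<exists>P N. subspace P \<and> dim P = r \<and> (\<forall>v\<in>P. v \<noteq> 0 \<longrightarrow> v \<bullet> (G *v v) > 0) \<and>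
            subspace N \<and> dim N = s \<and> (\<forall>v\<in>N. v \<noteq> 0 \<longrightarrow> v \<bullet> (G *v v) < 0))"

definition metric23 :: "'m chart set \<Rightarrow> 'm metric \<Rightarrow> bool" where
  "metric23 A g \<longleftrightarrow>
     (\<forall>\<kappa>\<in>A. chart_smooth \<kappa> (dom \<kappa>) (g \<kappa>) \<and> (\<forall>p\<in>dom \<kappa>. has_signature 2 3 (g \<kappa> p))) \<and>
     (\<forall>\<kappa>\<in>A. \<forall>\<kappa>'\<in>A. \<forall>p\<in>dom \<kappa> \<inter> dom \<kappa>'.
        g \<kappa> p = transpose (jac \<kappa> \<kappa>' p) ** g \<kappa>' p ** jac \<kappa> \<kappa>' p)"

definition rescaled :: "'m chart set \<Rightarrow> ('m \<Rightarrow> real) \<Rightarrow> 'm metric \<Rightarrow> 'm metric \<Rightarrow> bool" where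
  "rescaled A \<Omega> g h \<longleftrightarrow> smooth_fun A \<Omega> \<and> (\<forall>p. \<Omega> p > 0) \<and>
     (\<forall>\<kappa>\<in>A. \<forall>p\<in>dom \<kappa>. h \<kappa> p = (\<Omega> p)\<^sup>2 *\<^sub>R g \<kappa> p)"

definition conformal_structure :: "'m chart set \<Rightarrow> 'm metric set \<Rightarrow> bool" where
  "conformal_structure A c \<longleftrightarrow> c \<noteq> {} \<and>
     (\<forall>g\<in>c. metric23 A g \<and> (\<forall>h. h \<in> c \<longleftrightarrow> metric23 A h \<and> (\<exists>\<Omega>. rescaled A \<Omega> g h)))"

text \<open>
  Weighted objects are written in the frame of \<open>\<E>[w]\<close> that a chart induces as the power
  \<open>w/10\<close> of \<open>(\<partial>\<^sub>1 \<and> \<dots> \<and> \<partial>\<^sub>5)\<^sup>2\<close>; changing charts, components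
  of weight \<open>w\<close> thus acquire the factor \<open>(det J)\<^bsup>w/5\<^esup>\<close>. The component matrix of the conformal
  metric (weight 2) is the multiple of \<open>g\<close> with determinant of absolute value 1.
\<close>

definition density :: "'m chart set \<Rightarrow> real \<Rightarrow> 'm density \<Rightarrow> bool" where
  "density A w \<sigma> \<longleftrightarrow> (\<forall>\<kappa>\<in>A. chart_smooth \<kappa> (dom \<kappa>) (\<sigma> \<kappa>)) \<and>
     (\<forall>\<kappa>\<in>A. \<forall>\<kappa>'\<in>A. \<forall>p\<in>dom \<kappa> \<inter> dom \<kappa>'.
        \<sigma> \<kappa>' p = det (jac \<kappa> \<kappa>' p) powr (w / 5) * \<sigma> \<kappa> p)"

definition cmetric :: "'m metric \<Rightarrow> 'm chart \<Rightarrow> 'm \<Rightarrow> real ^ 5 ^ 5" where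
  "cmetric g \<kappa> p = \<bar>det (g \<kappa> p)\<bar> powr (- 1 / 5) *\<^sub>R g \<kappa> p"

definition cinv :: "'m metric \<Rightarrow> 'm chart \<Rightarrow> 'm \<Rightarrow> real ^ 5 ^ 5" where
  "cinv g \<kappa> p = matrix_inv (cmetric g \<kappa> p)"

text \<open>\<open>chr g \<kappa> p a b c\<close> is \<open>\<Gamma>\<^sup>a\<^bsub>bc\<^esub>\<close>.\<close>

definition chr :: "'m metric \<Rightarrow> 'm chart \<Rightarrow> 'm \<Rightarrow> 5 \<Rightarrow> 5 \<Rightarrow> 5 \<Rightarrow> real" where
  "chr g \<kappa> p a b c = (1 / 2) * (\<Sum>d\<in>UNIV. matrix_inv (g \<kappa> p) $ a $ d *
     (pd \<kappa> (\<lambda>q. g \<kappa> q $ d $ c) b p + pd \<kappa> (\<lambda>q. g \<kappa> q $ d $ b) c p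
      - pd \<kappa> (\<lambda>q. g \<kappa> q $ b $ c) d p))"

text \<open>Sign convention: the Ricci tensor of a round sphere is positive.\<close>

definition ricci :: "'m metric \<Rightarrow> 'm chart \<Rightarrow> 'm \<Rightarrow> 5 \<Rightarrow> 5 \<Rightarrow> real" where
  "ricci g \<kappa> p a b =
     (\<Sum>c\<in>UNIV. pd \<kappa> (\<lambda>q. chr g \<kappa> q c a b) c p - pd \<kappa> (\<lambda>q. chr g \<kappa> q c c b) a p) +
     (\<Sum>c\<in>UNIV. \<Sum>d\<in>UNIV. chr g \<kappa> p c c d * chr g \<kappa> p d a b
                            - chr g \<kappa> p c a d * chr g \<kappa> p d c b)"

definition scal :: "'m metric \<Rightarrow> 'm chart \<Rightarrow> 'm \<Rightarrow> real" where
  "scal g \<kappa> p = (\<Sum>a\<in>UNIV. \<Sum>b\<in>UNIV. matrix_inv (g \<kappa> p) $ a $ b * ricci g \<kappa> p a b)"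

definition schouten :: "'m metric \<Rightarrow> 'm chart \<Rightarrow> 'm \<Rightarrow> 5 \<Rightarrow> 5 \<Rightarrow> real" where
  "schouten g \<kappa> p a b = (1 / 3) * (ricci g \<kappa> p a b - (1 / 8) * scal g \<kappa> p * g \<kappa> p $ a $ b)"

text \<open>
  Levi-Civita derivatives, in the order of the comma notation, of objects of weight \<open>w\<close>:
  densities \<open>f\<^bsub>,b\<^esub>\<close>, vectors \<open>\<mu>\<^sup>a\<^bsub>,b\<^esub>\<close>, covectors \<open>\<eta>\<^bsub>a,b\<^esub>\<close>, and contravariant 2-tensors
  \<open>\<phi>\<^bsup>ab\<^esup>\<^bsub>,c\<^esub>\<close>. On \<open>\<E>[w]\<close>, as the power \<open>w/5\<close> of \<open>\<Lambda>\<^sup>5TM\<close>, the connection form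
  is \<open>(w/5) \<Gamma>\<^sup>c\<^bsub>bc\<^esub>\<close>.
\<close>

definition wconn :: "'m metric \<Rightarrow> 'm chart \<Rightarrow> real \<Rightarrow> 5 \<Rightarrow> 'm \<Rightarrow> real" where
  "wconn g \<kappa> w b p = (w / 5) * (\<Sum>c\<in>UNIV. chr g \<kappa> p c b c)"

definition cd_dens ::
    "'m metric \<Rightarrow> 'm chart \<Rightarrow> real \<Rightarrow> ('m \<Rightarrow> real) \<Rightarrow> 5 \<Rightarrow> 'm \<Rightarrow> real" where
  "cd_dens g \<kappa> w f b p = pd \<kappa> f b p + wconn g \<kappa> w b p * f p"

definition cd_vec ::
    "'m metric \<Rightarrow> 'm chart \<Rightarrow> real \<Rightarrow> ('m \<Rightarrow> real ^ 5) \<Rightarrow> 5 \<Rightarrow> 5 \<Rightarrow> 'm \<Rightarrow> real" where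
  "cd_vec g \<kappa> w \<mu> a b p = pd \<kappa> (\<lambda>q. \<mu> q $ a) b p
     + (\<Sum>c\<in>UNIV. chr g \<kappa> p a b c * \<mu> p $ c) + wconn g \<kappa> w b p * \<mu> p $ a"

definition cd_covec ::
    "'m metric \<Rightarrow> 'm chart \<Rightarrow> real \<Rightarrow> ('m \<Rightarrow> real ^ 5) \<Rightarrow> 5 \<Rightarrow> 5 \<Rightarrow> 'm \<Rightarrow> real" where
  "cd_covec g \<kappa> w \<eta> a b p = pd \<kappa> (\<lambda>q. \<eta> q $ a) b p
     - (\<Sum>c\<in>UNIV. chr g \<kappa> p c b a * \<eta> p $ c) + wconn g \<kappa> w b p * \<eta> p $ a"

definition cd_biv ::
    "'m metric \<Rightarrow> 'm chart \<Rightarrow> real \<Rightarrow> ('m \<Rightarrow> real ^ 5 ^ 5) \<Rightarrow> 5 \<Rightarrow> 5 \<Rightarrow> 5 \<Rightarrow> 'm \<Rightarrow> real" where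
  "cd_biv g \<kappa> w \<phi> a b c p = pd \<kappa> (\<lambda>q. \<phi> q $ a $ b) c p
     + (\<Sum>d\<in>UNIV. chr g \<kappa> p a c d * \<phi> p $ d $ b)
     + (\<Sum>d\<in>UNIV. chr g \<kappa> p b c d * \<phi> p $ a $ d) + wconn g \<kappa> w c p * \<phi> p $ a $ b"

section \<open>Standard tractors\<close>

text \<open>
  Components \<open>(\<sigma>, \<mu>\<^sup>a, \<rho>)\<close> of a standard tractor in the splitting given by \<open>g \<in> c\<close> and
  in the coordinates and weight frames given by a chart.
\<close>

type_synonym tractor = "real \<times> (real ^ 5) \<times> real"

definition tr_chart :: "'m chart \<Rightarrow> 'm chart \<Rightarrow> 'm \<Rightarrow> tractor \<Rightarrow> tractor" where
  "tr_chart \<kappa> \<kappa>' p = (\<lambda>(s, m, r). let J = jac \<kappa> \<kappa>' p; d = det J in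
     (d powr (1 / 5) * s, d powr (- 1 / 5) *\<^sub>R (J *v m), d powr (- 1 / 5) * r))"

definition tr_split ::
    "('m \<Rightarrow> real) \<Rightarrow> 'm metric \<Rightarrow> 'm chart \<Rightarrow> 'm \<Rightarrow> tractor \<Rightarrow> tractor" where
  "tr_split \<Omega> g \<kappa> p = (\<lambda>(s, m, r).
     let U = (\<chi> b. pd \<kappa> (\<lambda>q. ln (\<Omega> q)) b p); V = cinv g \<kappa> p *v U in
     (s, m + s *\<^sub>R V, r - U \<bullet> m - (1 / 2) * (U \<bullet> V) * s))"

text \<open>In the next definitions \<open>G\<close> stands for the component matrix of the conformal metric.\<close>

definition tr_H :: "real ^ 5 ^ 5 \<Rightarrow> tractor \<Rightarrow> tractor \<Rightarrow> real" where
  "tr_H G = (\<lambda>(s, m, r) (s', m', r'). s * r' + r * s' + m \<bullet> (G *v m'))"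

text \<open>The tractor that \<open>tr_H G\<close> associates with the linear functional \<open>v \<mapsto> w \<bullet> v\<close>.\<close>

definition tr_sharp :: "real ^ 5 ^ 5 \<Rightarrow> tractor \<Rightarrow> tractor" where
  "tr_sharp G = (\<lambda>(s, m, r). (r, matrix_inv G *v m, s))"

definition tr_nabla ::
    "'m metric \<Rightarrow> 'm chart \<Rightarrow> ('m \<Rightarrow> tractor) \<Rightarrow> 5 \<Rightarrow> 'm \<Rightarrow> tractor" where
  "tr_nabla g \<kappa> S b p =
     (let \<sigma> = (\<lambda>q. fst (S q)); \<mu> = (\<lambda>q. fst (snd (S q))); \<rho> = (\<lambda>q. snd (snd (S q))) in
       (cd_dens g \<kappa> 1 \<sigma> b p - (cmetric g \<kappa> p *v \<mu> p) $ b,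
        \<chi> a. cd_vec g \<kappa> (-1) \<mu> a b p
             + (\<Sum>d\<in>UNIV. cinv g \<kappa> p $ a $ d * schouten g \<kappa> p d b) * \<sigma> p
             + (if a = b then \<rho> p else 0),
        cd_dens g \<kappa> (-1) \<rho> b p - (\<Sum>d\<in>UNIV. schouten g \<kappa> p b d * \<mu> p $ d)))"

text \<open>\<open>(\<alpha>\<^sub>0 \<and> \<dots>)(v\<^sub>0, \<dots>) = det (\<alpha>\<^sub>i(v\<^sub>j))\<close>.\<close>

definition wedge :: "('v \<Rightarrow> real) list \<Rightarrow> 'v list \<Rightarrow> real" where
  "wedge \<alpha>s vs = (\<Sum>p | p permutes {..<length \<alpha>s}.
     of_int (sign p) * (\<Prod>i<length \<alpha>s. (\<alpha>s ! i) (vs ! p i)))"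

text \<open>
  The positive unit volume form \<open>Y \<and> X \<and> \<epsilon>\<close>: since \<open>Y\<close> and \<open>X\<close> are the lowered inclusions,
  \<open>Y\<close> reads off the component \<open>\<rho>\<close> and \<open>X\<close> the component \<open>\<sigma>\<close>.
\<close>

definition tr_vol :: "real ^ 5 ^ 5 \<Rightarrow> tractor list \<Rightarrow> real" where
  "tr_vol G vs = sqrt \<bar>det G\<bar> * wedge
     ([\<lambda>v. snd (snd v), \<lambda>v. fst v] @ map (\<lambda>i v. fst (snd v) $ i) [1, 2, 3, 4, 5]) vs"

section \<open>Tractor 3-forms and \<open>G\<^sub>2\<close>-structures\<close>

type_synonym form3 = "tractor \<Rightarrow> tractor \<Rightarrow> tractor \<Rightarrow> real"
type_synonym 'm tr3form = "'m metric \<Rightarrow> 'm chart \<Rightarrow> 'm \<Rightarrow> form3"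

definition alternating3 :: "form3 \<Rightarrow> bool" where
  "alternating3 F \<longleftrightarrow>
     (\<forall>u v. linear (\<lambda>x. F x u v) \<and> linear (\<lambda>x. F u x v) \<and> linear (\<lambda>x. F u v x)) \<and>
     (\<forall>u v. F u u v = 0 \<and> F u v u = 0 \<and> F v u u = 0)"

definition tractor_3form :: "'m chart set \<Rightarrow> 'm metric set \<Rightarrow> 'm tr3form \<Rightarrow> bool" where
  "tractor_3form A c \<Phi> \<longleftrightarrow>
     (\<forall>g\<in>c. \<forall>\<kappa>\<in>A. (\<forall>p\<in>dom \<kappa>. alternating3 (\<Phi> g \<kappa> p)) \<and>
        (\<forall>u v w. chart_smooth \<kappa> (dom \<kappa>) (\<lambda>p. \<Phi> g \<kappa> p u v w))) \<and>
     (\<forall>g\<in>c. \<forall>\<kappa>\<in>A. \<forall>\<kappa>'\<in>A. \<forall>p\<in>dom \<kappa> \<inter> dom \<kappa>'. \<forall>u v w.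
        \<Phi> g \<kappa>' p (tr_chart \<kappa> \<kappa>' p u) (tr_chart \<kappa> \<kappa>' p v) (tr_chart \<kappa> \<kappa>' p w) = \<Phi> g \<kappa> p u v w) \<and>
     (\<forall>g\<in>c. \<forall>h\<in>c. \<forall>\<Omega>. rescaled A \<Omega> g h \<longrightarrow> (\<forall>\<kappa>\<in>A. \<forall>p\<in>dom \<kappa>. \<forall>u v w.
        \<Phi> h \<kappa> p (tr_split \<Omega> g \<kappa> p u) (tr_split \<Omega> g \<kappa> p v) (tr_split \<Omega> g \<kappa> p w)
          = \<Phi> g \<kappa> p u v w))"

text \<open>Vanishing of the covariant derivative, by the Leibniz rule on local tractor fields.\<close>

definition parallel3 :: "'m chart set \<Rightarrow> 'm metric set \<Rightarrow> 'm tr3form \<Rightarrow> bool" where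
  "parallel3 A c \<Phi> \<longleftrightarrow> (\<forall>g\<in>c. \<forall>\<kappa>\<in>A. \<forall>S T U.
     chart_smooth \<kappa> (dom \<kappa>) S \<and> chart_smooth \<kappa> (dom \<kappa>) T \<and> chart_smooth \<kappa> (dom \<kappa>) U \<longrightarrow>
     (\<forall>p\<in>dom \<kappa>. \<forall>b. pd \<kappa> (\<lambda>q. \<Phi> g \<kappa> q (S q) (T q) (U q)) b p
        = \<Phi> g \<kappa> p (tr_nabla g \<kappa> S b p) (T p) (U p)
        + \<Phi> g \<kappa> p (S p) (tr_nabla g \<kappa> T b p) (U p)
        + \<Phi> g \<kappa> p (S p) (T p) (tr_nabla g \<kappa> U b p)))"

definition G2_basis ::
    "('v::real_vector \<Rightarrow> 'v \<Rightarrow> 'v \<Rightarrow> real) \<Rightarrow> (nat \<Rightarrow> 'v) \<Rightarrow> (nat \<Rightarrow> 'v \<Rightarrow> real) \<Rightarrow> bool" where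
  "G2_basis F E e \<longleftrightarrow>
     inj_on E {1..7} \<and> independent (E ` {1..7}) \<and> span (E ` {1..7}) = UNIV \<and>
     (\<forall>i\<in>{1..7}. linear (e i) \<and> (\<forall>j\<in>{1..7}. e i (E j) = (if i = j then 1 else 0))) \<and>
     (\<forall>u v w. F u v w =
        - wedge [e 1, e 4, e 7] [u, v, w] + sqrt 2 * wedge [e 1, e 5, e 6] [u, v, w]
        + sqrt 2 * wedge [e 2, e 3, e 7] [u, v, w] + wedge [e 2, e 4, e 5] [u, v, w]
        + wedge [e 3, e 4, e 6] [u, v, w])"

text \<open>The pairings \<open>H\<^sub>\<Phi>(E\<^sub>i, E\<^sub>j)\<close> in an adapted basis.\<close>

definition G2_pairing :: "nat \<Rightarrow> nat \<Rightarrow> real" where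
  "G2_pairing i j =
     (if {i, j} = {1, 7} \<or> {i, j} = {2, 5} \<or> {i, j} = {3, 6} then 1
      else if i = 4 \<and> j = 4 then -1 else 0)"

text \<open>
  A \<open>G\<^sub>2\<close>-structure inducing the tractor metric and the tractor orientation. The last conjunct
  says that \<open>- e\<^bsup>1234567\<^esup>\<close>, whose value on \<open>(E\<^sub>1, \<dots>, E\<^sub>7)\<close> is -1, is a positive multiple of the
  volume form.
\<close>

definition compatible_G2 :: "real ^ 5 ^ 5 \<Rightarrow> form3 \<Rightarrow> bool" where
  "compatible_G2 G F \<longleftrightarrow> (\<exists>E e. G2_basis F E e \<and>
     (\<forall>i\<in>{1..7}. \<forall>j\<in>{1..7}. tr_H G (E i) (E j) = G2_pairing i j) \<and>
     tr_vol G (map E [1, 2, 3, 4, 5, 6, 7]) < 0)"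

definition parallel_compatible_G2 :: "'m chart set \<Rightarrow> 'm metric set \<Rightarrow> 'm tr3form \<Rightarrow> bool" where
  "parallel_compatible_G2 A c \<Phi> \<longleftrightarrow> tractor_3form A c \<Phi> \<and> parallel3 A c \<Phi> \<and>
     (\<forall>g\<in>c. \<forall>\<kappa>\<in>A. \<forall>p\<in>dom \<kappa>. compatible_G2 (cmetric g \<kappa> p) (\<Phi> g \<kappa> p))"

text \<open>
  Projecting part: the coefficient \<open>\<phi>\<^bsub>ab\<^esub>\<close> (weight 3) of \<open>Y\<close>, found by inserting the canonical
  tractor \<open>(0, 0, 1)\<close> first; then the weighted bivector \<open>\<phi>\<^bsup>ab\<^esup>\<close> (weight -1).
\<close>

definition proj_part :: "'m tr3form \<Rightarrow> 'm metric \<Rightarrow> 'm chart \<Rightarrow> 'm \<Rightarrow> real ^ 5 ^ 5" where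
  "proj_part \<Phi> g \<kappa> p = (\<chi> a b. \<Phi> g \<kappa> p (0, 0, 1) (0, axis a 1, 0) (0, axis b 1, 0))"

definition proj_bivector :: "'m tr3form \<Rightarrow> 'm metric \<Rightarrow> 'm chart \<Rightarrow> 'm \<Rightarrow> real ^ 5 ^ 5" where
  "proj_bivector \<Phi> g \<kappa> p = cinv g \<kappa> p ** proj_part \<Phi> g \<kappa> p ** transpose (cinv g \<kappa> p)"

section \<open>Oriented \<open>(2,3,5)\<close> distributions\<close>

text \<open>An oriented plane is represented by the set of its positively oriented frames.\<close>

type_synonym 'm dist2 = "'m chart \<Rightarrow> 'm \<Rightarrow> ((real ^ 5) \<times> (real ^ 5)) set"

definition oriented_plane :: "real ^ 5 \<Rightarrow> real ^ 5 \<Rightarrow> ((real ^ 5) \<times> (real ^ 5)) set" where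
  "oriented_plane u v =
     {(a *\<^sub>R u + b *\<^sub>R v, a' *\<^sub>R u + b' *\<^sub>R v) | a b a' b'. a * b' - b * a' > 0}"

definition plane_of :: "((real ^ 5) \<times> (real ^ 5)) set \<Rightarrow> (real ^ 5) set" where
  "plane_of Q = span (fst ` Q)"

definition oriented_distribution :: "'m::topological_space chart set \<Rightarrow> 'm dist2 \<Rightarrow> bool" where
  "oriented_distribution A D \<longleftrightarrow>
     (\<forall>\<kappa>\<in>A. \<forall>p\<in>dom \<kappa>. \<exists>W X Y. open W \<and> p \<in> W \<and> W \<subseteq> dom \<kappa> \<and>
        chart_smooth \<kappa> W X \<and> chart_smooth \<kappa> W Y \<and>
        (\<forall>q\<in>W. X q \<noteq> Y q \<and> independent {X q, Y q} \<and> D \<kappa> q = oriented_plane (X q) (Y q))) \<and>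
     (\<forall>\<kappa>\<in>A. \<forall>\<kappa>'\<in>A. \<forall>p\<in>dom \<kappa> \<inter> dom \<kappa>'.
        D \<kappa>' p = (\<lambda>(u, v). (jac \<kappa> \<kappa>' p *v u, jac \<kappa> \<kappa>' p *v v)) ` D \<kappa> p)"

definition lie_bracket ::
    "'m chart \<Rightarrow> ('m \<Rightarrow> real ^ 5) \<Rightarrow> ('m \<Rightarrow> real ^ 5) \<Rightarrow> 'm \<Rightarrow> real ^ 5" where
  "lie_bracket \<kappa> X Y p = dird \<kappa> Y (X p) p - dird \<kappa> X (Y p) p"

definition local_section ::
    "'m::topological_space chart \<Rightarrow> ('m \<Rightarrow> (real ^ 5) set) \<Rightarrow> 'm \<Rightarrow> ('m \<Rightarrow> real ^ 5) \<Rightarrow> bool" where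
  "local_section \<kappa> F p X \<longleftrightarrow>
     (\<exists>W. open W \<and> p \<in> W \<and> W \<subseteq> dom \<kappa> \<and> chart_smooth \<kappa> W X \<and> (\<forall>q\<in>W. X q \<in> F q))"

definition bracket_dist ::
    "'m::topological_space chart \<Rightarrow> ('m \<Rightarrow> (real ^ 5) set) \<Rightarrow> ('m \<Rightarrow> (real ^ 5) set) \<Rightarrow>
     'm \<Rightarrow> (real ^ 5) set" where
  "bracket_dist \<kappa> F K p = span (
     {X p | X. local_section \<kappa> F p X} \<union> {Y p | Y. local_section \<kappa> K p Y} \<union>
     {lie_bracket \<kappa> X Y p | X Y. local_section \<kappa> F p X \<and> local_section \<kappa> K p Y})"

definition oriented_235 :: "'m::topological_space chart set \<Rightarrow> 'm dist2 \<Rightarrow> bool" where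
  "oriented_235 A D \<longleftrightarrow> oriented_distribution A D \<and>
     (\<forall>\<kappa>\<in>A. \<forall>p\<in>dom \<kappa>. let F = (\<lambda>q. plane_of (D \<kappa> q)); K = bracket_dist \<kappa> F F in
        dim (K p) = 3 \<and> bracket_dist \<kappa> F K p = UNIV)"

text \<open>
  \<open>bivector_spans \<phi> Q\<close>: the bivector is decomposable, nonzero (as \<open>u\<close> and \<open>v\<close> are
  independent), and spans the oriented plane \<open>Q\<close>.
\<close>

definition bivector_spans :: "real ^ 5 ^ 5 \<Rightarrow> ((real ^ 5) \<times> (real ^ 5)) set \<Rightarrow> bool" where
  "bivector_spans \<phi> Q \<longleftrightarrow> (\<exists>u v. u \<noteq> v \<and> independent {u, v} \<and>
     \<phi> = (\<chi> a b. u $ a * v $ b - u $ b * v $ a) \<and> Q = oriented_plane u v)"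

definition spans_dist :: "'m chart set \<Rightarrow> 'm metric set \<Rightarrow> 'm tr3form \<Rightarrow> 'm dist2 \<Rightarrow> bool" where
  "spans_dist A c \<Phi> D \<longleftrightarrow>
     (\<forall>g\<in>c. \<forall>\<kappa>\<in>A. \<forall>p\<in>dom \<kappa>. bivector_spans (proj_bivector \<Phi> g \<kappa> p) (D \<kappa> p))"

definition G2_of_dist :: "'m chart set \<Rightarrow> 'm metric set \<Rightarrow> 'm dist2 \<Rightarrow> 'm tr3form \<Rightarrow> bool" where
  "G2_of_dist A c D \<Phi> \<longleftrightarrow> parallel_compatible_G2 A c \<Phi> \<and> spans_dist A c \<Phi> D"

text \<open>
  \<open>c\<close>, with the orientation of \<open>A\<close>, is Nurowski's oriented conformal structure of \<open>D\<close>.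
\<close>

definition nurowski :: "'m chart set \<Rightarrow> 'm metric set \<Rightarrow> 'm dist2 \<Rightarrow> bool" where
  "nurowski A c D \<longleftrightarrow> conformal_structure A c \<and> (\<exists>\<Phi>. G2_of_dist A c D \<Phi>)"

section \<open>Almost Einstein scales, the family, and the conformal Killing field\<close>

definition grad_scale :: "'m metric \<Rightarrow> 'm chart \<Rightarrow> 'm density \<Rightarrow> 'm \<Rightarrow> real ^ 5" where
  "grad_scale g \<kappa> \<sigma> p = (\<chi> b. cd_dens g \<kappa> 1 (\<sigma> \<kappa>) b p)"

text \<open>The components of \<open>\<sigma>\<^bsub>,ab\<^esub> + P\<^bsub>ab\<^esub> \<sigma>\<close> and their trace.\<close>

definition ae_tensor :: "'m metric \<Rightarrow> 'm chart \<Rightarrow> 'm density \<Rightarrow> 'm \<Rightarrow> 5 \<Rightarrow> 5 \<Rightarrow> real" where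
  "ae_tensor g \<kappa> \<sigma> p a b =
     cd_covec g \<kappa> 1 (grad_scale g \<kappa> \<sigma>) a b p + schouten g \<kappa> p a b * \<sigma> \<kappa> p"

definition ae_trace :: "'m metric \<Rightarrow> 'm chart \<Rightarrow> 'm density \<Rightarrow> 'm \<Rightarrow> real" where
  "ae_trace g \<kappa> \<sigma> p = (\<Sum>a\<in>UNIV. \<Sum>b\<in>UNIV. cinv g \<kappa> p $ a $ b * ae_tensor g \<kappa> \<sigma> p a b)"

definition almost_einstein :: "'m chart set \<Rightarrow> 'm metric set \<Rightarrow> 'm density \<Rightarrow> bool" where
  "almost_einstein A c \<sigma> \<longleftrightarrow> density A 1 \<sigma> \<and>
     (\<forall>g\<in>c. \<forall>\<kappa>\<in>A. \<forall>p\<in>dom \<kappa>. \<forall>a b.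
        ae_tensor g \<kappa> \<sigma> p a b - (1 / 5) * ae_trace g \<kappa> \<sigma> p * cmetric g \<kappa> p $ a $ b = 0)"

definition scale_tractor :: "'m metric \<Rightarrow> 'm chart \<Rightarrow> 'm density \<Rightarrow> 'm \<Rightarrow> tractor" where
  "scale_tractor g \<kappa> \<sigma> p =
     (\<sigma> \<kappa> p, cinv g \<kappa> p *v grad_scale g \<kappa> \<sigma> p, - (1 / 5) * ae_trace g \<kappa> \<sigma> p)"

text \<open>The wedge product of a 1-form and a 3-form.\<close>

definition wedge13 ::
    "(tractor \<Rightarrow> real) \<Rightarrow> form3 \<Rightarrow> tractor \<Rightarrow> tractor \<Rightarrow> tractor \<Rightarrow> tractor \<Rightarrow> real" where
  "wedge13 \<alpha> F t u v w =
     \<alpha> t * F u v w - \<alpha> u * F t v w + \<alpha> v * F t u w - \<alpha> w * F t u v"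

text \<open>
  Hodge dual of a 3-form: \<open>\<star>F\<^bsub>DEFG\<^esub> = (1/3!) F\<^bsup>ABC\<^esup> vol\<^bsub>ABCDEFG\<^esub>\<close>, where the functional
  \<open>v \<mapsto> x \<bullet> v\<close> is the dual basis covector of the basis vector \<open>x\<close>.
\<close>

definition hodge3 ::
    "real ^ 5 ^ 5 \<Rightarrow> form3 \<Rightarrow> tractor \<Rightarrow> tractor \<Rightarrow> tractor \<Rightarrow> tractor \<Rightarrow> real" where
  "hodge3 G F t u v w = (1 / 6) * (\<Sum>x\<in>Basis. \<Sum>y\<in>Basis. \<Sum>z\<in>Basis.
     F (tr_sharp G x) (tr_sharp G y) (tr_sharp G z) * tr_vol G [x, y, z, t, u, v, w])"

definition deform3 :: "real ^ 5 ^ 5 \<Rightarrow> real \<Rightarrow> real \<Rightarrow> tractor \<Rightarrow> form3 \<Rightarrow> form3" where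
  "deform3 G a b S F = (\<lambda>u v w.
     F u v w + a * wedge13 (tr_H G S) F S u v w + b * hodge3 G F S u v w)"

text \<open>
  The scaling of the parallel tractor with \<open>\<epsilon> \<in> {-1, 0, 1}\<close> is done by the constant \<open>k\<close>, so
  that \<open>\<sigma>\<close> itself need not be normalised. For \<open>\<epsilon> = 0\<close>, where \<open>k\<close> is arbitrary, the
  substitution of \<open>(k\<^sup>2 a, k b)\<close> for \<open>(a, b)\<close> shows that the family does not depend on \<open>k\<close>.
\<close>

definition family :: "'m::topological_space chart set \<Rightarrow> 'm metric set \<Rightarrow> 'm dist2 \<Rightarrow> 'm density \<Rightarrow>
    'm dist2 set" where
  "family A c D \<sigma> = {D'. oriented_235 A D' \<and>
     (\<exists>\<Phi> \<Phi>' k \<epsilon> a b. G2_of_dist A c D \<Phi> \<and> k > 0 \<and> \<epsilon> \<in> {-1, 0, 1} \<and>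
        (\<forall>g\<in>c. \<forall>\<kappa>\<in>A. \<forall>p\<in>dom \<kappa>. let S = k *\<^sub>R scale_tractor g \<kappa> \<sigma> p in
           \<epsilon> = - tr_H (cmetric g \<kappa> p) S S) \<and>
        - \<epsilon> * a\<^sup>2 + 2 * a + b\<^sup>2 = 0 \<and>
        (\<forall>g\<in>c. \<forall>\<kappa>\<in>A. \<forall>p\<in>dom \<kappa>. \<Phi>' g \<kappa> p =
           deform3 (cmetric g \<kappa> p) a b (k *\<^sub>R scale_tractor g \<kappa> \<sigma> p) (\<Phi> g \<kappa> p)) \<and>
        parallel_compatible_G2 A c \<Phi>' \<and> spans_dist A c \<Phi>' D')}"

definition killing_formula ::
    "'m metric \<Rightarrow> 'm tr3form \<Rightarrow> 'm density \<Rightarrow> 'm chart \<Rightarrow> 'm \<Rightarrow> real ^ 5" where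
  "killing_formula g \<Phi> \<sigma> \<kappa> p = (let \<phi> = proj_bivector \<Phi> g \<kappa> in
     (\<chi> a. - (\<Sum>b\<in>UNIV. \<phi> p $ a $ b * grad_scale g \<kappa> \<sigma> p $ b)
           + (1 / 4) * (\<Sum>b\<in>UNIV. cd_biv g \<kappa> (-1) \<phi> a b b p) * \<sigma> \<kappa> p))"

text \<open>
  \<open>\<xi>\<close> is the field determined by \<open>(D, \<sigma>)\<close>, for some choice of the metric \<open>g \<in> c\<close>
  in the formula.
\<close>

definition determined_field ::
    "'m chart set \<Rightarrow> 'm metric set \<Rightarrow> 'm dist2 \<Rightarrow> 'm density \<Rightarrow> 'm vfield \<Rightarrow> bool" where
  "determined_field A c D \<sigma> \<xi> \<longleftrightarrow> (\<exists>\<Phi> g. G2_of_dist A c D \<Phi> \<and> g \<in> c \<and>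
     (\<forall>\<kappa>\<in>A. \<forall>p\<in>dom \<kappa>. \<xi> \<kappa> p = killing_formula g \<Phi> \<sigma> \<kappa> p))"

definition coincide :: "'m chart set \<Rightarrow> 'm vfield \<Rightarrow> 'm vfield \<Rightarrow> bool" where
  "coincide A \<xi> \<xi>' \<longleftrightarrow> (\<forall>\<kappa>\<in>A. \<forall>p\<in>dom \<kappa>. \<xi> \<kappa> p = \<xi>' \<kappa> p)"

definition nonzero_locus :: "'m chart set \<Rightarrow> 'm vfield \<Rightarrow> 'm set" where
  "nonzero_locus A \<xi> = {p. \<exists>\<kappa>\<in>A. p \<in> dom \<kappa> \<and> \<xi> \<kappa> p \<noteq> 0}"

definition line_field :: "'m vfield \<Rightarrow> 'm chart \<Rightarrow> 'm \<Rightarrow> (real ^ 5) set" where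
  "line_field \<xi> \<kappa> p = span {\<xi> \<kappa> p}"

definition hyperplane_field :: "'m metric set \<Rightarrow> 'm vfield \<Rightarrow> 'm chart \<Rightarrow> 'm \<Rightarrow> (real ^ 5) set" where
  "hyperplane_field c \<xi> \<kappa> p = {v. \<forall>g\<in>c. \<forall>l\<in>line_field \<xi> \<kappa> p. v \<bullet> (g \<kappa> p *v l) = 0}"

end

theory Submission
  imports Defs
begin

text \<open>Both \<open>family\<close> and \<open>determined_field\<close> quantify existentially
  over the 3-form, and the latter also over the metric. So the pointwise identity for the
  deformation has to be supplemented by uniqueness of the form and independence of the metric. The
  1/4 in the formula for the field is 1/(5 - 1): the derivative of \<open>\<phi>\<close> is a skew
  part plus metric times \<open>\<theta>\<close>, and its trace is 4 times \<open>\<theta>\<close>.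
  Compatibility forces the factor 1 because \<open>H\<close> fixes the norm of the cross product,
  which scales by the square of the factor; the sign comes from the orientation of \<open>D\<close>.
  For the second part the main object is the field lowered by \<open>g\<close>, an ordinary 1-form.
  Inserting \<open>X\<close> removes the third slot of \<open>S\<close> from it, so it transforms
  correctly once the first two slots do; its curl then shows the error in the third slot multiplied
  by \<open>\<phi>\<close>, which vanishes nowhere. When the curl is differentiated, the
  Christoffel, metric and Schouten terms cancel by symmetry, leaving \<open>\<lambda>\<close> wedge
  \<open>\<phi>\<close>. Finally \<open>\<lambda>\<close> lies in the image of
  \<open>\<phi>\<close>, and nullity of \<open>D\<close> makes it annihilate
  \<open>D\<close>.\<close>

text \<open>
  Write \<open>X\<close> for the canonical tractor and \<open>S\<close> for the scale tractor. Since \<open>\<Phi>\<close> is parallel, the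
  divergence of \<open>\<phi>\<close> is a contraction of \<open>\<Phi>\<close>, and \<open>\<xi>\<close> turns out to be the raised 1-form
  \<open>\<Phi>(X, S, \<cdot>)\<close>. The deformation of \<open>\<Phi>\<close> only adds terms into which \<open>S\<close> is inserted twice, so it does
  not change \<open>\<xi>\<close>. That \<open>\<xi>\<close> depends on the distribution only follows from the uniqueness of \<open>\<Phi>\<close>: two
  parallel forms with proportional projecting parts are proportional, because the conformal Killing
  equation for \<open>\<phi>\<close> forces the factor to be constant, and the compatibility with \<open>H\<close> fixes it to 1.

  For the second part one needs that every distribution belongs to its own family, that is, that
  \<open>H(S, S)\<close> is constant and independent of the metric and the chart. The exterior derivative of
  \<open>\<Phi>(X, S, \<cdot>)\<close> is a multiple of \<open>\<Phi>(\<cdot>, \<cdot>, S)\<close>, which determines the last slot of \<open>S\<close> without curvature and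
  so gives its transformation law. Differentiating once more shows that \<open>\<nabla>S = \<lambda> X\<close> with \<open>\<lambda> \<and> \<phi> = 0\<close>;
  hence the differential of \<open>H(S, S)\<close> annihilates \<open>D\<close>, which is bracket generating. This replaces the
  contracted Bianchi identity.
\<close>

section \<open>Calculus in a chart\<close>

lemma frechet_eq: "(f has_derivative f') (at x) \<Longrightarrow> frechet_derivative f (at x) = f'"
  by (simp add: frechet_derivative_at[symmetric])

lemma frechet_cong:
  assumes "open S" "x \<in> S" "\<And>y. y \<in> S \<Longrightarrow> f y = g y" "f differentiable (at x)"
  shows "frechet_derivative f (at x) = frechet_derivative g (at x)"
  using frechet_derivative_transform_within_open[OF assms(4,1,2)] assms(3) by blast

lemma differentiable_cong_open:
  assumes "open S" "x \<in> S" "\<And>y. y \<in> S \<Longrightarrow> f y = g y" "f differentiable (at x)"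
  shows "g differentiable (at x)"
  using assms(4) has_derivative_transform_within_open[OF _ assms(1,2), of f _ UNIV g] assms(3)
  unfolding differentiable_def by blast

text \<open>A derivative at a point of an open set depends only on the values in that set. Later
  lemmas use this to replace an abstract derivative by its explicit formula on the set.\<close>

lemma Ck_on_cong:
  assumes "open S" "\<And>x. x \<in> S \<Longrightarrow> f x = g x" "Ck_on k S f"
  shows "Ck_on k S g"
  using assms(2,3)
proof (induction k arbitrary: f g)
  case 0
  then show ?case by (simp cong: continuous_on_cong)
next
  case (Suc k)
  have d: "\<And>x. x \<in> S \<Longrightarrow> f differentiable (at x)" using Suc.prems by simp
  have "g differentiable (at x)" if "x \<in> S" for x
    using differentiable_cong_open[OF assms(1) that Suc.prems(1) d[OF that]] .
  moreover have "Ck_on k S (\<lambda>x. frechet_derivative g (at x) (axis i 1))" for i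
  proof (rule Suc.IH[of "\<lambda>x. frechet_derivative f (at x) (axis i 1)"])
    show "frechet_derivative f (at x) (axis i 1) = frechet_derivative g (at x) (axis i 1)"
      if "x \<in> S" for x
      using frechet_cong[OF assms(1) that Suc.prems(1) d[OF that]] by simp
    show "Ck_on k S (\<lambda>x. frechet_derivative f (at x) (axis i 1))" using Suc.prems by simp
  qed
  ultimately show ?case by simp
qed

lemma Ck_on_SucD: "Ck_on (Suc k) S f \<Longrightarrow> Ck_on k S f"
proof (induction k arbitrary: f)
  case 0
  then show ?case
    by (auto intro!: continuous_at_imp_continuous_on differentiable_imp_continuous_within)
next
  case (Suc k)
  then show ?case by auto
qed

lemma Ck_on_bounded_linear:
  assumes "open S" "bounded_linear h" "Ck_on k S f"
  shows "Ck_on k S (\<lambda>x. h (f x))"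
  using assms(3)
proof (induction k arbitrary: f)
  case 0
  then show ?case using assms(2)
    by (simp add: bounded_linear.continuous_on)
next
  case (Suc k)
  have hd: "((\<lambda>x. h (f x)) has_derivative (\<lambda>v. h (frechet_derivative f (at x) v))) (at x)"
    if "x \<in> S" for x
    using Suc.prems that bounded_linear.has_derivative[OF assms(2)]
    by (auto simp: frechet_derivative_works)
  have "Ck_on k S (\<lambda>x. frechet_derivative (\<lambda>x. h (f x)) (at x) (axis i 1))" for i
    by (rule Ck_on_cong[OF assms(1) _ Suc.IH[of "\<lambda>x. frechet_derivative f (at x) (axis i 1)"]])
       (use Suc.prems frechet_eq[OF hd] in auto)
  then show ?case using hd by (auto simp: differentiable_def)
qed

lemma frechet_const: "frechet_derivative (\<lambda>x. c) (at x) = (\<lambda>v. 0)"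
  by (rule frechet_eq) simp

lemma Ck_on_const: "Ck_on k S (\<lambda>x. c)"
  by (induction k arbitrary: c) (simp_all add: frechet_const)

lemma Ck_on_add:
  assumes "open S" "Ck_on k S f" "Ck_on k S g"
  shows "Ck_on k S (\<lambda>x. f x + g x)"
  using assms(2,3)
proof (induction k arbitrary: f g)
  case 0
  then show ?case by (simp add: continuous_on_add)
next
  case (Suc k)
  have hd: "((\<lambda>x. f x + g x) has_derivative
      (\<lambda>v. frechet_derivative f (at x) v + frechet_derivative g (at x) v)) (at x)"
    if "x \<in> S" for x
    using Suc.prems that by (auto simp: frechet_derivative_works intro!: has_derivative_add)
  have "Ck_on k S (\<lambda>x. frechet_derivative (\<lambda>x. f x + g x) (at x) (axis i 1))" for i
    by (rule Ck_on_cong[OF assms(1) _ Suc.IH[of "\<lambda>x. frechet_derivative f (at x) (axis i 1)"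
            "\<lambda>x. frechet_derivative g (at x) (axis i 1)"]])
       (use Suc.prems frechet_eq[OF hd] in auto)
  then show ?case using hd by (auto simp: differentiable_def)
qed

lemma Ck_on_mult:
  fixes f g :: "real ^ 'n \<Rightarrow> real"
  assumes "open S" "Ck_on k S f" "Ck_on k S g"
  shows "Ck_on k S (\<lambda>x. f x * g x)"
  using assms(2,3)
proof (induction k arbitrary: f g)
  case 0
  then show ?case by (simp add: continuous_on_mult)
next
  case (Suc k)
  have hd: "((\<lambda>x. f x * g x) has_derivative
      (\<lambda>v. f x * frechet_derivative g (at x) v + frechet_derivative f (at x) v * g x)) (at x)"
    if "x \<in> S" for x
    using Suc.prems that by (auto simp: frechet_derivative_works intro!: has_derivative_mult)
  have "Ck_on k S (\<lambda>x. f x * frechet_derivative g (at x) (axis i 1)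
      + frechet_derivative f (at x) (axis i 1) * g x)" for i
    using Suc.prems Ck_on_SucD[of k S f] Ck_on_SucD[of k S g]
    by (intro Ck_on_add[OF assms(1)] Suc.IH) simp_all
  then have "Ck_on k S (\<lambda>x. frechet_derivative (\<lambda>x. f x * g x) (at x) (axis i 1))" for i
    by (rule Ck_on_cong[OF assms(1), rotated]) (use frechet_eq[OF hd] in auto)
  then show ?case using hd by (auto simp: differentiable_def)
qed

lemma Ck_on_inverse:
  fixes f :: "real ^ 'n \<Rightarrow> real"
  assumes "open S" "\<And>x. x \<in> S \<Longrightarrow> f x \<noteq> 0" "Ck_on k S f"
  shows "Ck_on k S (\<lambda>x. inverse (f x))"
  using assms(3)
proof (induction k)
  case 0
  then show ?case using assms(2) by (auto simp: continuous_on_inverse)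
next
  case (Suc k)
  have hd: "((\<lambda>x. inverse (f x)) has_derivative
      (\<lambda>v. - (inverse (f x) * frechet_derivative f (at x) v * inverse (f x)))) (at x)"
    if "x \<in> S" for x
    using Suc.prems that assms(2)[OF that]
    by (auto simp: frechet_derivative_works intro!: has_derivative_inverse)
  have "Ck_on k S (\<lambda>x. - 1 * (inverse (f x) * frechet_derivative f (at x) (axis i 1) * inverse (f x)))" for i
    using Suc.prems Suc.IH Ck_on_SucD[of k S f]
    by (intro Ck_on_mult[OF assms(1)] Ck_on_const) simp_all
  then have "Ck_on k S (\<lambda>x. frechet_derivative (\<lambda>x. inverse (f x)) (at x) (axis i 1))" for i
    by (rule Ck_on_cong[OF assms(1), rotated]) (use frechet_eq[OF hd] in auto)
  then show ?case using hd by (auto simp: differentiable_def)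
qed

text \<open>Writing the power of exponent \<open>a - 1\<close> as a power of exponent
  \<open>a\<close> times an inverse keeps the exponent fixed, so the induction in
  \<open>Ck_on_powr\<close> closes.\<close>

lemma has_derivative_powr_pos:
  assumes "(f has_derivative f') (at x)" "f x > (0::real)"
  shows "((\<lambda>x. f x powr a) has_derivative (\<lambda>v. a * (f x powr a * inverse (f x)) * f' v)) (at x)"
  by (rule has_derivative_eq_rhs[OF has_derivative_powr[OF assms(1) has_derivative_const assms(2)]])
     (use assms(2) in \<open>auto simp: fun_eq_iff field_simps\<close>)

lemma Ck_on_powr:
  fixes f :: "real ^ 'n \<Rightarrow> real"
  assumes "open S" "\<And>x. x \<in> S \<Longrightarrow> f x > 0" "Ck_on k S f"
  shows "Ck_on k S (\<lambda>x. f x powr a)"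
  using assms(3)
proof (induction k)
  case 0
  then show ?case using assms(2)
    by (force intro!: continuous_on_powr continuous_on_const)
next
  case (Suc k)
  have hd: "((\<lambda>x. f x powr a) has_derivative
      (\<lambda>v. a * (f x powr a * inverse (f x)) * frechet_derivative f (at x) v)) (at x)"
    if "x \<in> S" for x
    using Suc.prems that assms(2)[OF that]
    by (auto simp: frechet_derivative_works intro!: has_derivative_powr_pos)
  have "Ck_on k S (\<lambda>x. a * (f x powr a * inverse (f x)) * frechet_derivative f (at x) (axis i 1))" for i
    using Suc.prems Suc.IH Ck_on_SucD[of k S f] assms(2)
    by (intro Ck_on_mult[OF assms(1)] Ck_on_const Ck_on_inverse[OF assms(1)]) force+
  then have "Ck_on k S (\<lambda>x. frechet_derivative (\<lambda>x. f x powr a) (at x) (axis i 1))" for i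
    by (rule Ck_on_cong[OF assms(1), rotated]) (use frechet_eq[OF hd] in auto)
  then show ?case using hd by (auto simp: differentiable_def)
qed

lemma Ck_on_subset: "Ck_on k S f \<Longrightarrow> T \<subseteq> S \<Longrightarrow> Ck_on k T f"
  by (induction k arbitrary: f) (simp_all add: continuous_on_subset subset_iff)

text \<open>The two mean value points come from the second difference quotient of \<open>f\<close>, read in the two orders.\<close>

lemma mixed_difference_mvt:
  fixes f :: "real ^ 'n \<Rightarrow> real"
  assumes "h > 0"
    and inS: "\<And>s t. 0 \<le> s \<Longrightarrow> s \<le> h \<Longrightarrow> 0 \<le> t \<Longrightarrow> t \<le> h \<Longrightarrow> x + s *\<^sub>R u + t *\<^sub>R v \<in> S"
    and df: "\<And>y. y \<in> S \<Longrightarrow> f differentiable (at y)"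
    and ddf: "\<And>y. y \<in> S \<Longrightarrow> (\<lambda>y. frechet_derivative f (at y) u) differentiable (at y)"
  shows "\<exists>s t. 0 < s \<and> s < h \<and> 0 < t \<and> t < h \<and>
     f (x + h *\<^sub>R u + h *\<^sub>R v) - f (x + h *\<^sub>R u) - f (x + h *\<^sub>R v) + f x
      = h * (h * frechet_derivative (\<lambda>y. frechet_derivative f (at y) u) (at (x + s *\<^sub>R u + t *\<^sub>R v)) v)"
proof -
  let ?f1 = "\<lambda>y. frechet_derivative f (at y) u"
  define F where "F s = f (x + s *\<^sub>R u + h *\<^sub>R v) - f (x + s *\<^sub>R u)" for s
  have dF: "(F has_real_derivative ?f1 (x + s *\<^sub>R u + h *\<^sub>R v) - ?f1 (x + s *\<^sub>R u)) (at s)"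
    if "0 \<le> s" "s \<le> h" for s
  proof -
    have 1: "(f has_derivative frechet_derivative f (at (x + s *\<^sub>R u + h *\<^sub>R v))) (at (x + s *\<^sub>R u + h *\<^sub>R v))"
      using df[OF inS[of s h]] that assms(1) by (simp add: frechet_derivative_works)
    have 2: "(f has_derivative frechet_derivative f (at (x + s *\<^sub>R u))) (at (x + s *\<^sub>R u))"
      using df[of "x + s *\<^sub>R u"] inS[of s 0] that assms(1) by (simp add: frechet_derivative_works)
    have "((\<lambda>s. f (x + s *\<^sub>R u + h *\<^sub>R v)) has_derivative
        (\<lambda>r. frechet_derivative f (at (x + s *\<^sub>R u + h *\<^sub>R v)) (r *\<^sub>R u))) (at s)"
      by (rule has_derivative_compose[of "\<lambda>s. x + s *\<^sub>R u + h *\<^sub>R v", OF _ 1])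
         (auto intro!: derivative_eq_intros)
    moreover have "((\<lambda>s. f (x + s *\<^sub>R u)) has_derivative
        (\<lambda>r. frechet_derivative f (at (x + s *\<^sub>R u)) (r *\<^sub>R u))) (at s)"
      by (rule has_derivative_compose[of "\<lambda>s. x + s *\<^sub>R u", OF _ 2])
         (auto intro!: derivative_eq_intros)
    ultimately have "(F has_derivative (\<lambda>r. frechet_derivative f (at (x + s *\<^sub>R u + h *\<^sub>R v)) (r *\<^sub>R u)
        - frechet_derivative f (at (x + s *\<^sub>R u)) (r *\<^sub>R u))) (at s)"
      unfolding F_def[abs_def] by (rule has_derivative_diff)
    then show ?thesis
      unfolding has_field_derivative_def
      by (rule has_derivative_eq_rhs)
         (simp add: fun_eq_iff left_diff_distrib right_diff_distrib linear_cmul[OF has_derivative_linear[OF 1]]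
           linear_cmul[OF has_derivative_linear[OF 2]])
  qed
  obtain s where s: "0 < s" "s < h"
    "F h - F 0 = h * (?f1 (x + s *\<^sub>R u + h *\<^sub>R v) - ?f1 (x + s *\<^sub>R u))"
    using MVT2[OF assms(1), of F "\<lambda>s. ?f1 (x + s *\<^sub>R u + h *\<^sub>R v) - ?f1 (x + s *\<^sub>R u)"] dF by auto
  have dG: "((\<lambda>t. ?f1 (x + s *\<^sub>R u + t *\<^sub>R v)) has_real_derivative
      frechet_derivative ?f1 (at (x + s *\<^sub>R u + t *\<^sub>R v)) v) (at t)"
    if "0 \<le> t" "t \<le> h" for t
  proof -
    have 1: "(?f1 has_derivative frechet_derivative ?f1 (at (x + s *\<^sub>R u + t *\<^sub>R v))) (at (x + s *\<^sub>R u + t *\<^sub>R v))"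
      by (rule frechet_derivative_works[THEN iffD1, OF ddf[OF inS]]) (use that s in auto)
    have "((\<lambda>t. ?f1 (x + s *\<^sub>R u + t *\<^sub>R v)) has_derivative
        (\<lambda>r. frechet_derivative ?f1 (at (x + s *\<^sub>R u + t *\<^sub>R v)) (r *\<^sub>R v))) (at t)"
      by (rule has_derivative_compose[of "\<lambda>t. x + s *\<^sub>R u + t *\<^sub>R v", OF _ 1])
         (auto intro!: derivative_eq_intros)
    then show ?thesis
      unfolding has_field_derivative_def
      by (rule has_derivative_eq_rhs)
         (simp add: fun_eq_iff mult.commute linear_cmul[OF has_derivative_linear[OF 1]])
  qed
  obtain t where t: "0 < t" "t < h"
    "?f1 (x + s *\<^sub>R u + h *\<^sub>R v) - ?f1 (x + s *\<^sub>R u + 0 *\<^sub>R v)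
      = h * frechet_derivative ?f1 (at (x + s *\<^sub>R u + t *\<^sub>R v)) v"
    using MVT2[OF assms(1), of "\<lambda>t. ?f1 (x + s *\<^sub>R u + t *\<^sub>R v)"
        "\<lambda>t. frechet_derivative ?f1 (at (x + s *\<^sub>R u + t *\<^sub>R v)) v"] dG by auto
  show ?thesis
    using s t by (intro exI[of _ s] exI[of _ t]) (auto simp: F_def algebra_simps)
qed

text \<open>The same second difference equals each of the two mixed derivatives at some nearby
  point; continuity carries the equality to \<open>x\<close> itself.\<close>

lemma Ck_on_2_mixed_partials:
  fixes f :: "real ^ 'n \<Rightarrow> real"
  assumes "open S" "Ck_on 2 S f" "x \<in> S"
  shows "frechet_derivative (\<lambda>y. frechet_derivative f (at y) (axis i 1)) (at x) (axis j 1)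
       = frechet_derivative (\<lambda>y. frechet_derivative f (at y) (axis j 1)) (at x) (axis i 1)"
proof -
  let ?d = "\<lambda>i j y. frechet_derivative (\<lambda>y. frechet_derivative f (at y) (axis i 1)) (at y) (axis j 1)"
  have c: "continuous_on S (?d i j)" for i j using assms(2) by (simp add: numeral_2_eq_2)
  have df: "\<And>y. y \<in> S \<Longrightarrow> f differentiable (at y)" using assms(2) by (simp add: numeral_2_eq_2)
  have ddf: "\<And>y i. y \<in> S \<Longrightarrow> (\<lambda>y. frechet_derivative f (at y) (axis i 1)) differentiable (at y)"
    using assms(2) by (simp add: numeral_2_eq_2)
  have "\<bar>?d i j x - ?d j i x\<bar> \<le> e" if "e > 0" for e
  proof -
    obtain d1 where d1: "d1 > 0" "\<And>y. y \<in> S \<Longrightarrow> dist y x < d1 \<Longrightarrow> dist (?d i j y) (?d i j x) < e/2"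
      using c[of i j] assms(3) \<open>e > 0\<close> unfolding continuous_on_iff by (metis half_gt_zero)
    obtain d2 where d2: "d2 > 0" "\<And>y. y \<in> S \<Longrightarrow> dist y x < d2 \<Longrightarrow> dist (?d j i y) (?d j i x) < e/2"
      using c[of j i] assms(3) \<open>e > 0\<close> unfolding continuous_on_iff by (metis half_gt_zero)
    obtain d3 where d3: "d3 > 0" "ball x d3 \<subseteq> S" using assms(1,3) openE by blast
    \<comment> \<open>Points of the square of side \<open>h\<close> are at most \<open>2 * h\<close>
      away from \<open>x\<close>; the divisor 3 keeps them strictly inside all three radii.\<close>
    define h where "h = min d1 (min d2 d3) / 3"
    have h: "h > 0" using d1 d2 d3 by (simp add: h_def)
    have near: "dist (x + s *\<^sub>R axis k 1 + t *\<^sub>R axis l (1::real)) x < min d1 (min d2 d3)"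
      if "0 \<le> s" "s \<le> h" "0 \<le> t" "t \<le> h" for s t and k l :: 'n
    proof -
      have "dist (x + s *\<^sub>R axis k 1 + t *\<^sub>R axis l (1::real)) x \<le> norm (s *\<^sub>R axis k (1::real) :: real^'n) + norm (t *\<^sub>R axis l (1::real) :: real^'n)"
        by (simp add: dist_norm norm_triangle_ineq add.assoc del: norm_scaleR)
      also have "\<dots> \<le> h + h" using that by (simp add: norm_axis_1)
      also have "\<dots> < 3 * h" using h by simp
      also have "\<dots> = min d1 (min d2 d3)" by (simp add: h_def)
      finally show ?thesis .
    qed
    have inS: "x + s *\<^sub>R axis k 1 + t *\<^sub>R axis l (1::real) \<in> S"
      if "0 \<le> s" "s \<le> h" "0 \<le> t" "t \<le> h" for s t k l
      using near[OF that, of k l] d3(2) by (auto simp: dist_commute subset_iff)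
    obtain s t where st: "0 < s" "s < h" "0 < t" "t < h"
      "f (x + h *\<^sub>R axis i 1 + h *\<^sub>R axis j 1) - f (x + h *\<^sub>R axis i 1) - f (x + h *\<^sub>R axis j 1) + f x
      = h * (h * ?d i j (x + s *\<^sub>R axis i 1 + t *\<^sub>R axis j 1))"
      using mixed_difference_mvt[of h x "axis i 1" "axis j 1" S f, OF h inS df ddf] by blast
    obtain s' t' where st': "0 < s'" "s' < h" "0 < t'" "t' < h"
      "f (x + h *\<^sub>R axis j 1 + h *\<^sub>R axis i 1) - f (x + h *\<^sub>R axis j 1) - f (x + h *\<^sub>R axis i 1) + f x
      = h * (h * ?d j i (x + s' *\<^sub>R axis j 1 + t' *\<^sub>R axis i 1))"
      using mixed_difference_mvt[of h x "axis j 1" "axis i 1" S f, OF h inS df ddf] by blast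
    have "h * (h * ?d i j (x + s *\<^sub>R axis i 1 + t *\<^sub>R axis j 1))
        = h * (h * ?d j i (x + s' *\<^sub>R axis j 1 + t' *\<^sub>R axis i 1))"
      unfolding st(5)[symmetric] st'(5)[symmetric] by (simp add: algebra_simps)
    then have "?d i j (x + s *\<^sub>R axis i 1 + t *\<^sub>R axis j 1) = ?d j i (x + s' *\<^sub>R axis j 1 + t' *\<^sub>R axis i 1)"
      using h by simp
    moreover have "dist (?d i j (x + s *\<^sub>R axis i 1 + t *\<^sub>R axis j 1)) (?d i j x) < e/2"
      using st near[of s t i j] inS[of s t i j] by (intro d1) auto
    moreover have "dist (?d j i (x + s' *\<^sub>R axis j 1 + t' *\<^sub>R axis i 1)) (?d j i x) < e/2"
      using st' near[of s' t' j i] inS[of s' t' j i] by (intro d2) auto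
    ultimately show ?thesis unfolding dist_real_def by (smt (verit) field_sum_of_halves)
  qed
  then have "\<bar>?d i j x - ?d j i x\<bar> \<le> 0 + e" if "e > 0" for e using that by simp
  then have "\<bar>?d i j x - ?d j i x\<bar> \<le> 0" by (rule field_le_epsilon)
  then show ?thesis by simp
qed

text \<open>\<open>W\<close> may be smaller than the chart domain, so that the same calculus serves
  overlaps of two charts and neighbourhoods of local sections. \<open>chart_inv\<close> remains the
  inverse on the full domain and is a left inverse on \<open>W\<close>.\<close>

locale chart_open =
  fixes \<kappa> :: "'m chart" and W :: "'m set"
  assumes open_image: "open (coord \<kappa> ` W)"
    and inv_coord: "p \<in> W \<Longrightarrow> chart_inv \<kappa> (coord \<kappa> p) = p"
begin

abbreviation sm :: "('m \<Rightarrow> 'b::real_normed_vector) \<Rightarrow> bool" where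
  "sm f \<equiv> chart_smooth \<kappa> W f"

lemma coord_inv: "x \<in> coord \<kappa> ` W \<Longrightarrow> coord \<kappa> (chart_inv \<kappa> x) = x"
  using inv_coord by auto

lemma inv_in: "x \<in> coord \<kappa> ` W \<Longrightarrow> chart_inv \<kappa> x \<in> W"
  using inv_coord by auto

lemma sm_iff: "sm f \<longleftrightarrow> (\<forall>k. Ck_on k (coord \<kappa> ` W) (\<lambda>x. f (chart_inv \<kappa> x)))"
  by (simp add: chart_smooth_def smooth_on_def comp_def)

lemma sm_cong:
  assumes "sm f" "\<And>p. p \<in> W \<Longrightarrow> f p = g p" shows "sm g"
  unfolding sm_iff
proof
  fix k show "Ck_on k (coord \<kappa> ` W) (\<lambda>x. g (chart_inv \<kappa> x))"
    by (rule Ck_on_cong[OF open_image, of "\<lambda>x. f (chart_inv \<kappa> x)"])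
       (use assms inv_in sm_iff in blast)+
qed

lemma sm_const: "sm (\<lambda>p. c)" by (simp add: sm_iff Ck_on_const)

lemma sm_add: "sm f \<Longrightarrow> sm g \<Longrightarrow> sm (\<lambda>p. f p + g p)"
  by (simp add: sm_iff Ck_on_add[OF open_image])

lemma sm_mult: "sm f \<Longrightarrow> sm g \<Longrightarrow> sm (\<lambda>p. f p * g p :: real)"
  by (simp add: sm_iff Ck_on_mult[OF open_image])

lemma sm_bounded_linear: "bounded_linear h \<Longrightarrow> sm f \<Longrightarrow> sm (\<lambda>p. h (f p))"
  using Ck_on_bounded_linear[OF open_image, of h _ "\<lambda>x. f (chart_inv \<kappa> x)"] by (auto simp: sm_iff)

lemma sm_minus: "sm f \<Longrightarrow> sm (\<lambda>p. - f p)"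
  by (rule sm_bounded_linear[OF bounded_linear_minus[OF bounded_linear_ident]])

lemma sm_diff: "sm f \<Longrightarrow> sm g \<Longrightarrow> sm (\<lambda>p. f p - g p)"
  using sm_add[of f "\<lambda>p. - g p"] sm_minus[of g] by simp

lemma sm_sum: "(\<And>i. i \<in> I \<Longrightarrow> sm (f i)) \<Longrightarrow> sm (\<lambda>p. \<Sum>i\<in>I. f i p)"
  by (induction I rule: infinite_finite_induct) (simp_all add: sm_const sm_add)

lemma sm_prod: "(\<And>i. i \<in> I \<Longrightarrow> sm (f i)) \<Longrightarrow> sm (\<lambda>p. \<Prod>i\<in>I. f i p :: real)"
  by (induction I rule: infinite_finite_induct) (simp_all add: sm_const sm_mult)

lemma sm_component: "sm f \<Longrightarrow> sm (\<lambda>p. f p $ i)"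
  by (rule sm_bounded_linear[OF bounded_linear_vec_nth])

lemma sm_inverse: "sm f \<Longrightarrow> (\<And>p. p \<in> W \<Longrightarrow> f p \<noteq> 0) \<Longrightarrow> sm (\<lambda>p. inverse (f p) :: real)"
  using inv_in by (auto simp: sm_iff intro!: Ck_on_inverse[OF open_image])

lemma sm_powr: "sm (f :: 'm \<Rightarrow> real) \<Longrightarrow> (\<And>p. p \<in> W \<Longrightarrow> f p > 0) \<Longrightarrow> sm (\<lambda>p. f p powr a)"
  using inv_in Ck_on_powr[OF open_image, of "\<lambda>x. f (chart_inv \<kappa> x)"] by (auto simp: sm_iff)

lemma sm_scaleR_const: "sm f \<Longrightarrow> sm (\<lambda>p. f p *\<^sub>R c)"
  by (rule sm_bounded_linear[OF bounded_linear_scaleR_left])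

lemma sm_vec:
  fixes f :: "'m \<Rightarrow> real ^ 'k" assumes "\<And>i. sm (\<lambda>p. f p $ i)" shows "sm f"
proof -
  have "sm (\<lambda>p. \<Sum>i\<in>UNIV. f p $ i *\<^sub>R (axis i 1 :: real ^ 'k))" by (intro sm_sum sm_scaleR_const assms)
  moreover have "(\<Sum>i\<in>UNIV. f p $ i *\<^sub>R axis i 1) = f p" for p
    using basis_expansion[of "f p"] by (simp add: scalar_mult_eq_scaleR)
  ultimately show ?thesis by simp
qed

lemma sm_Pair:
  assumes "sm f" "sm g" shows "sm (\<lambda>p. (f p, g p))"
proof -
  have "sm (\<lambda>p. (f p, 0) + (0, g p))"
    by (intro sm_add sm_bounded_linear[of "\<lambda>x. (x, 0)"] sm_bounded_linear[of "\<lambda>x. (0, x)"] assms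
        bounded_linear_Pair bounded_linear_ident bounded_linear_zero)
  then show ?thesis by simp
qed

lemma sm_differentiable:
  "sm f \<Longrightarrow> p \<in> W \<Longrightarrow> (\<lambda>x. f (chart_inv \<kappa> x)) differentiable (at (coord \<kappa> p))"
  unfolding sm_iff by (drule spec[of _ "Suc 0"]) auto

lemma pd_def': "pd \<kappa> f b p = frechet_derivative (\<lambda>x. f (chart_inv \<kappa> x)) (at (coord \<kappa> p)) (axis b 1)"
  by (simp add: pd_def dird_def comp_def)

lemma pd_eqI:
  "((\<lambda>x. f (chart_inv \<kappa> x)) has_derivative f') (at (coord \<kappa> p)) \<Longrightarrow> pd \<kappa> f b p = f' (axis b 1)"
  unfolding pd_def' by (drule frechet_eq) simp

lemma sm_has_derivative:
  "sm f \<Longrightarrow> p \<in> W \<Longrightarrow> ((\<lambda>x. f (chart_inv \<kappa> x)) has_derivative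
     frechet_derivative (\<lambda>x. f (chart_inv \<kappa> x)) (at (coord \<kappa> p))) (at (coord \<kappa> p))"
  using sm_differentiable frechet_derivative_works by blast

lemma sm_pd:
  assumes "sm f" shows "sm (pd \<kappa> f b)"
  unfolding sm_iff
proof
  fix k
  have "Ck_on (Suc k) (coord \<kappa> ` W) (\<lambda>x. f (chart_inv \<kappa> x))" using assms sm_iff by blast
  then have "Ck_on k (coord \<kappa> ` W)
      (\<lambda>x. frechet_derivative (\<lambda>x. f (chart_inv \<kappa> x)) (at x) (axis b 1))" by simp
  then show "Ck_on k (coord \<kappa> ` W) (\<lambda>x. pd \<kappa> f b (chart_inv \<kappa> x))"
    by (rule Ck_on_cong[OF open_image, rotated]) (auto simp: pd_def' coord_inv)
qed

lemma pd_cong: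
  assumes "sm f" "\<And>q. q \<in> W \<Longrightarrow> f q = g q" "p \<in> W"
  shows "pd \<kappa> f b p = pd \<kappa> g b p"
proof -
  have "frechet_derivative (\<lambda>x. f (chart_inv \<kappa> x)) (at (coord \<kappa> p))
      = frechet_derivative (\<lambda>x. g (chart_inv \<kappa> x)) (at (coord \<kappa> p))"
    by (rule frechet_cong[OF open_image]) (use assms inv_in sm_differentiable in auto)
  then show ?thesis by (simp add: pd_def')
qed

section \<open>Rules for coordinate partial derivatives\<close>

lemma pd_const [simp]: "pd \<kappa> (\<lambda>p. c) b p = 0" by (simp add: pd_def' frechet_const)

context
  fixes p assumes p: "p \<in> W"
begin

lemma pd_add: "sm f \<Longrightarrow> sm g \<Longrightarrow> pd \<kappa> (\<lambda>q. f q + g q) b p = pd \<kappa> f b p + pd \<kappa> g b p"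
  using pd_eqI[of "\<lambda>q. f q + g q", OF has_derivative_add[OF sm_has_derivative[of f] sm_has_derivative[of g]]] p
  by (simp add: pd_def')

lemma pd_minus: "sm f \<Longrightarrow> pd \<kappa> (\<lambda>q. - f q) b p = - pd \<kappa> f b p"
  using pd_eqI[of "\<lambda>q. - f q", OF has_derivative_minus[OF sm_has_derivative[of f]]] p
  by (simp add: pd_def')

lemma pd_diff: "sm f \<Longrightarrow> sm g \<Longrightarrow> pd \<kappa> (\<lambda>q. f q - g q) b p = pd \<kappa> f b p - pd \<kappa> g b p"
  using pd_add[of f "\<lambda>q. - g q" b] pd_minus[of g b] sm_minus[of g] by simp

lemma pd_mult:
  "sm f \<Longrightarrow> sm g \<Longrightarrow> pd \<kappa> (\<lambda>q. f q * g q :: real) b p = f p * pd \<kappa> g b p + pd \<kappa> f b p * g p"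
  using pd_eqI[of "\<lambda>q. f q * g q", OF has_derivative_mult[OF sm_has_derivative[of f] sm_has_derivative[of g]]] p
  by (simp add: pd_def' inv_coord)

lemma pd_sum:
  assumes "\<And>i. i \<in> I \<Longrightarrow> sm (f i)"
  shows "pd \<kappa> (\<lambda>q. \<Sum>i\<in>I. f i q) b p = (\<Sum>i\<in>I. pd \<kappa> (f i) b p)"
  using assms
proof (induction I rule: infinite_finite_induct)
  case (insert x F)
  then show ?case using pd_add[of "f x" "\<lambda>q. \<Sum>i\<in>F. f i q" b] sm_sum[of F f] by simp
qed simp_all

lemma pd_powr:
  fixes f :: "'m \<Rightarrow> real"
  assumes "sm f" "f p > 0"
  shows "pd \<kappa> (\<lambda>q. f q powr a) b p = a * (f p powr a / f p) * pd \<kappa> f b p"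
  using pd_eqI[of "\<lambda>q. f q powr a", OF has_derivative_powr_pos[OF sm_has_derivative[of f]]] assms p
  by (simp add: pd_def' inv_coord divide_inverse)

lemma pd_ln:
  fixes f :: "'m \<Rightarrow> real"
  assumes "sm f" "f p > 0"
  shows "pd \<kappa> (\<lambda>q. ln (f q)) b p = pd \<kappa> f b p / f p"
proof -
  have "((\<lambda>x. ln (f (chart_inv \<kappa> x))) has_derivative
     (\<lambda>v. frechet_derivative (\<lambda>x. f (chart_inv \<kappa> x)) (at (coord \<kappa> p)) v *
        inverse (f (chart_inv \<kappa> (coord \<kappa> p))))) (at (coord \<kappa> p))"
    by (rule has_derivative_ln[OF _ sm_has_derivative[OF assms(1) p]]) (use assms(2) p in \<open>simp add: inv_coord\<close>)
  from pd_eqI[of "\<lambda>q. ln (f q)", OF this] show ?thesis using p by (simp add: pd_def' inv_coord divide_inverse)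
qed

lemma pd_component: "sm f \<Longrightarrow> pd \<kappa> (\<lambda>q. f q $ i) b p = pd \<kappa> f b p $ i"
  using pd_eqI[of "\<lambda>q. f q $ i", OF bounded_linear.has_derivative[OF bounded_linear_vec_nth sm_has_derivative[of f]]] p
  by (simp add: pd_def')

lemma pd_commute:
  fixes f :: "'m \<Rightarrow> real" assumes "sm f"
  shows "pd \<kappa> (pd \<kappa> f a) b p = pd \<kappa> (pd \<kappa> f b) a p"
proof -
  let ?f = "\<lambda>x. f (chart_inv \<kappa> x)"
  have *: "pd \<kappa> (pd \<kappa> f a) b p
     = frechet_derivative (\<lambda>y. frechet_derivative ?f (at y) (axis a 1)) (at (coord \<kappa> p)) (axis b 1)" for a b
  proof -
    have "frechet_derivative (\<lambda>x. pd \<kappa> f a (chart_inv \<kappa> x)) (at (coord \<kappa> p))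
        = frechet_derivative (\<lambda>y. frechet_derivative ?f (at y) (axis a 1)) (at (coord \<kappa> p))"
      by (rule frechet_cong[OF open_image])
         (use p sm_differentiable[OF sm_pd[OF assms]] in \<open>auto simp: pd_def' inv_coord\<close>)
    then show ?thesis by (simp add: pd_def'[of "pd \<kappa> f a"])
  qed
  show ?thesis unfolding *
    by (rule Ck_on_2_mixed_partials[OF open_image]) (use assms p in \<open>auto simp: sm_iff\<close>)
qed

lemma dird_eq_sum:
  fixes f :: "'m \<Rightarrow> 'b::real_normed_vector" assumes "sm f"
  shows "dird \<kappa> f v p = (\<Sum>b\<in>UNIV. v $ b *\<^sub>R pd \<kappa> f b p)"
proof -
  let ?L = "frechet_derivative (f \<circ> chart_inv \<kappa>) (at (coord \<kappa> p))"
  have l: "linear ?L" using sm_has_derivative[OF assms p] has_derivative_linear by (auto simp: comp_def)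
  have "?L v = ?L (\<Sum>b\<in>UNIV. v $ b *\<^sub>R axis b 1)"
    using basis_expansion[of v] by (simp add: scalar_mult_eq_scaleR)
  also have "\<dots> = (\<Sum>b\<in>UNIV. v $ b *\<^sub>R ?L (axis b 1))"
    by (simp add: linear_sum[OF l] linear_cmul[OF l])
  finally show ?thesis by (simp add: dird_def pd_def)
qed

end

end

lemma chart_smooth_subset: "chart_smooth \<kappa> W f \<Longrightarrow> V \<subseteq> W \<Longrightarrow> chart_smooth \<kappa> V f"
  unfolding chart_smooth_def smooth_on_def by (auto intro: Ck_on_subset[OF _ image_mono])

lemma pd_chain:
  fixes f :: "'m \<Rightarrow> real"
  assumes "chart_open \<kappa> W" "chart_open \<kappa>' W" "p \<in> W"
    and c: "chart_smooth \<kappa> W (coord \<kappa>')" and f: "chart_smooth \<kappa>' W f"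
  shows "pd \<kappa> f b p = (\<Sum>c\<in>UNIV. jac \<kappa> \<kappa>' p $ c $ b * pd \<kappa>' f c p)"
proof -
  interpret k: chart_open \<kappa> W by fact
  interpret k': chart_open \<kappa>' W by fact
  let ?C = "\<lambda>x. coord \<kappa>' (chart_inv \<kappa> x)"
  let ?C' = "frechet_derivative ?C (at (coord \<kappa> p))"
  have "((\<lambda>x. f (chart_inv \<kappa>' (?C x))) has_derivative
      (\<lambda>v. frechet_derivative (\<lambda>x. f (chart_inv \<kappa>' x)) (at (coord \<kappa>' p)) (?C' v))) (at (coord \<kappa> p))"
    using k'.sm_has_derivative[OF f assms(3)] assms(3)
    by (intro has_derivative_compose[OF k.sm_has_derivative[OF c assms(3)]]) (simp add: k.inv_coord)
  then have "((\<lambda>x. f (chart_inv \<kappa> x)) has_derivative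
      (\<lambda>v. frechet_derivative (\<lambda>x. f (chart_inv \<kappa>' x)) (at (coord \<kappa>' p)) (?C' v))) (at (coord \<kappa> p))"
    by (rule has_derivative_transform_within_open[OF _ k.open_image])
       (use assms(3) k.inv_in k'.inv_coord in auto)
  then have "pd \<kappa> f b p = dird \<kappa>' f (dird \<kappa> (coord \<kappa>') (axis b 1) p) p"
    by (subst k.pd_eqI) (auto simp: dird_def comp_def)
  also have "\<dots> = (\<Sum>c\<in>UNIV. dird \<kappa> (coord \<kappa>') (axis b 1) p $ c * pd \<kappa>' f c p)"
    by (simp add: k'.dird_eq_sum[OF assms(3) f])
  finally show ?thesis by (simp add: jac_def matrix_def)
qed

section \<open>Linear algebra\<close>

text \<open>The dimensions force every vector to be a sum of \<open>x\<close> in \<open>P\<close>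
  and \<open>y\<close> in \<open>N\<close>. For a kernel vector, pairing with \<open>x\<close> and
  with \<open>y\<close> makes the squares of \<open>x\<close> and \<open>y\<close> equal; one is
  nonnegative and the other nonpositive, so both vectors vanish.\<close>

lemma has_signature_invertible:
  fixes G :: "real ^ 'n ^ 'n"
  assumes "has_signature r s G" shows "invertible G"
proof -
  obtain P N where sym: "transpose G = G" and rs: "r + s = CARD('n)"
    and P: "subspace P" "dim P = r" "\<And>v. v \<in> P \<Longrightarrow> v \<noteq> 0 \<Longrightarrow> v \<bullet> (G *v v) > 0"
    and N: "subspace N" "dim N = s" "\<And>v. v \<in> N \<Longrightarrow> v \<noteq> 0 \<Longrightarrow> v \<bullet> (G *v v) < 0"
    using assms unfolding has_signature_def by blast
  have "P \<inter> N = {0}" using P N subspace_0 by (force dest: less_asym)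
  then have "dim {x + y |x y. x \<in> P \<and> y \<in> N} = CARD('n)"
    using dim_sums_Int[OF P(1) N(1)] P(2) N(2) rs by simp
  then have *: "{x + y |x y. x \<in> P \<and> y \<in> N} = UNIV"
    using dim_eq_full[of "{x + y |x y. x \<in> P \<and> y \<in> N}"] span_eq_iff[of "{x + y |x y. x \<in> P \<and> y \<in> N}"]
      subspace_sums[OF P(1) N(1)] by simp
  have sw: "x \<bullet> (G *v y) = y \<bullet> (G *v x)" for x y
    by (metis dot_lmul_matrix inner_commute sym vector_transpose_matrix)
  have "v = 0" if "G *v v = 0" for v
  proof -
    obtain x y where xy: "v = x + y" "x \<in> P" "y \<in> N" using * by blast
    have "x \<bullet> (G *v (x + y)) = 0" "y \<bullet> (G *v (x + y)) = 0" using that xy by simp_all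
    then have "x \<bullet> (G *v x) = y \<bullet> (G *v y)"
      by (simp add: matrix_vector_right_distrib inner_add_right sw[of x y])
    then show ?thesis using P(3)[OF xy(2)] N(3)[OF xy(3)] xy(1) by (cases "x = 0"; cases "y = 0") auto
  qed
  then show ?thesis using matrix_left_invertible_ker invertible_left_inverse by blast
qed

lemma
  fixes M :: "'a::semiring_1 ^ 'n ^ 'm"
  assumes "invertible M"
  shows matrix_inv_right: "M ** matrix_inv M = mat 1" and matrix_inv_left: "matrix_inv M ** M = mat 1"
  using assms someI_ex[of "\<lambda>A'. M ** A' = mat 1 \<and> A' ** M = mat 1"]
  unfolding invertible_def matrix_inv_def by auto

lemma dim_orthogonal_complement:
  fixes S :: "(real ^ 'n) set"
  shows "dim {y. \<forall>x\<in>S. orthogonal x y} + dim S = CARD('n)"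
proof -
  have "{y. \<forall>x\<in>S. orthogonal x y} = {y \<in> UNIV. \<forall>x\<in>span S. orthogonal x y}"
    using span_superset[of S] by (auto simp: orthogonal_commute intro: orthogonal_to_span)
  then show ?thesis
    using dim_subspace_orthogonal_to_vectors[of "span S" UNIV] by simp
qed

lemma transpose_eq_nth: "transpose M = M \<Longrightarrow> M $ i $ j = M $ j $ i"
  by (metis transpose_def vec_lambda_beta)

lemma transpose_matrix_inv:
  fixes M :: "real ^ 'n ^ 'n"
  assumes "invertible M" "transpose M = M"
  shows "transpose (matrix_inv M) = matrix_inv M"
proof -
  have "transpose (matrix_inv M) ** M = mat 1"
    using arg_cong[OF matrix_inv_right[OF assms(1)], of transpose] assms(2)
    by (simp add: matrix_transpose_mul transpose_mat)
  then have "transpose (matrix_inv M) ** (M ** matrix_inv M) = matrix_inv M"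
    by (simp add: matrix_mul_assoc)
  then show ?thesis by (simp add: matrix_inv_right[OF assms(1)])
qed

lemma inner_transpose_mult: "x \<bullet> (transpose M *v y) = (M *v x) \<bullet> y"
  for M :: "real ^ 'n ^ 'm"
  unfolding dot_lmul_matrix[symmetric] vector_transpose_matrix ..

lemma det_scaleR: "det (k *\<^sub>R M) = k ^ CARD('n) * det M" for M :: "real ^ 'n ^ 'n"
proof -
  have "k *\<^sub>R M = (\<chi> i. k *s M $ i)" by (simp add: vec_eq_iff)
  then show ?thesis using det_rows_mul[of "\<lambda>i. k" "\<lambda>i. M $ i"] by simp
qed

lemma
  fixes A B :: "real ^ 'n ^ 'm" and C :: "real ^ 'k ^ 'n" and D :: "real ^ 'm ^ 'k"
  shows matrix_add_rdistrib: "(A + B) ** C = A ** C + B ** C"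
    and matrix_diff_rdistrib: "(A - B) ** C = A ** C - B ** C"
    and matrix_diff_ldistrib: "D ** (A - B) = D ** A - D ** B"
  by (simp_all add: vec_eq_iff matrix_matrix_mult_def sum.distrib sum_subtractf algebra_simps)

text \<open>Cramer's rule. As a quotient of determinants the entry is visibly smooth in the entries
  of \<open>M\<close>, which is how \<open>sm_matrix_inv\<close> uses it.\<close>

lemma matrix_inv_nth:
  fixes M :: "real ^ 'n ^ 'n"
  assumes "invertible M"
  shows "matrix_inv M $ i $ j = det (\<chi> a b. if b = i then (if a = j then 1 else 0) else M $ a $ b) / det M"
proof -
  have "M *v (matrix_inv M *v axis j 1) = axis j 1"
    by (simp add: matrix_vector_mul_assoc matrix_inv_right[OF assms])
  then have "matrix_inv M *v axis j 1
      = (\<chi> k. det (\<chi> a b. if b = k then axis j 1 $ a else M $ a $ b) / det M)"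
    using cramer[of M] assms invertible_det_nz by blast
  then have "(matrix_inv M *v axis j 1) $ i = det (\<chi> a b. if b = i then axis j 1 $ a else M $ a $ b) / det M"
    by simp
  moreover have "(matrix_inv M *v axis j 1) $ i = matrix_inv M $ i $ j"
    by (simp add: matrix_vector_mul_component inner_axis)
  ultimately show ?thesis by (simp add: axis_def eq_commute cong: if_cong)
qed

text \<open>
  If \<open>\<theta> \<noteq> 0\<close>, then the common kernel of \<open>\<omega>\<close> and \<open>\<theta>\<close> is totally isotropic of codimension at most 2,
  which is impossible for a nondegenerate form in dimension 5 or more.
\<close>

lemma conformal_killing_algebra:
  fixes G :: "real ^ 'n ^ 'n" and \<theta> \<omega> :: "real ^ 'n"
  assumes card: "5 \<le> CARD('n)" and sym: "transpose G = G" and inv: "invertible G"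
    and alt1: "\<And>c a b. \<tau> c a b = - \<tau> a c b" and alt2: "\<And>c a b. \<tau> c a b = - \<tau> c b a"
    and skew: "\<And>a b. \<phi> a b = - \<phi> b a"
    and eq: "\<And>c a b. \<tau> c a b - G $ c $ a * \<theta> $ b + G $ c $ b * \<theta> $ a = \<omega> $ c * \<phi> a b"
    and nz: "\<phi> a0 b0 \<noteq> 0"
  shows "\<theta> = 0 \<and> \<omega> = 0 \<and> (\<forall>c a b. \<tau> c a b = 0)"
proof -
  have symG: "G $ a $ c = G $ c $ a" for a c using sym by (metis transpose_def vec_lambda_beta)
  have \<theta>: "\<theta> = 0"
  proof (rule ccontr)
    assume "\<theta> \<noteq> 0"
    then obtain b where b: "\<theta> $ b \<noteq> 0" by (metis vec_eq_iff zero_index)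
    define U where "U = {\<omega>, \<theta>}"
    define W where "W = {y. \<forall>x\<in>U. orthogonal x y}"
    have dimW: "dim W + dim U = CARD('n)"
      unfolding W_def by (rule dim_orthogonal_complement)
    have "dim U \<le> 2" unfolding U_def by (rule order_trans[OF dim_le_card']) (auto simp: card_insert_if)
    have iso: "y \<bullet> (G *v x) = 0" if "x \<in> W" "y \<in> W" for x y
    proof -
      have o: "\<omega> \<bullet> x = 0" "\<omega> \<bullet> y = 0" "\<theta> \<bullet> x = 0" "\<theta> \<bullet> y = 0"
        using that by (auto simp: W_def U_def orthogonal_def)
      \<comment> \<open>Symmetrising in \<open>c\<close> and \<open>a\<close> removes the skew
        tensor \<open>\<tau>\<close>.\<close>
      have e: "- 2 * G $ c $ a * \<theta> $ b + G $ c $ b * \<theta> $ a + G $ a $ b * \<theta> $ c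
          = \<omega> $ c * \<phi> a b + \<omega> $ a * \<phi> c b" for c a
        using eq[of c a b] eq[of a c b] alt1[of c a b] symG[of a c] by simp
      have d: "(\<Sum>c\<in>UNIV. \<Sum>a\<in>UNIV. f c a) * k = (\<Sum>c\<in>UNIV. \<Sum>a\<in>UNIV. f c a * k)"
        for f :: "'n \<Rightarrow> 'n \<Rightarrow> real" and k by (simp add: sum_distrib_right)
      have "(\<Sum>c\<in>UNIV. \<Sum>a\<in>UNIV. x $ c * y $ a *
          (- 2 * G $ c $ a * \<theta> $ b + G $ c $ b * \<theta> $ a + G $ a $ b * \<theta> $ c)) =
        (\<Sum>c\<in>UNIV. \<Sum>a\<in>UNIV. x $ c * y $ a * (\<omega> $ c * \<phi> a b + \<omega> $ a * \<phi> c b))"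
        by (simp only: e)
      moreover have "(\<Sum>c\<in>UNIV. \<Sum>a\<in>UNIV. x $ c * y $ a * (\<omega> $ c * \<phi> a b + \<omega> $ a * \<phi> c b))
         = (\<Sum>c\<in>UNIV. \<omega> $ c * x $ c) * (\<Sum>a\<in>UNIV. y $ a * \<phi> a b)
         + (\<Sum>c\<in>UNIV. x $ c * \<phi> c b) * (\<Sum>a\<in>UNIV. \<omega> $ a * y $ a)"
        unfolding sum_product sum.distrib[symmetric] by (intro sum.cong refl) (simp add: algebra_simps)
      moreover have "(\<Sum>c\<in>UNIV. \<Sum>a\<in>UNIV. x $ c * y $ a *
          (- 2 * G $ c $ a * \<theta> $ b + G $ c $ b * \<theta> $ a + G $ a $ b * \<theta> $ c))
        = (\<Sum>c\<in>UNIV. \<Sum>a\<in>UNIV. x $ c * y $ a * G $ c $ a) * (- 2 * \<theta> $ b)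
          + (\<Sum>c\<in>UNIV. x $ c * G $ c $ b) * (\<Sum>a\<in>UNIV. \<theta> $ a * y $ a)
          + (\<Sum>c\<in>UNIV. \<theta> $ c * x $ c) * (\<Sum>a\<in>UNIV. y $ a * G $ a $ b)"
        unfolding sum_product d sum.distrib[symmetric]
        by (intro sum.cong refl) (simp add: algebra_simps)
      moreover note o[unfolded inner_vec_def inner_real_def]
      ultimately have "(\<Sum>c\<in>UNIV. \<Sum>a\<in>UNIV. x $ c * y $ a * G $ c $ a) = 0" using b by simp
      then show ?thesis
        by (subst (asm) sum.swap)
           (simp add: inner_vec_def matrix_vector_mult_def sum_distrib_left symG[of _ _] mult_ac)
    qed
    have "(*v) G ` W \<subseteq> {y. \<forall>x\<in>W. orthogonal x y}" using iso by (auto simp: orthogonal_def)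
    then have "dim ((*v) G ` W) \<le> dim {y. \<forall>x\<in>W. orthogonal x y}" by (rule dim_subset)
    moreover have "inj ((*v) G)" using inv by (simp add: inj_matrix_vector_mult)
    then have "dim ((*v) G ` W) = dim W"
      using dim_image_eq[of "(*v) G" W] by (simp add: inj_on_subset matrix_vector_mul_linear)
    moreover have "dim {y. \<forall>x\<in>W. orthogonal x y} + dim W = CARD('n)"
      by (rule dim_orthogonal_complement)
    \<comment> \<open>\<open>G\<close> maps \<open>W\<close> injectively into its orthogonal
      complement, so \<open>2 * dim W\<close> is at most \<open>n\<close>, while
      \<open>dim W\<close> is at least \<open>n - 2\<close>. This needs \<open>n\<close> at most
      4.\<close>
    ultimately show False using dimW \<open>dim U \<le> 2\<close> card by linarith
  qed
  have e: "\<tau> c a b = \<omega> $ c * \<phi> a b" for c a b using eq[of c a b] \<theta> by simp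
  \<comment> \<open>If \<open>\<omega> $ c\<close> were nonzero, skewness of \<open>\<tau>\<close>
    in its first two indices would give first \<open>\<phi> c b0 = 0\<close> and then, after
    exchanging \<open>c\<close> and \<open>a0\<close>,
    \<open>\<omega> $ c * \<phi> a0 b0 = 0\<close>.\<close>
  have "\<omega> $ c = 0" for c
  proof (rule ccontr)
    assume c: "\<omega> $ c \<noteq> 0"
    have "\<phi> c b0 = 0" using e[of c c b0] alt1[of c c b0] c by simp
    then have "\<omega> $ c * \<phi> a0 b0 = 0" using e[of c a0 b0] e[of a0 c b0] alt1[of c a0 b0] by simp
    then show False using c nz by simp
  qed
  then have "\<omega> = 0" by (simp add: vec_eq_iff)
  then show ?thesis using \<theta> e by simp
qed

section \<open>Algebra of \<open>G\<^sub>2\<close>-structures\<close>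

lemma wedge_3:
  "wedge [a, b, c] [u, v, w] =
     a u * (b v * c w - b w * c v) - a v * (b u * c w - b w * c u) + a w * (b u * c v - b v * c u)"
proof -
  have l: "length [a, b, c] = 3" and s: "{..<3::nat} = {0, 1, 2}" by auto
  have f: "finite {1::nat, 2}" "0 \<notin> {1::nat, 2}" "finite {2::nat}" "1 \<notin> {2::nat}" by auto
  show ?thesis
    unfolding wedge_def l s sum_over_permutations_insert[OF f(1,2)]
      sum_over_permutations_insert[OF f(3,4)] permutes_sing
    by (simp add: sign_swap_id sign_compose permutation_swap_id permutation_compose sign_id
        Transposition.transpose_def numeral_2_eq_2 algebra_simps)
qed

text \<open>Composing with the transposition of the two equal entries permutes the summands and
  flips every sign. It is applied to the volume form in the Hodge dual, where the scale tractor
  occurs twice.\<close>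

lemma wedge_repeated:
  assumes "i < j" "j < length \<alpha>s" "vs ! i = vs ! j"
  shows "wedge \<alpha>s vs = 0"
proof -
  let ?n = "length \<alpha>s" and ?t = "Transposition.transpose i j"
  let ?f = "\<lambda>p. of_int (sign p) * (\<Prod>k<?n. (\<alpha>s ! k) (vs ! p k)) :: real"
  have t: "?t permutes {..<?n}" using assms by (simp add: permutes_swap_id)
  have vs: "vs ! ?t k = vs ! k" for k using assms(3) by (simp add: Transposition.transpose_def)
  have "wedge \<alpha>s vs = (\<Sum>p | p permutes {..<?n}. ?f (?t \<circ> p))"
    unfolding wedge_def by (rule setum_permutations_compose_left[OF t])
  also have "\<dots> = (\<Sum>p | p permutes {..<?n}. - ?f p)"
  proof (rule sum.cong[OF refl])
    fix p assume "p \<in> {p. p permutes {..<?n}}"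
    then have "permutation p" using permutation_permutes by blast
    then have "sign (?t \<circ> p) = - sign p"
      using assms(1) by (simp add: sign_compose permutation_swap_id sign_swap_id)
    then show "?f (?t \<circ> p) = - ?f p" by (simp add: vs)
  qed
  also have "\<dots> = - wedge \<alpha>s vs" by (simp add: wedge_def sum_negf)
  finally show ?thesis by simp
qed

lemma G2_basis_expansion:
  assumes "G2_basis F E e"
  shows "x = (\<Sum>i\<in>{1..7}. e i x *\<^sub>R E i)"
proof -
  have li: "linear (e i)" if "i \<in> {1..7}" for i using assms that unfolding G2_basis_def by blast
  have d: "e i (E j) = (if i = j then 1 else 0)" if "i \<in> {1..7}" "j \<in> {1..7}" for i j
    using assms that unfolding G2_basis_def by blast
  have "x \<in> span (E ` {1..7})" "inj_on E {1..7}" using assms unfolding G2_basis_def by auto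
  then obtain a where "x = (\<Sum>y\<in>E ` {1..7}. a y *\<^sub>R y)"
    using span_finite[of "E ` {1..7}"] by auto
  then have x: "x = (\<Sum>j\<in>{1..7}. a (E j) *\<^sub>R E j)"
    using \<open>inj_on E {1..7}\<close> by (simp add: sum.reindex)
  have "e i x = a (E i)" if "i \<in> {1..7}" for i
  proof -
    have "e i x = (\<Sum>j\<in>{1..7}. a (E j) * e i (E j))"
      by (subst x) (simp add: linear_sum[OF li[OF that]] linear_cmul[OF li[OF that]])
    also have "\<dots> = (\<Sum>j\<in>{1..7}. if i = j then a (E j) else 0)"
      by (rule sum.cong) (use d that in auto)
    finally show ?thesis using that by simp
  qed
  then show ?thesis using x by simp
qed

text \<open>This is the identity |u x v|^2 = |u|^2 |v|^2 - (u, v)^2 for imaginary split octonions,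
  in the coordinates of an adapted basis: \<open>f1\<close> to \<open>f7\<close> are the components
  of the lowered cross product. The square root of 2 is the variable \<open>r\<close>, so that only
  polynomial algebra is left.\<close>

lemma split_octonion_norm_identity:
  fixes r u1 u2 u3 u4 u5 u6 u7 v1 v2 v3 v4 v5 v6 v7 :: real
  assumes r: "r * r = 2"
    and f: "f1 = (u7 * v4 - u4 * v7) + r * (u5 * v6 - u6 * v5)"
      "f2 = (u4 * v5 - u5 * v4) + r * (u3 * v7 - u7 * v3)"
      "f3 = (u4 * v6 - u6 * v4) + r * (u7 * v2 - u2 * v7)"
      "f4 = (u1 * v7 - u7 * v1) - (u2 * v5 - u5 * v2) - (u3 * v6 - u6 * v3)"
      "f5 = (u2 * v4 - u4 * v2) + r * (u6 * v1 - u1 * v6)"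
      "f6 = (u3 * v4 - u4 * v3) + r * (u1 * v5 - u5 * v1)"
      "f7 = (u4 * v1 - u1 * v4) + r * (u2 * v3 - u3 * v2)"
  shows "f7 * f1 + f1 * f7 + f5 * f2 + f2 * f5 + f6 * f3 + f3 * f6 - (- f4) * (- f4)
   = (u1 * u7 + u7 * u1 + u2 * u5 + u5 * u2 + u3 * u6 + u6 * u3 - u4 * u4)
       * (v1 * v7 + v7 * v1 + v2 * v5 + v5 * v2 + v3 * v6 + v6 * v3 - v4 * v4)
     - (u1 * v7 + u7 * v1 + u2 * v5 + u5 * v2 + u3 * v6 + u6 * v3 - u4 * v4)\<^sup>2"
proof -
  \<comment> \<open>Each product of two components is expanded with \<open>r * r\<close> already
    replaced by 2.\<close>
  have x: "(p + r * q) * (p' + r * q') = p * p' + 2 * (q * q') + r * (p * q' + q * p')" for p q p' q'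
    unfolding r[symmetric] by (simp add: algebra_simps)
  show ?thesis unfolding f x power2_eq_square by (simp add: algebra_simps)
qed

lemma one_to_seven: "{1..7::nat} = {1, 2, 3, 4, 5, 6, 7}" by auto

text \<open>
  \<open>n\<close> is the cross product of \<open>u\<close> and \<open>v\<close>; the identity expresses that \<open>F\<close> determines the scale
  of the metric.
\<close>

lemma G2_cross_product_norm:
  fixes F :: "'v::real_vector \<Rightarrow> 'v \<Rightarrow> 'v \<Rightarrow> real"
  assumes b: "G2_basis F E e" and H: "bilinear H"
    and pair: "\<forall>i\<in>{1..7}. \<forall>j\<in>{1..7}. H (E i) (E j) = G2_pairing i j"
  shows "\<exists>n. (\<forall>w. H n w = F u v w) \<and> H n n = H u u * H v v - (H u v)\<^sup>2"
proof -
  have Hx: "H x y = e 1 x * e 7 y + e 7 x * e 1 y + e 2 x * e 5 y + e 5 x * e 2 y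
      + e 3 x * e 6 y + e 6 x * e 3 y - e 4 x * e 4 y" for x y
  proof -
    have "H x y = H (\<Sum>i\<in>{1..7}. e i x *\<^sub>R E i) (\<Sum>j\<in>{1..7}. e j y *\<^sub>R E j)"
      using G2_basis_expansion[OF b] by metis
    also have "\<dots> = (\<Sum>i\<in>{1..7}. \<Sum>j\<in>{1..7}. e i x * (e j y * H (E i) (E j)))"
      by (simp add: bilinear_sum[OF H] sum.cartesian_product bilinear_lmul[OF H] bilinear_rmul[OF H]
          case_prod_unfold mult_ac)
    also have "\<dots> = (\<Sum>i\<in>{1..7}. \<Sum>j\<in>{1..7}. e i x * (e j y * G2_pairing i j))"
      using pair by (intro sum.cong refl) auto
    also have "\<dots> = e 1 x * e 7 y + e 7 x * e 1 y + e 2 x * e 5 y + e 5 x * e 2 y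
      + e 3 x * e 6 y + e 6 x * e 3 y - e 4 x * e 4 y"
      unfolding one_to_seven by (simp add: G2_pairing_def doubleton_eq_iff)
    finally show ?thesis .
  qed
  have li: "linear (e i)" if "i \<in> {1..7}" for i using b that unfolding G2_basis_def by blast
  have d: "e i (E j) = (if i = j then 1 else 0)" if "i \<in> {1..7}" "j \<in> {1..7}" for i j
    using b that unfolding G2_basis_def by blast
  have F: "F u v w = - wedge [e 1, e 4, e 7] [u, v, w] + sqrt 2 * wedge [e 1, e 5, e 6] [u, v, w]
        + sqrt 2 * wedge [e 2, e 3, e 7] [u, v, w] + wedge [e 2, e 4, e 5] [u, v, w]
        + wedge [e 3, e 4, e 6] [u, v, w]" for u v w
    using b unfolding G2_basis_def by blast
  \<comment> \<open>This is the 1-form \<open>F u v\<close> raised with the pairing: the indices 1,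
    7 and 2, 5 and 3, 6 are exchanged, and the sign at 4 comes from the negative square of
    \<open>E 4\<close>.\<close>
  define n where "n = F u v (E 7) *\<^sub>R E 1 + F u v (E 1) *\<^sub>R E 7 + F u v (E 5) *\<^sub>R E 2
     + F u v (E 2) *\<^sub>R E 5 + F u v (E 6) *\<^sub>R E 3 + F u v (E 3) *\<^sub>R E 6 - F u v (E 4) *\<^sub>R E 4"
  have en: "e 1 n = F u v (E 7)" "e 7 n = F u v (E 1)" "e 2 n = F u v (E 5)" "e 5 n = F u v (E 2)"
    "e 3 n = F u v (E 6)" "e 6 n = F u v (E 3)" "e 4 n = - F u v (E 4)"
    by (simp_all add: n_def linear_add[OF li] linear_diff[OF li] linear_cmul[OF li] d)
  have FE: "F u v (E 1) = (e 7 u * e 4 v - e 4 u * e 7 v) + sqrt 2 * (e 5 u * e 6 v - e 6 u * e 5 v)"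
    "F u v (E 2) = (e 4 u * e 5 v - e 5 u * e 4 v) + sqrt 2 * (e 3 u * e 7 v - e 7 u * e 3 v)"
    "F u v (E 3) = (e 4 u * e 6 v - e 6 u * e 4 v) + sqrt 2 * (e 7 u * e 2 v - e 2 u * e 7 v)"
    "F u v (E 4) = (e 1 u * e 7 v - e 7 u * e 1 v) - (e 2 u * e 5 v - e 5 u * e 2 v) - (e 3 u * e 6 v - e 6 u * e 3 v)"
    "F u v (E 5) = (e 2 u * e 4 v - e 4 u * e 2 v) + sqrt 2 * (e 6 u * e 1 v - e 1 u * e 6 v)"
    "F u v (E 6) = (e 3 u * e 4 v - e 4 u * e 3 v) + sqrt 2 * (e 1 u * e 5 v - e 5 u * e 1 v)"
    "F u v (E 7) = (e 4 u * e 1 v - e 1 u * e 4 v) + sqrt 2 * (e 2 u * e 3 v - e 3 u * e 2 v)"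
    unfolding F wedge_3 by (simp_all add: d algebra_simps)
  have "H n w = F u v w" for w
    unfolding Hx en FE F[of u v w] wedge_3 by (simp add: algebra_simps)
  moreover have "H n n = H u u * H v v - (H u v)\<^sup>2"
    unfolding Hx en by (rule split_octonion_norm_identity[OF _ FE]) simp
  ultimately show ?thesis by blast
qed

section \<open>Derivatives of determinants and inverse matrices\<close>

context chart_open
begin

lemma sm_det: "(\<And>i j. sm (\<lambda>q. M q $ i $ j)) \<Longrightarrow> sm (\<lambda>q. det (M q :: real ^ 'k ^ 'k))"
  unfolding det_def by (intro sm_sum sm_mult sm_const sm_prod)

lemma sm_matrix_inv:
  fixes M :: "'m \<Rightarrow> real ^ 'k ^ 'k"
  assumes "\<And>i j. sm (\<lambda>q. M q $ i $ j)" "\<And>q. q \<in> W \<Longrightarrow> invertible (M q)"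
  shows "sm (\<lambda>q. matrix_inv (M q) $ i $ j)"
proof (rule sm_cong)
  show "sm (\<lambda>q. det (\<chi> a b. if b = i then (if a = j then 1 else 0) else M q $ a $ b) * inverse (det (M q)))"
  proof (intro sm_mult sm_inverse sm_det assms)
    show "sm (\<lambda>q. (\<chi> a b. if b = i then if a = j then 1 else 0 else M q $ a $ b) $ a $ b)" for a b
      using assms(1)[of a b] by (cases "b = i") (simp_all add: sm_const)
  qed (use assms(2) invertible_det_nz in auto)
qed (simp add: assms(2) matrix_inv_nth[of "M _"] divide_inverse)

context
  fixes p assumes p: "p \<in> W"
begin

lemma pd_prod:
  fixes f :: "'i \<Rightarrow> 'm \<Rightarrow> real"
  assumes "finite I" "\<And>i. i \<in> I \<Longrightarrow> sm (f i)"
  shows "pd \<kappa> (\<lambda>q. \<Prod>i\<in>I. f i q) b p = (\<Sum>i\<in>I. \<Prod>j\<in>I. if j = i then pd \<kappa> (f j) b p else f j p)"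
  using assms
proof (induction I)
  case (insert x I)
  have "pd \<kappa> (\<lambda>q. \<Prod>i\<in>insert x I. f i q) b p
      = f x p * (\<Sum>i\<in>I. \<Prod>j\<in>I. if j = i then pd \<kappa> (f j) b p else f j p)
        + pd \<kappa> (f x) b p * (\<Prod>i\<in>I. f i p)"
    using insert pd_mult[OF p, of "f x" "\<lambda>q. \<Prod>i\<in>I. f i q" b] sm_prod[of I f] by simp
  also have "\<dots> = (\<Sum>i\<in>insert x I. \<Prod>j\<in>insert x I. if j = i then pd \<kappa> (f j) b p else f j p)"
  proof -
    have "(\<Prod>j\<in>insert x I. if j = x then pd \<kappa> (f j) b p else f j p)
        = pd \<kappa> (f x) b p * (\<Prod>j\<in>I. f j p)"
      using insert.hyps by (auto intro!: prod.cong)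
    moreover have "(\<Prod>j\<in>insert x I. if j = i then pd \<kappa> (f j) b p else f j p)
        = f x p * (\<Prod>j\<in>I. if j = i then pd \<kappa> (f j) b p else f j p)" if "i \<in> I" for i
      using insert.hyps that by auto
    ultimately show ?thesis
      using insert.hyps by (subst sum.insert) (simp_all add: sum_distrib_left del: prod.insert)
  qed
  finally show ?case .
qed simp

text \<open>Jacobi's formula. The product rule replaces one row at a time by its derivative; that
  row is a combination of the rows of \<open>M p\<close> with coefficients from the inverse matrix,
  and Cramer's lemma leaves only its diagonal coefficient.\<close>

lemma pd_det:
  fixes M :: "'m \<Rightarrow> real ^ 'k ^ 'k"
  assumes s: "\<And>i j. sm (\<lambda>q. M q $ i $ j)" and inv: "invertible (M p)"
  shows "pd \<kappa> (\<lambda>q. det (M q)) b p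
    = det (M p) * (\<Sum>i\<in>UNIV. \<Sum>k\<in>UNIV. matrix_inv (M p) $ k $ i * pd \<kappa> (\<lambda>q. M q $ i $ k) b p)"
proof -
  define D where "D i k = pd \<kappa> (\<lambda>q. M q $ i $ k) b p" for i k
  define R where "R i = (\<chi> j k. if j = i then D i k else M p $ j $ k)" for i
  have R: "det (R i) = (\<Sum>k\<in>UNIV. D i k * matrix_inv (M p) $ k $ i) * det (M p)" for i
  proof -
    define x where "x = (\<chi> l. \<Sum>k\<in>UNIV. D i k * matrix_inv (M p) $ k $ l)"
    have "(\<Sum>l\<in>UNIV. x $ l *s row l (M p)) $ k = D i k" for k
    proof -
      have "(\<Sum>l\<in>UNIV. x $ l *s row l (M p)) $ k
          = (\<Sum>l\<in>UNIV. \<Sum>m\<in>UNIV. D i m * (matrix_inv (M p) $ m $ l * M p $ l $ k))"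
        by (simp add: x_def row_def sum_distrib_right mult.assoc)
      also have "\<dots> = (\<Sum>m\<in>UNIV. D i m * (matrix_inv (M p) ** M p) $ m $ k)"
        by (subst sum.swap) (simp add: matrix_matrix_mult_def sum_distrib_left)
      also have "\<dots> = D i k"
        by (simp add: matrix_inv_left[OF inv] mat_def if_distrib cong: if_cong)
      finally show ?thesis .
    qed
    then have "R i = (\<chi> j. if j = i then (\<Sum>l\<in>UNIV. x $ l *s row l (M p)) else row j (M p))"
      by (simp add: R_def vec_eq_iff row_def)
    then show ?thesis
      using cramer_lemma_transpose[of i x "M p"] by (simp add: x_def)
  qed
  have "pd \<kappa> (\<lambda>q. det (M q)) b p
      = (\<Sum>\<pi> | \<pi> permutes (UNIV :: 'k set). of_int (sign \<pi>) *
          (\<Sum>i\<in>UNIV. \<Prod>j\<in>UNIV. if j = i then D j (\<pi> j) else M p $ j $ \<pi> j))"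
    unfolding det_def D_def
    by (subst pd_sum[OF p]) (auto intro!: sm_mult sm_const sm_prod s sum.cong
        simp: pd_mult[OF p sm_const sm_prod] pd_prod s)
  also have "\<dots> = (\<Sum>i\<in>UNIV. det (R i))"
    unfolding det_def R_def
    by (subst sum.swap) (auto simp: sum_distrib_left intro!: sum.cong prod.cong)
  finally show ?thesis by (simp add: R D_def sum_distrib_left sum_distrib_right mult_ac)
qed

end

end

section \<open>The Levi-Civita calculus of a metric in a chart\<close>

context chart_open
begin

lemma sm_matrix:
  fixes f :: "'m \<Rightarrow> real ^ 'k ^ 'l" assumes "\<And>i j. sm (\<lambda>p. f p $ i $ j)" shows "sm f"
proof -
  have "sm (\<lambda>p. \<Sum>i\<in>UNIV. \<Sum>j\<in>UNIV. f p $ i $ j *\<^sub>R (axis i (axis j 1) :: real ^ 'k ^ 'l))"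
    by (intro sm_sum sm_scaleR_const assms)
  moreover have "(\<Sum>i\<in>UNIV. \<Sum>j\<in>UNIV. f p $ i $ j *\<^sub>R (axis i (axis j 1) :: real ^ 'k ^ 'l)) = f p" for p
  proof -
    have "(f p $ i $ j *\<^sub>R (axis i (axis j 1) :: real ^ 'k ^ 'l)) $ a $ b
       = (if j = b then if i = a then f p $ i $ j else 0 else 0)" for i j a b
      by (simp add: axis_def)
    then show ?thesis by (simp add: vec_eq_iff)
  qed
  ultimately show ?thesis by simp
qed

lemma sm_matrix_vector_mult:
  fixes A :: "'m \<Rightarrow> real ^ 'k ^ 'l"
  assumes "sm A" "sm x" shows "sm (\<lambda>q. A q *v x q)"
  unfolding matrix_vector_mult_def
  by (rule sm_vec) (use assms in \<open>simp, intro sm_sum sm_mult sm_component\<close>)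

lemma sm_matrix_mult:
  fixes A :: "'m \<Rightarrow> real ^ 'k ^ 'l" and B :: "'m \<Rightarrow> real ^ 'n ^ 'k"
  assumes "sm A" "sm B" shows "sm (\<lambda>q. A q ** B q)"
  unfolding matrix_matrix_mult_def
  by (rule sm_matrix) (use assms in \<open>simp, intro sm_sum sm_mult sm_component\<close>)

lemma sm_scaleR:
  fixes M :: "'m \<Rightarrow> real ^ 'k ^ 'l"
  assumes "sm f" "sm M" shows "sm (\<lambda>q. f q *\<^sub>R M q)"
  by (rule sm_matrix) (use assms in \<open>simp, intro sm_mult sm_component\<close>)

context
  fixes p assumes p: "p \<in> W"
begin

lemma pd_nth2:
  fixes M :: "'m \<Rightarrow> real ^ 'k ^ 'l"
  shows "sm M \<Longrightarrow> pd \<kappa> (\<lambda>q. M q $ i $ j) c p = pd \<kappa> M c p $ i $ j"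
  using pd_component[OF p, of "\<lambda>q. M q $ i" j c] pd_component[OF p, of M i c] sm_component[of M i]
  by simp

lemma pd_matrix_vector_mult:
  fixes A :: "'m \<Rightarrow> real ^ 'k ^ 'l"
  assumes "sm A" "sm x"
  shows "pd \<kappa> (\<lambda>q. A q *v x q) c p = A p *v pd \<kappa> x c p + pd \<kappa> A c p *v x p"
proof -
  have "pd \<kappa> (\<lambda>q. A q *v x q) c p $ i = pd \<kappa> (\<lambda>q. \<Sum>k\<in>UNIV. A q $ i $ k * x q $ k) c p" for i
    by (simp add: pd_component[OF p sm_matrix_vector_mult[OF assms], symmetric]) (simp add: matrix_vector_mult_def)
  also have "\<dots> i = (\<Sum>k\<in>UNIV. A p $ i $ k * pd \<kappa> x c p $ k + pd \<kappa> A c p $ i $ k * x p $ k)" for i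
    by (simp add: pd_sum[OF p] sm_mult sm_component assms pd_mult[OF p]
        pd_component[OF p assms(2)] pd_nth2[OF assms(1)])
  finally show ?thesis by (simp add: vec_eq_iff matrix_vector_mult_def sum.distrib)
qed

lemma pd_matrix_mult:
  fixes A :: "'m \<Rightarrow> real ^ 'k ^ 'l" and B :: "'m \<Rightarrow> real ^ 'n ^ 'k"
  assumes "sm A" "sm B"
  shows "pd \<kappa> (\<lambda>q. A q ** B q) c p = A p ** pd \<kappa> B c p + pd \<kappa> A c p ** B p"
proof -
  have "pd \<kappa> (\<lambda>q. A q ** B q) c p $ i $ j = pd \<kappa> (\<lambda>q. \<Sum>k\<in>UNIV. A q $ i $ k * B q $ k $ j) c p" for i j
    by (simp add: pd_nth2[OF sm_matrix_mult[OF assms], symmetric]) (simp add: matrix_matrix_mult_def)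
  also have "\<dots> i j = (\<Sum>k\<in>UNIV. A p $ i $ k * pd \<kappa> B c p $ k $ j + pd \<kappa> A c p $ i $ k * B p $ k $ j)" for i j
    by (simp add: pd_sum[OF p] sm_mult sm_component assms pd_mult[OF p]
        pd_nth2[OF assms(2)] pd_nth2[OF assms(1)])
  finally show ?thesis by (simp add: vec_eq_iff matrix_matrix_mult_def sum.distrib)
qed

lemma pd_scaleR:
  fixes M :: "'m \<Rightarrow> real ^ 'k ^ 'l"
  assumes "sm f" "sm M"
  shows "pd \<kappa> (\<lambda>q. f q *\<^sub>R M q) c p = f p *\<^sub>R pd \<kappa> M c p + pd \<kappa> f c p *\<^sub>R M p"
proof -
  have "pd \<kappa> (\<lambda>q. f q *\<^sub>R M q) c p $ i $ j = pd \<kappa> (\<lambda>q. f q * M q $ i $ j) c p" for i j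
    by (simp add: pd_nth2[OF sm_scaleR[OF assms], symmetric])
  also have "\<dots> i j = f p * pd \<kappa> M c p $ i $ j + pd \<kappa> f c p * M p $ i $ j" for i j
    using assms by (simp add: pd_mult[OF p] sm_component pd_nth2)
  finally show ?thesis by (simp add: vec_eq_iff)
qed

end

end

locale metric_chart = chart_open \<kappa> W for \<kappa> :: "'m chart" and W :: "'m set" +
  fixes g :: "'m metric"
  assumes g_sm: "sm (g \<kappa>)"
    and g_sym: "p \<in> W \<Longrightarrow> transpose (g \<kappa> p) = g \<kappa> p"
    and g_inv: "p \<in> W \<Longrightarrow> invertible (g \<kappa> p)"
begin

text \<open>The factor relating a metric to the conformal metric, \<open>g = vol * cmetric\<close>.
  Under changes of chart it is a density of weight -2, so multiplication by it turns weight 2 into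
  weight 0.\<close>

definition vol :: "'m \<Rightarrow> real" where "vol p = \<bar>det (g \<kappa> p)\<bar> powr (1 / 5)"

abbreviation wc :: "5 \<Rightarrow> 'm \<Rightarrow> real" where "wc b p \<equiv> wconn g \<kappa> 1 b p"

definition Gam :: "5 \<Rightarrow> 'm \<Rightarrow> real ^ 5 ^ 5" where "Gam c p = (\<chi> d a. chr g \<kappa> p d c a)"

lemma wconn_eq: "wconn g \<kappa> w b p = w * wc b p" by (simp add: wconn_def)

lemma g_sym_nth: "p \<in> W \<Longrightarrow> g \<kappa> p $ a $ b = g \<kappa> p $ b $ a"
  by (rule transpose_eq_nth[OF g_sym])

lemma g_sm_nth: "sm (\<lambda>q. g \<kappa> q $ a $ b)"
  by (intro sm_component g_sm)

lemma pd_g_sym: "p \<in> W \<Longrightarrow> pd \<kappa> (\<lambda>q. g \<kappa> q $ a $ b) c p = pd \<kappa> (\<lambda>q. g \<kappa> q $ b $ a) c p"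
  by (rule pd_cong[OF g_sm_nth]) (auto simp: g_sym_nth)

lemma chr_sm: "sm (\<lambda>p. chr g \<kappa> p a b c)"
  unfolding chr_def
  by (intro sm_mult sm_const sm_sum sm_add sm_diff sm_pd g_sm_nth sm_matrix_inv g_inv)

lemma chr_sym: "p \<in> W \<Longrightarrow> chr g \<kappa> p a b c = chr g \<kappa> p a c b"
  unfolding chr_def by (simp add: pd_g_sym[of p b c] algebra_simps)

lemma Gam_nth: "Gam c p $ d $ a = chr g \<kappa> p d c a" by (simp add: Gam_def)

lemma g_chr:
  assumes p: "p \<in> W"
  shows "(\<Sum>e\<in>UNIV. g \<kappa> p $ a $ e * chr g \<kappa> p e b c) = (1 / 2) *
    (pd \<kappa> (\<lambda>q. g \<kappa> q $ a $ c) b p + pd \<kappa> (\<lambda>q. g \<kappa> q $ a $ b) c p - pd \<kappa> (\<lambda>q. g \<kappa> q $ b $ c) a p)"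
    (is "_ = 1 / 2 * ?K a")
proof -
  have "(\<Sum>e\<in>UNIV. g \<kappa> p $ a $ e * chr g \<kappa> p e b c)
      = (\<Sum>e\<in>UNIV. \<Sum>d\<in>UNIV. (1 / 2) * ?K d * (g \<kappa> p $ a $ e * matrix_inv (g \<kappa> p) $ e $ d))"
    unfolding chr_def by (simp add: sum_distrib_left mult_ac)
  also have "\<dots> = (\<Sum>d\<in>UNIV. (1 / 2) * ?K d * (g \<kappa> p ** matrix_inv (g \<kappa> p)) $ a $ d)"
    by (subst sum.swap) (simp add: matrix_matrix_mult_def sum_distrib_left)
  also have "\<dots> = (\<Sum>d\<in>UNIV. if d = a then (1 / 2) * ?K d else 0)"
    unfolding matrix_inv_right[OF g_inv[OF p]] by (intro sum.cong refl) (auto simp: mat_def)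
  finally show ?thesis by simp
qed

text \<open>Metric compatibility of the Levi-Civita connection, in matrix form so that later
  derivatives reduce to matrix algebra.\<close>

lemma pd_g:
  assumes p: "p \<in> W"
  shows "pd \<kappa> (g \<kappa>) c p = g \<kappa> p ** Gam c p + transpose (Gam c p) ** g \<kappa> p"
proof -
  have "pd \<kappa> (\<lambda>q. g \<kappa> q $ a $ b) c p = (\<Sum>e\<in>UNIV. g \<kappa> p $ a $ e * chr g \<kappa> p e c b)
      + (\<Sum>e\<in>UNIV. g \<kappa> p $ b $ e * chr g \<kappa> p e c a)" for a b
    unfolding g_chr[OF p] using pd_g_sym[OF p] by (simp add: field_simps)
  then have "pd \<kappa> (g \<kappa>) c p $ a $ b = (\<Sum>e\<in>UNIV. g \<kappa> p $ a $ e * chr g \<kappa> p e c b)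
      + (\<Sum>e\<in>UNIV. chr g \<kappa> p e c a * g \<kappa> p $ e $ b)" for a b
    by (simp add: pd_nth2[OF p g_sm, symmetric] mult.commute g_sym_nth[OF p, of b])
  then show ?thesis
    by (simp add: vec_eq_iff matrix_matrix_mult_def transpose_def Gam_nth)
qed

section \<open>The metric density and the symmetry of the Ricci tensor\<close>

lemma det_g_nz: "p \<in> W \<Longrightarrow> det (g \<kappa> p) \<noteq> 0" using g_inv invertible_det_nz by blast

lemma vol_pos: "p \<in> W \<Longrightarrow> vol p > 0" using det_g_nz by (simp add: vol_def)

text \<open>The square of the determinant replaces the absolute value: it is smooth and positive, as
  the power rules require.\<close>

lemma vol_eq: "vol p = (det (g \<kappa> p) * det (g \<kappa> p)) powr (1 / 10)"
proof -
  have "(det (g \<kappa> p) * det (g \<kappa> p)) powr (1 / 10) = (\<bar>det (g \<kappa> p)\<bar> * \<bar>det (g \<kappa> p)\<bar>) powr (1 / 10)" by simp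
  also have "\<dots> = \<bar>det (g \<kappa> p)\<bar> powr (1 / 10) * \<bar>det (g \<kappa> p)\<bar> powr (1 / 10)"
    by (rule powr_mult)
  also have "\<dots> = \<bar>det (g \<kappa> p)\<bar> powr (1 / 10 + 1 / 10)" by (rule powr_add[symmetric])
  finally show ?thesis by (simp add: vol_def)
qed

lemma det_g_sm: "sm (\<lambda>q. det (g \<kappa> q))" by (intro sm_det g_sm_nth)

lemma vol_sm: "sm vol"
proof -
  have "sm (\<lambda>p. (det (g \<kappa> p) * det (g \<kappa> p)) powr (1 / 10))"
    by (rule sm_powr[OF sm_mult[OF det_g_sm det_g_sm]]) (metis det_g_nz not_real_square_gt_zero)
  then show ?thesis by (simp add: vol_eq[abs_def])
qed

lemma wconn_sm: "sm (\<lambda>q. wconn g \<kappa> w b q)"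
  unfolding wconn_def by (intro sm_mult sm_const sm_sum chr_sm)

text \<open>The logarithmic derivative of the determinant is twice the trace of the Christoffel
  symbols, and a fifth of this is \<open>2 * wc\<close>. Equivalently, \<open>vol\<close> is
  parallel as a density of weight -2.\<close>

lemma pd_vol:
  assumes p: "p \<in> W" shows "pd \<kappa> vol b p = 2 * wc b p * vol p"
proof -
  let ?d = "det (g \<kappa> p)" and ?i = "matrix_inv (g \<kappa> p)"
  have dd: "?d * ?d > 0" using det_g_nz[OF p] by (metis not_real_square_gt_zero)
  \<comment> \<open>In the trace of the Christoffel formula two of the three terms cancel by
    symmetry of the inverse metric. The constant 10 undoes the 1/2 of that formula and the 1/5 of
    \<open>wconn\<close>.\<close>
  have tr: "(\<Sum>i\<in>UNIV. \<Sum>k\<in>UNIV. ?i $ k $ i * pd \<kappa> (\<lambda>q. g \<kappa> q $ i $ k) b p) = 10 * wc b p"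
  proof -
    have *: "(\<Sum>k\<in>UNIV. \<Sum>i\<in>UNIV. ?i $ k $ i * pd \<kappa> (\<lambda>q. g \<kappa> q $ b $ k) i p)
        = (\<Sum>k\<in>UNIV. \<Sum>i\<in>UNIV. ?i $ k $ i * pd \<kappa> (\<lambda>q. g \<kappa> q $ i $ b) k p)"
    proof -
      have "transpose ?i = ?i"
        by (rule transpose_matrix_inv[OF g_inv[OF p] g_sym[OF p]])
      then have "?i $ k $ i = ?i $ i $ k" for i k by (rule transpose_eq_nth)
      then show ?thesis
        by (subst sum.swap) (intro sum.cong refl arg_cong2[of _ _ _ _ "(*)"] pd_g_sym[OF p]; simp)
    qed
    have "(\<Sum>k\<in>UNIV. \<Sum>i\<in>UNIV. ?i $ k $ i * (pd \<kappa> (\<lambda>q. g \<kappa> q $ i $ k) b p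
        + pd \<kappa> (\<lambda>q. g \<kappa> q $ i $ b) k p - pd \<kappa> (\<lambda>q. g \<kappa> q $ b $ k) i p))
       = (\<Sum>k\<in>UNIV. \<Sum>i\<in>UNIV. ?i $ k $ i * pd \<kappa> (\<lambda>q. g \<kappa> q $ i $ k) b p)"
      by (simp add: distrib_left right_diff_distrib sum.distrib sum_subtractf *)
    moreover have "10 * wc b p = (\<Sum>k\<in>UNIV. \<Sum>i\<in>UNIV. ?i $ k $ i * (pd \<kappa> (\<lambda>q. g \<kappa> q $ i $ k) b p
        + pd \<kappa> (\<lambda>q. g \<kappa> q $ i $ b) k p - pd \<kappa> (\<lambda>q. g \<kappa> q $ b $ k) i p))"
      unfolding wconn_def chr_def sum_distrib_left[of "1 / 2", symmetric] by simp
    ultimately show ?thesis by (subst sum.swap) simp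
  qed
  have "pd \<kappa> vol b p = (1 / 10) * (vol p / (?d * ?d)) * (2 * ?d * pd \<kappa> (\<lambda>q. det (g \<kappa> q)) b p)"
    unfolding vol_eq[abs_def]
    by (subst pd_powr[OF p]) (use dd in \<open>auto intro!: sm_mult det_g_sm simp: pd_mult[OF p] det_g_sm\<close>)
  also have "\<dots> = 2 * wc b p * vol p"
    unfolding pd_det[OF p g_sm_nth g_inv[OF p]] tr using det_g_nz[OF p] by simp
  finally show ?thesis .
qed

text \<open>By \<open>pd_vol\<close>, twice \<open>wc\<close> is the logarithmic differential of
  \<open>vol\<close>, so its curl vanishes by equality of mixed partials.\<close>

lemma pd_wc_sym:
  assumes p: "p \<in> W" shows "pd \<kappa> (wc b) a p = pd \<kappa> (wc a) b p"
proof -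
  have w: "sm (wc a)" for a using wconn_sm[of 1 a] by simp
  have "pd \<kappa> (pd \<kappa> vol b) a p = 2 * pd \<kappa> (wc b) a p * vol p + 4 * wc b p * wc a p * vol p" for a b
  proof -
    have "pd \<kappa> (pd \<kappa> vol b) a p = pd \<kappa> (\<lambda>q. 2 * wc b q * vol q) a p"
      by (rule pd_cong[OF sm_pd[OF vol_sm]]) (use p pd_vol in auto)
    also have "\<dots> = 2 * wc b p * (2 * wc a p * vol p) + 2 * pd \<kappa> (wc b) a p * vol p"
      using w by (subst pd_mult[OF p]) (auto intro!: sm_mult sm_const vol_sm simp: pd_mult[OF p sm_const] pd_vol[OF p])
    finally show ?thesis by (simp add: algebra_simps)
  qed
  from this[of b a] this[of a b] have "2 * pd \<kappa> (wc b) a p * vol p = 2 * pd \<kappa> (wc a) b p * vol p"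
    using pd_commute[OF p vol_sm, of a b] by simp
  then show ?thesis using vol_pos[OF p] by simp
qed

text \<open>The derivative of the traced Christoffel symbol is the term whose symmetry is not
  algebraic; it is \<open>5 * wc\<close> and is covered by \<open>pd_wc_sym\<close>.\<close>

lemma ricci_sym:
  assumes p: "p \<in> W" shows "ricci g \<kappa> p a b = ricci g \<kappa> p b a"
proof -
  have 1: "(\<Sum>c\<in>UNIV. pd \<kappa> (\<lambda>q. chr g \<kappa> q c a b) c p - pd \<kappa> (\<lambda>q. chr g \<kappa> q c c b) a p)
      = (\<Sum>c\<in>UNIV. pd \<kappa> (\<lambda>q. chr g \<kappa> q c a b) c p) - 5 * pd \<kappa> (wc b) a p" for a b
  proof -
    have "pd \<kappa> (wc b) a p = pd \<kappa> (\<lambda>q. (1 / 5) * (\<Sum>c\<in>UNIV. chr g \<kappa> q c c b)) a p"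
      by (rule pd_cong[OF wconn_sm]) (use p chr_sym in \<open>auto simp: wconn_def\<close>)
    also have "\<dots> = (1 / 5) * (\<Sum>c\<in>UNIV. pd \<kappa> (\<lambda>q. chr g \<kappa> q c c b) a p)"
      by (subst pd_mult[OF p]) (auto intro!: sm_const sm_sum chr_sm simp: pd_sum[OF p] chr_sm)
    finally show ?thesis by (simp add: sum_subtractf)
  qed
  have 2: "pd \<kappa> (\<lambda>q. chr g \<kappa> q c a b) c p = pd \<kappa> (\<lambda>q. chr g \<kappa> q c b a) c p" for c
    by (rule pd_cong[OF chr_sm]) (use p chr_sym in auto)
  have 3: "(\<Sum>c\<in>UNIV. \<Sum>d\<in>UNIV. chr g \<kappa> p c a d * chr g \<kappa> p d c b)
      = (\<Sum>c\<in>UNIV. \<Sum>d\<in>UNIV. chr g \<kappa> p c b d * chr g \<kappa> p d c a)"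
    by (subst sum.swap) (simp add: chr_sym[OF p, of _ a] chr_sym[OF p, of _ b] mult.commute)
  have 4: "(\<Sum>c\<in>UNIV. \<Sum>d\<in>UNIV. chr g \<kappa> p c c d * chr g \<kappa> p d a b - chr g \<kappa> p c a d * chr g \<kappa> p d c b)
      = (\<Sum>c\<in>UNIV. \<Sum>d\<in>UNIV. chr g \<kappa> p c c d * chr g \<kappa> p d a b)
      - (\<Sum>c\<in>UNIV. \<Sum>d\<in>UNIV. chr g \<kappa> p c a d * chr g \<kappa> p d c b)" for a b
    by (simp add: sum_subtractf)
  show ?thesis
    unfolding ricci_def 1 4 3 by (simp add: 2 pd_wc_sym[OF p, of b] chr_sym[OF p, of _ a b])
qed

lemma schouten_sym: "p \<in> W \<Longrightarrow> schouten g \<kappa> p a b = schouten g \<kappa> p b a"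
  unfolding schouten_def using ricci_sym[of p a b] g_sym_nth[of p a b] by simp

lemma schouten_sm: "sm (\<lambda>p. schouten g \<kappa> p a b)"
  unfolding schouten_def scal_def ricci_def
  by (intro sm_mult sm_const sm_sum sm_add sm_diff sm_pd chr_sm g_sm_nth sm_matrix_inv g_inv)

section \<open>The conformal metric and its inverse\<close>

lemma cmetric_eq: "cmetric g \<kappa> p = inverse (vol p) *\<^sub>R g \<kappa> p"
  by (simp add: cmetric_def vol_def powr_minus)

lemma inverse_vol_sm: "sm (\<lambda>q. inverse (vol q))"
  by (rule sm_inverse[OF vol_sm]) (metis less_irrefl vol_pos)

lemma cmetric_sm: "sm (cmetric g \<kappa>)"
  unfolding cmetric_eq[abs_def] by (intro sm_scaleR inverse_vol_sm g_sm)

lemma cmetric_sym: "p \<in> W \<Longrightarrow> transpose (cmetric g \<kappa> p) = cmetric g \<kappa> p"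
  by (simp add: cmetric_def transpose_scalar g_sym)

lemma cmetric_inv: "p \<in> W \<Longrightarrow> invertible (cmetric g \<kappa> p)"
  unfolding cmetric_eq by (rule scalar_invertible[OF _ g_inv]) (use vol_pos[of p] in simp_all)

lemma cmetric_cinv: "p \<in> W \<Longrightarrow> cmetric g \<kappa> p ** cinv g \<kappa> p = mat 1"
  and cinv_cmetric: "p \<in> W \<Longrightarrow> cinv g \<kappa> p ** cmetric g \<kappa> p = mat 1"
  unfolding cinv_def by (simp_all add: matrix_inv_right[OF cmetric_inv] matrix_inv_left[OF cmetric_inv])

lemma cinv_sym: "p \<in> W \<Longrightarrow> transpose (cinv g \<kappa> p) = cinv g \<kappa> p"
  unfolding cinv_def by (rule transpose_matrix_inv[OF cmetric_inv cmetric_sym])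

lemma cinv_sm: "sm (cinv g \<kappa>)"
  unfolding cinv_def[abs_def]
  by (rule sm_matrix, rule sm_matrix_inv[OF sm_component[OF sm_component[OF cmetric_sm]] cmetric_inv])

text \<open>The conformal metric is parallel as a tensor of weight 2; the last term is the weight
  contribution.\<close>

lemma pd_cmetric:
  assumes p: "p \<in> W"
  shows "pd \<kappa> (cmetric g \<kappa>) c p = cmetric g \<kappa> p ** Gam c p + transpose (Gam c p) ** cmetric g \<kappa> p
     - (2 * wc c p) *\<^sub>R cmetric g \<kappa> p"
proof -
  \<comment> \<open>Obtained by differentiating \<open>vol * inverse vol = 1\<close>.\<close>
  have i: "pd \<kappa> (\<lambda>q. inverse (vol q)) c p = - (2 * wc c p) * inverse (vol p)"
  proof -
    have "pd \<kappa> (\<lambda>q. 1) c p = pd \<kappa> (\<lambda>q. vol q * inverse (vol q)) c p"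
      by (rule pd_cong[OF sm_const _ p]) (metis less_irrefl right_inverse vol_pos)
    then have "vol p * (pd \<kappa> (\<lambda>q. inverse (vol q)) c p + 2 * wc c p * inverse (vol p)) = 0"
      by (simp add: pd_mult[OF p vol_sm inverse_vol_sm] pd_vol[OF p] algebra_simps)
    then show ?thesis using vol_pos[OF p] by (simp add: eq_neg_iff_add_eq_0)
  qed
  show ?thesis
    unfolding cmetric_eq[abs_def] pd_scaleR[OF p inverse_vol_sm g_sm] i pd_g[OF p]
    by (simp add: scaleR_add_right scalar_matrix_assoc[symmetric] matrix_scalar_ac)
qed

end

section \<open>Almost Einstein scales in a chart\<close>

lemma tr_H_self: "tr_H G (s, m, r) (s, m, r) = 2 * (s * r) + m \<bullet> (G *v m)"
  by (simp add: tr_H_def)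

locale scale_chart = metric_chart \<kappa> W g for \<kappa> :: "'m chart" and W :: "'m set" and g :: "'m metric" +
  fixes \<sigma> :: "'m density"
  assumes \<sigma>_sm: "sm (\<sigma> \<kappa>)"
    and ae: "p \<in> W \<Longrightarrow> ae_tensor g \<kappa> \<sigma> p a b - (1 / 5) * ae_trace g \<kappa> \<sigma> p * cmetric g \<kappa> p $ a $ b = 0"
begin

definition grad :: "'m \<Rightarrow> real ^ 5" where "grad p = grad_scale g \<kappa> \<sigma> p"
definition mu :: "'m \<Rightarrow> real ^ 5" where "mu p = cinv g \<kappa> p *v grad p"
definition rho :: "'m \<Rightarrow> real" where "rho p = - (1 / 5) * ae_trace g \<kappa> \<sigma> p"
definition Pcol :: "5 \<Rightarrow> 'm \<Rightarrow> real ^ 5" where "Pcol c p = (\<chi> d. schouten g \<kappa> p d c)"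
text \<open>The third slot of the covariant derivative of the scale tractor, the one slot about
  which the almost Einstein equation says nothing directly.\<close>

definition lam :: "5 \<Rightarrow> 'm \<Rightarrow> real" where "lam c p = pd \<kappa> rho c p - wc c p * rho p - Pcol c p \<bullet> mu p"

lemma scale_tractor_eq: "scale_tractor g \<kappa> \<sigma> p = (\<sigma> \<kappa> p, mu p, rho p)"
  by (simp add: scale_tractor_def mu_def rho_def grad_def)

lemma grad_nth: "grad p $ b = pd \<kappa> (\<sigma> \<kappa>) b p + wc b p * \<sigma> \<kappa> p"
  by (simp add: grad_def grad_scale_def cd_dens_def)

lemma grad_sm: "sm grad"
  by (rule sm_vec) (unfold grad_nth, intro sm_add sm_mult sm_pd \<sigma>_sm wconn_sm)

lemma mu_sm: "sm mu"
  unfolding mu_def[abs_def] by (rule sm_matrix_vector_mult[OF cinv_sm grad_sm])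

lemma rho_sm: "sm rho"
  unfolding rho_def[abs_def] ae_trace_def ae_tensor_def cd_covec_def grad_def[symmetric]
  by (intro sm_mult sm_const sm_sum sm_add sm_diff sm_pd chr_sm wconn_sm schouten_sm \<sigma>_sm
      sm_component[OF grad_sm] sm_component[OF sm_component[OF cinv_sm]])

lemma scale_tractor_sm: "sm (scale_tractor g \<kappa> \<sigma>)"
  unfolding scale_tractor_eq[abs_def] by (intro sm_Pair \<sigma>_sm mu_sm rho_sm)

context
  fixes p assumes p: "p \<in> W"
begin

lemma cmetric_mu: "cmetric g \<kappa> p *v mu p = grad p"
  by (simp add: mu_def matrix_vector_mul_assoc cmetric_cinv[OF p])

text \<open>The almost Einstein equation solved for the second derivatives of the scale;
  \<open>rho\<close> absorbs the trace.\<close>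

lemma pd_grad:
  "pd \<kappa> grad c p = transpose (Gam c p) *v grad p - wc c p *\<^sub>R grad p - \<sigma> \<kappa> p *\<^sub>R Pcol c p
     - rho p *\<^sub>R (cmetric g \<kappa> p *v axis c 1)"
proof -
  have "pd \<kappa> grad c p $ a = (transpose (Gam c p) *v grad p) $ a - wc c p * grad p $ a
      - \<sigma> \<kappa> p * schouten g \<kappa> p a c - rho p * cmetric g \<kappa> p $ a $ c" for a
  proof -
    have "cd_covec g \<kappa> 1 grad a c p = pd \<kappa> grad c p $ a - (transpose (Gam c p) *v grad p) $ a + wc c p * grad p $ a"
      by (simp add: cd_covec_def pd_component[OF p grad_sm] matrix_vector_mult_def transpose_def Gam_def)
    moreover have "cd_covec g \<kappa> 1 grad a c p + schouten g \<kappa> p a c * \<sigma> \<kappa> p + rho p * cmetric g \<kappa> p $ a $ c = 0"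
      using ae[OF p, of a c] by (simp add: ae_tensor_def rho_def grad_def[abs_def])
    ultimately show ?thesis by (simp add: algebra_simps)
  qed
  then show ?thesis
    by (simp add: vec_eq_iff Pcol_def matrix_vector_mul_component inner_axis)
qed

text \<open>Differentiating \<open>cmetric * mu = grad\<close> and solving for the derivative of
  \<open>mu\<close> avoids differentiating the inverse matrix.\<close>

lemma pd_mu:
  "pd \<kappa> mu c p = - (Gam c p *v mu p) + wc c p *\<^sub>R mu p - \<sigma> \<kappa> p *\<^sub>R (cinv g \<kappa> p *v Pcol c p)
     - rho p *\<^sub>R axis c 1"
proof -
  let ?G = "cmetric g \<kappa> p"
  have "pd \<kappa> grad c p = pd \<kappa> (\<lambda>q. cmetric g \<kappa> q *v mu q) c p"
    by (rule pd_cong[OF grad_sm _ p]) (simp add: mu_def matrix_vector_mul_assoc cmetric_cinv)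
  also have "\<dots> = ?G *v pd \<kappa> mu c p + (?G ** Gam c p + transpose (Gam c p) ** ?G - (2 * wc c p) *\<^sub>R ?G) *v mu p"
    by (simp add: pd_matrix_vector_mult[OF p cmetric_sm mu_sm] pd_cmetric[OF p])
  also have "\<dots> = ?G *v pd \<kappa> mu c p + ?G *v (Gam c p *v mu p) + transpose (Gam c p) *v grad p - (2 * wc c p) *\<^sub>R grad p"
    by (simp add: matrix_vector_mult_add_rdistrib matrix_vector_mult_diff_rdistrib
        matrix_vector_mul_assoc[symmetric] scaleR_matrix_vector_assoc[symmetric] cmetric_mu)
  finally have *: "pd \<kappa> grad c p = ?G *v pd \<kappa> mu c p + ?G *v (Gam c p *v mu p)
        + transpose (Gam c p) *v grad p - (2 * wc c p) *\<^sub>R grad p" .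
  \<comment> \<open>The cancellation is isolated on plain vectors, with \<open>2 * wc * grad\<close>
    split as \<open>y + y\<close>.\<close>
  have "M = - C + y - s - r" if "X - y - s - r = M + C + X - (y + y)" for M C y s r X :: "real ^ 5"
    using that by (simp add: algebra_simps)
  from this[OF *[unfolded pd_grad mult_2 scaleR_add_left]]
  have "?G *v pd \<kappa> mu c p = - (?G *v (Gam c p *v mu p)) + wc c p *\<^sub>R grad p
      - \<sigma> \<kappa> p *\<^sub>R Pcol c p - rho p *\<^sub>R (?G *v axis c 1)" .
  then have "cinv g \<kappa> p *v (?G *v pd \<kappa> mu c p) = cinv g \<kappa> p *v (- (?G *v (Gam c p *v mu p)) + wc c p *\<^sub>R grad p
      - \<sigma> \<kappa> p *\<^sub>R Pcol c p - rho p *\<^sub>R (?G *v axis c 1))" by simp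
  moreover have "cinv g \<kappa> p *v (?G *v x) = x" for x
    by (simp add: matrix_vector_mul_assoc cinv_cmetric[OF p])
  ultimately show ?thesis
    by (simp add: matrix_vector_right_distrib vec.neg matrix_vector_mult_diff_distrib
        matrix_vector_mult_scaleR mu_def[symmetric])
qed

text \<open>The first slot vanishes because \<open>mu\<close> is the raised gradient, the second by
  the almost Einstein equation.\<close>

lemma nabla_scale_tractor: "tr_nabla g \<kappa> (scale_tractor g \<kappa> \<sigma>) c p = (0, 0, lam c p)"
proof -
  have 1: "cd_dens g \<kappa> 1 (\<sigma> \<kappa>) c p - (cmetric g \<kappa> p *v mu p) $ c = 0"
    by (simp add: cmetric_mu grad_nth cd_dens_def)
  have 2: "cd_vec g \<kappa> (- 1) mu a c p + (\<Sum>d\<in>UNIV. cinv g \<kappa> p $ a $ d * schouten g \<kappa> p d c) * \<sigma> \<kappa> p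
      + (if a = c then rho p else 0) = 0" for a
  proof -
    have "cd_vec g \<kappa> (- 1) mu a c p = pd \<kappa> mu c p $ a + (Gam c p *v mu p) $ a - wc c p * mu p $ a"
      by (simp add: cd_vec_def pd_component[OF p mu_sm] wconn_eq[of "- 1"] matrix_vector_mult_def Gam_def)
    then show ?thesis
      unfolding pd_mu by (simp add: matrix_vector_mult_def[of "cinv g \<kappa> p"] Pcol_def axis_def)
  qed
  have 3: "cd_dens g \<kappa> (- 1) rho c p - (\<Sum>d\<in>UNIV. schouten g \<kappa> p c d * mu p $ d) = lam c p"
    by (simp add: cd_dens_def lam_def wconn_eq[of "- 1"] Pcol_def inner_vec_def schouten_sym[OF p, of c])
  show ?thesis
    using 1 2 3 by (simp add: tr_nabla_def scale_tractor_eq[abs_def] vec_eq_iff)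
qed

text \<open>In invariant terms this is \<open>2 * H (nabla S) S\<close>, where
  \<open>nabla S\<close> is \<open>lam\<close> times the canonical tractor and \<open>H X S\<close>
  is the scale.\<close>

lemma pd_tr_H_scale_tractor:
  "pd \<kappa> (\<lambda>q. tr_H (cmetric g \<kappa> q) (scale_tractor g \<kappa> \<sigma> q) (scale_tractor g \<kappa> \<sigma> q)) c p
     = 2 * \<sigma> \<kappa> p * lam c p"
proof -
  let ?G = "cmetric g \<kappa> p"
  have s: "sm (\<lambda>q. 2 * (\<sigma> \<kappa> q * rho q) + (\<Sum>a\<in>UNIV. mu q $ a * grad q $ a))"
    by (intro sm_add sm_mult sm_const sm_sum \<sigma>_sm rho_sm sm_component[OF mu_sm] sm_component[OF grad_sm])
  have "pd \<kappa> (\<lambda>q. tr_H (cmetric g \<kappa> q) (scale_tractor g \<kappa> \<sigma> q) (scale_tractor g \<kappa> \<sigma> q)) c p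
     = pd \<kappa> (\<lambda>q. 2 * (\<sigma> \<kappa> q * rho q) + (\<Sum>a\<in>UNIV. mu q $ a * grad q $ a)) c p"
    by (rule pd_cong[OF s _ p, symmetric])
       (simp add: scale_tractor_eq tr_H_self mu_def matrix_vector_mul_assoc cmetric_cinv inner_vec_def)
  also have "\<dots> = 2 * (\<sigma> \<kappa> p * pd \<kappa> rho c p + pd \<kappa> (\<sigma> \<kappa>) c p * rho p)
      + (mu p \<bullet> pd \<kappa> grad c p + pd \<kappa> mu c p \<bullet> grad p)"
    by (simp add: pd_add[OF p] pd_mult[OF p] pd_sum[OF p] sm_mult sm_sum sm_const \<sigma>_sm rho_sm
        sm_component[OF mu_sm] sm_component[OF grad_sm] pd_component[OF p mu_sm]
        pd_component[OF p grad_sm] inner_vec_def sum.distrib)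
  also have "mu p \<bullet> pd \<kappa> grad c p + pd \<kappa> mu c p \<bullet> grad p
      = - 2 * \<sigma> \<kappa> p * (Pcol c p \<bullet> mu p) - 2 * rho p * grad p $ c"
  proof -
    have "(cinv g \<kappa> p *v Pcol c p) \<bullet> grad p = Pcol c p \<bullet> mu p"
      using inner_transpose_mult[of "Pcol c p" "cinv g \<kappa> p" "grad p"] cinv_sym[OF p] by (simp add: mu_def)
    moreover have "mu p \<bullet> (?G *v axis c 1) = grad p $ c"
      using inner_transpose_mult[of "mu p" ?G "axis c 1"] cmetric_sym[OF p]
      by (simp add: cmetric_mu inner_axis)
    moreover have "mu p \<bullet> (transpose (Gam c p) *v grad p) = (Gam c p *v mu p) \<bullet> grad p"
      by (rule inner_transpose_mult)
    ultimately show ?thesis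
      unfolding pd_grad pd_mu
      by (simp add: inner_diff_left inner_diff_right inner_add_left inner_add_right inner_commute[of _ "mu p"]
          inner_axis inner_axis' algebra_simps)
  qed
  finally show ?thesis by (simp add: lam_def grad_nth algebra_simps)
qed

end

end

section \<open>Parallel tractor 3-forms in a chart\<close>

text \<open>The frame of tractors belonging to a splitting. These are vectors: the lowered
  \<open>Y\<close> takes the value 1 on \<open>tX\<close> and the lowered \<open>X\<close> takes the
  value 1 on \<open>tY\<close>, so inserting \<open>tX\<close> first extracts the projecting
  part.\<close>

definition tX :: tractor where "tX = (0, 0, 1)"
definition tY :: tractor where "tY = (1, 0, 0)"
definition tZ :: "5 \<Rightarrow> tractor" where "tZ a = (0, axis a 1, 0)"

lemma sum_tZ: "(\<Sum>d\<in>UNIV. f d *\<^sub>R tZ d) = (0, (\<chi> d. f d), 0)"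
proof -
  have "(\<Sum>d\<in>UNIV. f d *\<^sub>R axis d (1::real)) = (\<chi> d. f d)"
    using basis_expansion[of "\<chi> d. f d"] by (simp add: scalar_mult_eq_scaleR)
  then show ?thesis by (simp add: tZ_def prod_eq_iff fst_sum snd_sum)
qed

lemma tractor_decomp: "(s, m, r) = s *\<^sub>R tY + (\<Sum>d\<in>UNIV. m $ d *\<^sub>R tZ d) + r *\<^sub>R tX"
  unfolding sum_tZ by (simp add: tX_def tY_def)

lemma alternating3_linear:
  assumes "alternating3 F"
  shows "linear (\<lambda>x. F x u v)" "linear (\<lambda>x. F u x v)" "linear (\<lambda>x. F u v x)"
  using assms unfolding alternating3_def by blast+

lemma alternating3_zero [simp]:
  assumes "alternating3 F"
  shows "F u u v = 0" "F u v u = 0" "F v u u = 0" "F 0 u v = 0" "F u 0 v = 0" "F u v 0 = 0"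
proof -
  show "F u u v = 0" "F u v u = 0" "F v u u = 0" using assms unfolding alternating3_def by blast+
qed (rule alternating3_linear[OF assms, THEN linear_0])+

lemma alternating3_multilinear:
  assumes "alternating3 F"
  shows "F (x + y) u v = F x u v + F y u v" "F u (x + y) v = F u x v + F u y v"
    "F u v (x + y) = F u v x + F u v y"
    "F (x - y) u v = F x u v - F y u v" "F u (x - y) v = F u x v - F u y v"
    "F u v (x - y) = F u v x - F u v y"
    "F (k *\<^sub>R x) u v = k * F x u v" "F u (k *\<^sub>R x) v = k * F u x v" "F u v (k *\<^sub>R x) = k * F u v x"
    "F (- x) u v = - F x u v" "F u (- x) v = - F u x v" "F u v (- x) = - F u v x"
    "F (sum f I) u v = (\<Sum>i\<in>I. F (f i) u v)" "F u (sum f I) v = (\<Sum>i\<in>I. F u (f i) v)"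
    "F u v (sum f I) = (\<Sum>i\<in>I. F u v (f i))"
  using alternating3_linear[OF assms, THEN linear_add] alternating3_linear[OF assms, THEN linear_diff]
    alternating3_linear[OF assms, THEN linear_cmul] alternating3_linear[OF assms, THEN linear_neg]
    alternating3_linear[OF assms, THEN linear_sum] by simp_all

lemma alternating3_skew:
  assumes "alternating3 F"
  shows "F v u w = - F u v w" "F u w v = - F u v w" "F w v u = - F u v w"
proof -
  have "F (u + v) (u + v) w = 0" "F u (v + w) (v + w) = 0" "F (u + w) v (u + w) = 0"
    using assms by simp_all
  then show "F v u w = - F u v w" "F u w v = - F u v w" "F w v u = - F u v w"
    by (simp_all add: alternating3_multilinear[OF assms] assms)
qed

context metric_chart
begin

text \<open>For a parallel form, the covariant derivatives of the frame vectors express all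
  derivatives of frame components as combinations of frame components.\<close>

lemma nabla_tX: "tr_nabla g \<kappa> (\<lambda>q. tX) c p = tZ c - wc c p *\<^sub>R tX"
  by (auto simp: tX_def tZ_def tr_nabla_def cd_dens_def cd_vec_def wconn_eq[of "- 1"] vec_eq_iff axis_def)

lemma nabla_tY:
  "tr_nabla g \<kappa> (\<lambda>q. tY) c p = wc c p *\<^sub>R tY
     + (\<Sum>a\<in>UNIV. (\<Sum>d\<in>UNIV. cinv g \<kappa> p $ a $ d * schouten g \<kappa> p d c) *\<^sub>R tZ a)"
  unfolding sum_tZ by (simp add: tY_def tr_nabla_def cd_dens_def cd_vec_def vec_eq_iff)

lemma nabla_tZ:
  "tr_nabla g \<kappa> (\<lambda>q. tZ a) c p = (\<Sum>d\<in>UNIV. chr g \<kappa> p d c a *\<^sub>R tZ d) - cmetric g \<kappa> p $ c $ a *\<^sub>R tY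
     - wc c p *\<^sub>R tZ a - schouten g \<kappa> p c a *\<^sub>R tX"
  unfolding sum_tZ
  by (simp add: tX_def tY_def tZ_def tr_nabla_def cd_dens_def cd_vec_def wconn_eq[of "- 1"] vec_eq_iff axis_def
      matrix_vector_mult_def if_distrib cong: if_cong)

end

locale g2_chart = metric_chart \<kappa> W g for \<kappa> :: "'m chart" and W :: "'m set" and g :: "'m metric" +
  fixes F :: "'m \<Rightarrow> form3"
  assumes alt: "p \<in> W \<Longrightarrow> alternating3 (F p)"
    and F_sm: "sm (\<lambda>p. F p u v w)"
    and parallel: "sm S \<Longrightarrow> sm T \<Longrightarrow> sm U \<Longrightarrow> p \<in> W \<Longrightarrow>
      pd \<kappa> (\<lambda>q. F q (S q) (T q) (U q)) b p = F p (tr_nabla g \<kappa> S b p) (T p) (U p)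
        + F p (S p) (tr_nabla g \<kappa> T b p) (U p) + F p (S p) (T p) (tr_nabla g \<kappa> U b p)"
begin

lemma F_sm3:
  assumes "sm (\<lambda>q. fst (S q))" "sm (\<lambda>q. fst (snd (S q)))" "sm (\<lambda>q. snd (snd (S q)))"
  shows "sm (\<lambda>q. F q u v (S q))"
proof (rule sm_cong)
  show "sm (\<lambda>q. fst (S q) * F q u v tY + (\<Sum>d\<in>UNIV. fst (snd (S q)) $ d * F q u v (tZ d))
      + snd (snd (S q)) * F q u v tX)"
    by (intro sm_add sm_mult sm_sum F_sm assms sm_component[OF assms(2)])
  fix q assume "q \<in> W"
  then show "fst (S q) * F q u v tY + (\<Sum>d\<in>UNIV. fst (snd (S q)) $ d * F q u v (tZ d))
      + snd (snd (S q)) * F q u v tX = F q u v (S q)"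
    by (subst tractor_decomp[of "fst (S q)" "fst (snd (S q))" "snd (snd (S q))", simplified])
       (simp add: alternating3_multilinear[OF alt])
qed

context
  fixes p assumes p: "p \<in> W"
begin

lemmas F_lin = alternating3_multilinear[OF alt[OF p]]
lemmas F_zero = alternating3_zero[OF alt[OF p]]
lemmas F_skew = alternating3_skew[OF alt[OF p]]

text \<open>The conformal Killing-Yano equation: apart from connection terms and the weight 3, the
  derivative of \<open>\<phi>\<close> is a totally skew part plus a trace part given by
  \<open>F p tX tY\<close>.\<close>

lemma pd_phi:
  "pd \<kappa> (\<lambda>q. F q tX (tZ a) (tZ b)) c p = F p (tZ c) (tZ a) (tZ b)
     - cmetric g \<kappa> p $ c $ a * F p tX tY (tZ b) + cmetric g \<kappa> p $ c $ b * F p tX tY (tZ a)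
     + (\<Sum>d\<in>UNIV. chr g \<kappa> p d c a * F p tX (tZ d) (tZ b))
     + (\<Sum>d\<in>UNIV. chr g \<kappa> p d c b * F p tX (tZ a) (tZ d)) - 3 * wc c p * F p tX (tZ a) (tZ b)"
proof -
  have "F p tX (tZ a) tY = - F p tX tY (tZ a)" by (rule F_skew)
  then show ?thesis
    by (simp add: parallel[OF sm_const sm_const sm_const p] nabla_tX nabla_tZ F_lin F_zero)
qed

text \<open>Solved for its first term on the right, this recovers the block \<open>\<psi>\<close> of
  the form, up to sign, from \<open>\<phi>\<close>, \<open>\<theta>\<close> and the derivative of
  \<open>\<theta>\<close>.\<close>

lemma pd_theta:
  "pd \<kappa> (\<lambda>q. F q tX tY (tZ b)) c p = F p (tZ c) tY (tZ b)
     + (\<Sum>a\<in>UNIV. (\<Sum>d\<in>UNIV. cinv g \<kappa> p $ a $ d * schouten g \<kappa> p d c) * F p tX (tZ a) (tZ b))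
     + (\<Sum>d\<in>UNIV. chr g \<kappa> p d c b * F p tX tY (tZ d)) - wc c p * F p tX tY (tZ b)"
  by (simp add: parallel[OF sm_const sm_const sm_const p] nabla_tX nabla_tY nabla_tZ F_lin F_zero)

end

end

section \<open>Algebra of compatible \<open>G\<^sub>2\<close>-structures on the tractor space\<close>

lemma bilinear_tr_H: "bilinear (tr_H G)"
  unfolding bilinear_def tr_H_def
  by (auto intro!: linearI simp: inner_add_left inner_add_right matrix_vector_right_distrib
      matrix_vector_mult_scaleR algebra_simps)

lemma compatible_G2_cross_norm:
  assumes "compatible_G2 G F"
  shows "\<exists>n. (\<forall>w. tr_H G n w = F u v w) \<and>
     tr_H G n n = tr_H G u u * tr_H G v v - (tr_H G u v)\<^sup>2"
  using assms G2_cross_product_norm[OF _ bilinear_tr_H] unfolding compatible_G2_def by blast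

text \<open>For either form the cross product of \<open>tX\<close> and \<open>tY\<close> has norm
  -1, since \<open>tX\<close> is null and \<open>H tX tY = 1\<close>. Scaling the form by
  \<open>f\<close> multiplies this norm by \<open>f * f\<close>.\<close>

lemma compatible_G2_scale_unique:
  assumes F: "compatible_G2 G F" and F': "compatible_G2 G F'"
    and eq: "\<And>u v w. F' u v w = f * F u v w" and "f > 0" and sym: "\<And>x y. tr_H G x y = tr_H G y x"
  shows "f = 1"
proof -
  obtain n where n: "\<And>w. tr_H G n w = F tX tY w"
    "tr_H G n n = tr_H G tX tX * tr_H G tY tY - (tr_H G tX tY)\<^sup>2"
    using compatible_G2_cross_norm[OF F] by blast
  obtain n' where n': "\<And>w. tr_H G n' w = F' tX tY w"
    "tr_H G n' n' = tr_H G tX tX * tr_H G tY tY - (tr_H G tX tY)\<^sup>2"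
    using compatible_G2_cross_norm[OF F'] by blast
  have "tr_H G n' n' = f * tr_H G n n'" by (simp add: n'(1) eq n(1))
  also have "\<dots> = f * (f * tr_H G n n)" using sym[of n n'] by (simp add: n'(1) eq n(1))
  finally have "f * f = 1" using n(2) n'(2) by (simp add: tX_def tY_def tr_H_def)
  then show ?thesis using \<open>f > 0\<close> by (metis abs_of_pos real_sqrt_abs2 real_sqrt_one)
qed

lemma tr_H_sym: "transpose G = G \<Longrightarrow> tr_H G x y = tr_H G y x"
  unfolding tr_H_def using inner_transpose_mult[of _ G]
  by (auto split: prod.split simp: inner_commute)

lemma linear_tractor_eq_0:
  assumes "linear (f :: tractor \<Rightarrow> real)" "f tX = 0" "f tY = 0" "\<And>a. f (tZ a) = 0"
  shows "f x = 0"
proof -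
  obtain s m r where "x = (s, m, r)" by (cases x)
  then show ?thesis
    using assms by (simp add: tractor_decomp[of s m r] linear_add linear_cmul linear_sum)
qed

text \<open>The hypotheses concern the blocks \<open>\<phi>\<close>, \<open>\<theta>\<close>,
  \<open>\<chi>\<close> and \<open>\<psi>\<close>. Skew-symmetry gives the remaining values on frame
  vectors, and linearity then frees one slot after the other.\<close>

lemma alternating3_eq_0:
  assumes alt: "alternating3 F" and "\<And>a b. F tX (tZ a) (tZ b) = 0" "\<And>a. F tX tY (tZ a) = 0"
    "\<And>a b c. F (tZ a) (tZ b) (tZ c) = 0" "\<And>a b. F (tZ a) tY (tZ b) = 0"
  shows "F u v w = 0"
proof -
  note l = alternating3_linear[OF alt] and sk = alternating3_skew[OF alt] and z = alternating3_zero[OF alt]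
  have 0: "F tX (tZ a) tY = 0" "F (tZ a) tX (tZ b) = 0" "F (tZ a) tX tY = 0" "F (tZ a) tY tX = 0"
    "F (tZ a) (tZ b) tX = 0" "F (tZ a) (tZ b) tY = 0" "F tY tX (tZ a) = 0" "F tY (tZ a) tX = 0"
    "F tY (tZ a) (tZ b) = 0" for a b
    using assms(2-)[of a] assms(2)[of a b] assms(5)[of a b] sk(2)[of tX tY "tZ a"] sk(1)[of tX "tZ a" "tZ b"]
      sk(1)[of tX "tZ a" tY] sk(3)[of tX tY "tZ a"] sk(3)[of tX "tZ b" "tZ a"] assms(2)[of b a]
      sk(2)[of "tZ a" tY "tZ b"] sk(1)[of tX tY "tZ a"] sk(1)[of "tZ a" tY "tZ b"]
      sk(2)[of tY tX "tZ a"] by simp_all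
  have 1: "F u v w = 0" if "u \<in> insert tX (insert tY (range tZ))" "v \<in> insert tX (insert tY (range tZ))" for u v w
    by (rule linear_tractor_eq_0[OF l(3)]) (use that in \<open>auto simp: 0 z assms(2-)\<close>)
  have 2: "F u v w = 0" if "u \<in> insert tX (insert tY (range tZ))" for u v w
    by (rule linear_tractor_eq_0[OF l(2)]) (use that 1 in auto)
  show ?thesis
    by (rule linear_tractor_eq_0[OF l(1)]) (use 2 in auto)
qed

lemma alternating3_diff_scale:
  assumes "alternating3 F" "alternating3 G"
  shows "alternating3 (\<lambda>u v w. G u v w - k * F u v w)"
  unfolding alternating3_def
  by (intro conjI allI linearI)
     (simp_all only: alternating3_multilinear[OF assms(1)] alternating3_multilinear[OF assms(2)]
       alternating3_zero[OF assms(1)] alternating3_zero[OF assms(2)] real_scaleR_def, simp_all add: algebra_simps)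

lemma symmetric_quadratic_zero:
  fixes M :: "real ^ 'n ^ 'n"
  assumes "transpose M = M" "\<And>x. x \<bullet> (M *v x) = 0" shows "M = 0"
proof -
  have *: "y \<bullet> (M *v x) = 0" for x y
  proof -
    have "x \<bullet> (M *v y) = y \<bullet> (M *v x)"
      using inner_transpose_mult[of x M y] assms(1) by (simp add: inner_commute)
    then show ?thesis
      using assms(2)[of "x + y"] assms(2)[of x] assms(2)[of y]
      by (simp add: matrix_vector_right_distrib inner_add_left inner_add_right)
  qed
  have "M *v x = 0" for x using *[of "M *v x" x] by simp
  then show ?thesis by (simp add: matrix_eq)
qed

text \<open>The cross product of \<open>X\<close> with a vector orthogonal to \<open>X\<close> is null.\<close>

lemma compatible_G2_phi_null:
  fixes G \<phi> :: "real ^ 5 ^ 5"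
  assumes F: "compatible_G2 G F" and alt: "alternating3 F"
    and sym: "transpose G = G" and inv: "invertible G"
    and \<phi>: "\<phi> = (\<chi> a b. F tX (tZ a) (tZ b))"
  shows "\<phi> ** matrix_inv G ** \<phi> = 0"
proof -
  \<comment> \<open>The quadratic form of \<open>?M\<close> at \<open>x\<close> is the norm of the
    cross product of \<open>tX\<close> with \<open>(0, x, 0)\<close>.\<close>
  let ?M = "\<phi> ** matrix_inv G ** transpose \<phi>"
  have "transpose \<phi> = - \<phi>"
    unfolding \<phi> transpose_def vec_eq_iff by (simp, intro allI, rule alternating3_skew(2)[OF alt])
  moreover have "?M = 0"
  proof (rule symmetric_quadratic_zero)
    show "transpose ?M = ?M"
      by (simp add: matrix_transpose_mul transpose_matrix_inv[OF inv sym] matrix_mul_assoc)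
    fix x
    have Fxy: "F tX (0, x, 0) (0, y, 0) = x \<bullet> (\<phi> *v y)" for y
    proof -
      have "F tX (0, x, 0) (0, y, 0) = F tX (\<Sum>d\<in>UNIV. x $ d *\<^sub>R tZ d) (\<Sum>d\<in>UNIV. y $ d *\<^sub>R tZ d)"
        by (simp add: sum_tZ)
      also have "\<dots> = x \<bullet> (\<phi> *v y)"
        by (simp add: alternating3_multilinear[OF alt] \<phi> inner_vec_def matrix_vector_mult_def
            sum_distrib_left mult_ac) (subst sum.swap, rule refl)
      finally show ?thesis .
    qed
    obtain n where n: "\<And>w. tr_H G n w = F tX (0, x, 0) w"
      "tr_H G n n = tr_H G tX tX * tr_H G (0, x, 0) (0, x, 0) - (tr_H G tX (0, x, 0))\<^sup>2"
      using compatible_G2_cross_norm[OF F] by blast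
    obtain s m r where nsmr: "n = (s, m, r)" by (cases n)
    \<comment> \<open>Pairing the cross product with \<open>tX\<close> gives zero, so its norm
      involves only the middle slot.\<close>
    have "s = 0" using n(1)[of tX] alternating3_zero(2)[OF alt] by (simp add: nsmr tX_def tr_H_def)
    then have mm: "m \<bullet> (G *v m) = 0" using n(2) by (simp add: nsmr tX_def tr_H_def)
    have "m \<bullet> (G *v y) = x \<bullet> (\<phi> *v y)" for y
      using n(1)[of "(0, y, 0)"] \<open>s = 0\<close> by (simp add: Fxy nsmr tr_H_def)
    then have "(G *v m - transpose \<phi> *v x) \<bullet> y = 0" for y
      using inner_transpose_mult[of m G y] inner_transpose_mult[of x "transpose \<phi>" y] sym
      by (simp add: inner_diff_left)
    from this[of "G *v m - transpose \<phi> *v x"] have Gm: "G *v m = transpose \<phi> *v x" by simp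
    have "matrix_inv G *v (G *v m) = m"
      by (simp add: matrix_vector_mul_assoc matrix_inv_left[OF inv])
    then have "m = matrix_inv G *v (transpose \<phi> *v x)" by (simp add: Gm)
    then have "\<phi> *v m = ?M *v x" by (simp only: matrix_vector_mul_assoc matrix_mul_assoc)
    moreover have "m \<bullet> (transpose \<phi> *v x) = (\<phi> *v m) \<bullet> x" by (rule inner_transpose_mult)
    ultimately show "x \<bullet> (?M *v x) = 0" using mm Gm by (simp add: inner_commute)
  qed
  moreover have "A ** (- B) = - (A ** B)" for A B :: "real ^ 5 ^ 5"
    by (simp add: vec_eq_iff matrix_matrix_mult_def sum_negf)
  ultimately show ?thesis by simp
qed

section \<open>Uniqueness of the parallel 3-form\<close>

text \<open>
  Differentiating \<open>\<phi>\<^sub>2 \<otimes> \<phi>\<^sub>1 = \<phi>\<^sub>1 \<otimes> \<phi>\<^sub>2\<close> avoids having to differentiate the factor between the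
  projecting parts.
\<close>

lemma parallel_form_determined:
  assumes g1: "g2_chart \<kappa> W g F1" and g2: "g2_chart \<kappa> W g F2"
    and ratio: "\<And>q. q \<in> W \<Longrightarrow> \<exists>f>0. \<forall>a b. F2 q tX (tZ a) (tZ b) = f * F1 q tX (tZ a) (tZ b)"
    and nz: "\<And>q. q \<in> W \<Longrightarrow> \<exists>a b. F1 q tX (tZ a) (tZ b) \<noteq> 0"
    and p: "p \<in> W"
  shows "\<exists>f>0. \<forall>u v w. F2 p u v w = f * F1 p u v w"
proof -
  interpret A: g2_chart \<kappa> W g F1 by fact
  interpret B: g2_chart \<kappa> W g F2 by fact
  define \<phi>1 \<phi>2 where "\<phi>1 a b q = F1 q tX (tZ a) (tZ b)" and "\<phi>2 a b q = F2 q tX (tZ a) (tZ b)" for a b q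
  have sm: "A.sm (\<phi>1 a b)" "A.sm (\<phi>2 a b)" for a b
    unfolding \<phi>1_def[abs_def] \<phi>2_def[abs_def] by (rule A.F_sm B.F_sm)+
  \<comment> \<open>Here \<open>f\<close> is a number belonging to the single point
    \<open>q\<close>: proportionality at \<open>q\<close> passes from \<open>\<phi>\<close> to the
    trace part, the skew part and the first derivatives.\<close>
  have first: "(\<forall>a. F2 q tX tY (tZ a) = f * F1 q tX tY (tZ a)) \<and>
      (\<forall>c a b. F2 q (tZ c) (tZ a) (tZ b) = f * F1 q (tZ c) (tZ a) (tZ b)) \<and>
      (\<forall>a b c. pd \<kappa> (\<phi>2 a b) c q = f * pd \<kappa> (\<phi>1 a b) c q)"
    if q: "q \<in> W" and f: "\<And>a b. \<phi>2 a b q = f * \<phi>1 a b q" for q f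
  proof -
    obtain a0 b0 where ab: "\<phi>1 a0 b0 q \<noteq> 0" using nz[OF q] by (auto simp: \<phi>1_def)
    define \<tau> where "\<tau> c a b = F2 q (tZ c) (tZ a) (tZ b) - f * F1 q (tZ c) (tZ a) (tZ b)" for c a b
    define \<theta> where "\<theta> = (\<chi> b. F2 q tX tY (tZ b) - f * F1 q tX tY (tZ b))"
    define T where "T c a b = \<tau> c a b - cmetric g \<kappa> q $ c $ a * \<theta> $ b + cmetric g \<kappa> q $ c $ b * \<theta> $ a" for c a b
    have pd: "pd \<kappa> (\<phi>2 a b) c q = T c a b + f * pd \<kappa> (\<phi>1 a b) c q" for a b c
    proof -
      have 2: "pd \<kappa> (\<phi>2 a b) c q = F2 q (tZ c) (tZ a) (tZ b)
         - cmetric g \<kappa> q $ c $ a * F2 q tX tY (tZ b) + cmetric g \<kappa> q $ c $ b * F2 q tX tY (tZ a)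
         + (\<Sum>d\<in>UNIV. chr g \<kappa> q d c a * \<phi>2 d b q)
         + (\<Sum>d\<in>UNIV. chr g \<kappa> q d c b * \<phi>2 a d q) - 3 * A.wc c q * \<phi>2 a b q"
        unfolding \<phi>2_def[abs_def] by (rule B.pd_phi[OF q])
      have 1: "pd \<kappa> (\<phi>1 a b) c q = F1 q (tZ c) (tZ a) (tZ b)
         - cmetric g \<kappa> q $ c $ a * F1 q tX tY (tZ b) + cmetric g \<kappa> q $ c $ b * F1 q tX tY (tZ a)
         + (\<Sum>d\<in>UNIV. chr g \<kappa> q d c a * \<phi>1 d b q)
         + (\<Sum>d\<in>UNIV. chr g \<kappa> q d c b * \<phi>1 a d q) - 3 * A.wc c q * \<phi>1 a b q"
        unfolding \<phi>1_def[abs_def] by (rule A.pd_phi[OF q])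
      show ?thesis
        unfolding 1 2 T_def \<tau>_def \<theta>_def f by (simp add: sum_distrib_left algebra_simps)
    qed
    have T: "T c a b * \<phi>1 a0 b0 q = T c a0 b0 * \<phi>1 a b q" for c a b
    proof -
      have "pd \<kappa> (\<lambda>r. \<phi>2 a b r * \<phi>1 a0 b0 r) c q = pd \<kappa> (\<lambda>r. \<phi>2 a0 b0 r * \<phi>1 a b r) c q"
      proof (rule A.pd_cong[OF A.sm_mult[OF sm(2,1)] _ q])
        fix r assume "r \<in> W"
        obtain f' where "\<And>a b. \<phi>2 a b r = f' * \<phi>1 a b r" using ratio[OF \<open>r \<in> W\<close>] by (auto simp: \<phi>1_def \<phi>2_def)
        then show "\<phi>2 a b r * \<phi>1 a0 b0 r = \<phi>2 a0 b0 r * \<phi>1 a b r" by simp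
      qed
      then show ?thesis
        by (simp add: A.pd_mult[OF q] sm pd f algebra_simps)
    qed
    \<comment> \<open>If the factor is regarded as a function, \<open>\<omega>\<close> is its
      differential, read off from the nonzero component \<open>a0 b0\<close>.\<close>
    define \<omega> where "\<omega> = (\<chi> c. T c a0 b0 / \<phi>1 a0 b0 q)"
    have "\<theta> = 0 \<and> \<omega> = 0 \<and> (\<forall>c a b. \<tau> c a b = 0)"
    proof (rule conformal_killing_algebra[where G = "cmetric g \<kappa> q" and \<phi> = "\<lambda>a b. \<phi>1 a b q"])
      show "5 \<le> CARD(5)" by simp
      show "transpose (cmetric g \<kappa> q) = cmetric g \<kappa> q" "invertible (cmetric g \<kappa> q)"
        using q by (rule A.cmetric_sym A.cmetric_inv)+
      show "\<tau> c a b = - \<tau> a c b" "\<tau> c a b = - \<tau> c b a" for c a b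
        unfolding \<tau>_def using A.F_skew(1,2)[OF q, of "tZ c" "tZ a" "tZ b"] B.F_skew(1,2)[OF q, of "tZ c" "tZ a" "tZ b"]
        by simp_all
      show "\<phi>1 a b q = - \<phi>1 b a q" for a b
        unfolding \<phi>1_def using A.F_skew(2)[OF q, of tX "tZ a" "tZ b"] by simp
      show "\<tau> c a b - cmetric g \<kappa> q $ c $ a * \<theta> $ b + cmetric g \<kappa> q $ c $ b * \<theta> $ a = \<omega> $ c * \<phi>1 a b q" for c a b
        using T[of c a b] ab by (simp add: \<omega>_def T_def field_simps)
    qed (rule ab)
    then show ?thesis
      using pd by (simp add: T_def) (simp add: \<theta>_def \<tau>_def vec_eq_iff)
  qed
  obtain f where f: "f > 0" "\<And>a b. \<phi>2 a b p = f * \<phi>1 a b p" using ratio[OF p] by (auto simp: \<phi>1_def \<phi>2_def)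
  obtain a0 b0 where ab: "\<phi>1 a0 b0 p \<noteq> 0" using nz[OF p] by (auto simp: \<phi>1_def)
  \<comment> \<open>The same device one level up: the products of the trace parts with the
    \<open>\<phi>\<close> of the other form agree near \<open>p\<close>. With
    \<open>pd_theta\<close> this gives the last block.\<close>
  have pd\<theta>: "pd \<kappa> (\<lambda>q. F2 q tX tY (tZ b)) c p = f * pd \<kappa> (\<lambda>q. F1 q tX tY (tZ b)) c p" for b c
  proof -
    have "pd \<kappa> (\<lambda>r. F2 r tX tY (tZ b) * \<phi>1 a0 b0 r) c p = pd \<kappa> (\<lambda>r. F1 r tX tY (tZ b) * \<phi>2 a0 b0 r) c p"
    proof (rule A.pd_cong[OF A.sm_mult[OF B.F_sm sm(1)] _ p])
      fix r assume r: "r \<in> W"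
      obtain f' where "\<And>a b. \<phi>2 a b r = f' * \<phi>1 a b r" using ratio[OF r] by (auto simp: \<phi>1_def \<phi>2_def)
      then show "F2 r tX tY (tZ b) * \<phi>1 a0 b0 r = F1 r tX tY (tZ b) * \<phi>2 a0 b0 r"
        using first[OF r, of f'] by simp
    qed
    then have "(pd \<kappa> (\<lambda>q. F2 q tX tY (tZ b)) c p - f * pd \<kappa> (\<lambda>q. F1 q tX tY (tZ b)) c p) * \<phi>1 a0 b0 p = 0"
      using first[OF p f(2)] by (simp add: A.pd_mult[OF p] sm A.F_sm B.F_sm f(2) algebra_simps)
    then show ?thesis using ab by simp
  qed
  have \<psi>: "F2 p (tZ c) tY (tZ b) = f * F1 p (tZ c) tY (tZ b)" for c b
    using pd\<theta>[of b c] first[OF p f(2)] f(2)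
    unfolding A.pd_theta[OF p] B.pd_theta[OF p] \<phi>1_def \<phi>2_def
    by (simp add: sum_distrib_left algebra_simps)
  have "F2 p u v w - f * F1 p u v w = 0" for u v w
  proof (rule alternating3_eq_0[where F = "\<lambda>u v w. F2 p u v w - f * F1 p u v w"])
    show "alternating3 (\<lambda>u v w. F2 p u v w - f * F1 p u v w)"
      by (rule alternating3_diff_scale[OF A.alt[OF p] B.alt[OF p]])
  qed (use f(2) \<psi> first[OF p f(2)] in \<open>auto simp: \<phi>1_def \<phi>2_def\<close>)
  then show ?thesis using f(1) by auto
qed

section \<open>A parallel 3-form paired with the scale tractor\<close>

locale g2_scale_chart = scale_chart \<kappa> W g \<sigma> + g2_chart \<kappa> W g F
  for \<kappa> :: "'m chart" and W :: "'m set" and g :: "'m metric" and \<sigma> :: "'m density" and F :: "'m \<Rightarrow> form3"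
begin

abbreviation S :: "'m \<Rightarrow> tractor" where "S q \<equiv> scale_tractor g \<kappa> \<sigma> q"

lemma FS_sm: "sm (\<lambda>q. F q u v (S q))"
  by (rule F_sm3) (simp_all add: scale_tractor_eq \<sigma>_sm mu_sm rho_sm)

lemma nabla_S: "p \<in> W \<Longrightarrow> tr_nabla g \<kappa> S c p = lam c p *\<^sub>R tX"
  using nabla_scale_tractor by (simp add: tX_def)

text \<open>The curl of this 1-form determines the third slot of \<open>S\<close> without reference to the Schouten tensor.\<close>

definition eta :: "5 \<Rightarrow> 'm \<Rightarrow> real" where "eta a q = vol q * F q tX (tZ a) (S q)"

lemma eta_sm: "sm (eta a)"
  unfolding eta_def[abs_def] by (intro sm_mult vol_sm FS_sm)

context
  fixes p assumes p: "p \<in> W"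
begin

lemma pd_eta:
  "pd \<kappa> (eta a) c p = vol p * (F p (tZ c) (tZ a) (S p) - cmetric g \<kappa> p $ c $ a * F p tX tY (S p)
     + (\<Sum>d\<in>UNIV. chr g \<kappa> p d c a * F p tX (tZ d) (S p)))"
proof -
  have *: "pd \<kappa> (\<lambda>q. F q tX (tZ a) (S q)) c p = F p (tZ c) (tZ a) (S p)
     - cmetric g \<kappa> p $ c $ a * F p tX tY (S p)
     + (\<Sum>d\<in>UNIV. chr g \<kappa> p d c a * F p tX (tZ d) (S p)) - 2 * wc c p * F p tX (tZ a) (S p)"
    by (simp add: parallel[OF sm_const sm_const scale_tractor_sm p] nabla_tX nabla_tZ nabla_S[OF p] F_lin[OF p] F_zero[OF p])
  show ?thesis
    unfolding eta_def[abs_def] by (simp add: pd_mult[OF p] vol_sm FS_sm pd_vol[OF p] * algebra_simps)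
qed

text \<open>The Christoffel and metric terms of \<open>pd_eta\<close> are symmetric in
  \<open>a\<close> and \<open>c\<close> and drop out.\<close>

lemma curl_eta: "pd \<kappa> (eta a) c p - pd \<kappa> (eta c) a p = 2 * vol p * F p (tZ c) (tZ a) (S p)"
proof -
  have "F p (tZ a) (tZ c) (S p) = - F p (tZ c) (tZ a) (S p)" by (rule F_skew(1)[OF p])
  moreover have "cmetric g \<kappa> p $ a $ c = cmetric g \<kappa> p $ c $ a" by (rule transpose_eq_nth[OF cmetric_sym[OF p]])
  ultimately show ?thesis
    unfolding pd_eta by (simp add: chr_sym[OF p, of _ c a] right_diff_distrib distrib_left)
qed

text \<open>The terms without \<open>lam\<close> are arranged as an expression minus the same
  expression with \<open>c\<close> and \<open>a\<close> exchanged, ready to cancel in a cyclic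
  sum.\<close>

lemma pd_FZZS:
  "pd \<kappa> (\<lambda>q. vol q * F q (tZ c) (tZ a) (S q)) e p = vol p *
     ((\<Sum>d\<in>UNIV. chr g \<kappa> p d e c * F p (tZ d) (tZ a) (S p)) - cmetric g \<kappa> p $ e $ c * F p tY (tZ a) (S p)
       - schouten g \<kappa> p e c * F p tX (tZ a) (S p)
     - ((\<Sum>d\<in>UNIV. chr g \<kappa> p d e a * F p (tZ d) (tZ c) (S p)) - cmetric g \<kappa> p $ e $ a * F p tY (tZ c) (S p)
       - schouten g \<kappa> p e a * F p tX (tZ c) (S p))
     + lam e p * F p tX (tZ c) (tZ a))"
proof -
  have sk: "F p (tZ c) x (S p) = - F p x (tZ c) (S p)" for x by (rule F_skew(1)[OF p])
  have "F p (tZ c) (tZ a) tX = F p tX (tZ c) (tZ a)"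
    using F_skew(3)[OF p, of tX "tZ a" "tZ c"] F_skew(2)[OF p, of tX "tZ c" "tZ a"] by simp
  then have *: "pd \<kappa> (\<lambda>q. F q (tZ c) (tZ a) (S q)) e p =
     (\<Sum>d\<in>UNIV. chr g \<kappa> p d e c * F p (tZ d) (tZ a) (S p)) - cmetric g \<kappa> p $ e $ c * F p tY (tZ a) (S p)
       - schouten g \<kappa> p e c * F p tX (tZ a) (S p)
     + ((\<Sum>d\<in>UNIV. chr g \<kappa> p d e a * F p (tZ c) (tZ d) (S p)) - cmetric g \<kappa> p $ e $ a * F p (tZ c) tY (S p)
       - schouten g \<kappa> p e a * F p (tZ c) tX (S p))
     - 2 * wc e p * F p (tZ c) (tZ a) (S p) + lam e p * F p tX (tZ c) (tZ a)"
    by (simp add: parallel[OF sm_const sm_const scale_tractor_sm p] nabla_tZ nabla_S[OF p] F_lin[OF p])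
  have s: "(\<Sum>d\<in>UNIV. chr g \<kappa> p d e a * F p (tZ c) (tZ d) (S p))
      = - (\<Sum>d\<in>UNIV. chr g \<kappa> p d e a * F p (tZ d) (tZ c) (S p))"
    by (simp add: sk[of "tZ _"] sum_negf)
  show ?thesis
    by (simp add: pd_mult[OF p] vol_sm FS_sm pd_vol[OF p] * s sk[of tY] sk[of tX] algebra_simps)
qed

end

text \<open>By \<open>curl_eta\<close> the differentiated 2-form is half the exterior derivative of
  \<open>eta\<close>, hence closed. The terms named \<open>Q\<close> are symmetric in their first
  two indices and vanish from the cyclic sum, leaving \<open>lam\<close> wedge
  \<open>\<phi>\<close>.\<close>

lemma lam_wedge_phi:
  assumes p: "p \<in> W"
  shows "lam e p * F p tX (tZ c) (tZ a) + lam c p * F p tX (tZ a) (tZ e) + lam a p * F p tX (tZ e) (tZ c) = 0"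
proof -
  let ?B = "\<lambda>c a q. vol q * F q (tZ c) (tZ a) (S q)"
  define Q where "Q e c a = (\<Sum>d\<in>UNIV. chr g \<kappa> p d e c * F p (tZ d) (tZ a) (S p))
    - cmetric g \<kappa> p $ e $ c * F p tY (tZ a) (S p) - schouten g \<kappa> p e c * F p tX (tZ a) (S p)" for e c a
  have Q: "Q e c a = Q c e a" for e c a
    unfolding Q_def using schouten_sym[OF p, of e c] transpose_eq_nth[OF cmetric_sym[OF p], of e c]
    by (simp add: chr_sym[OF p, of _ e c])
  have B: "2 * pd \<kappa> (?B c a) e p = pd \<kappa> (pd \<kappa> (eta a) c) e p - pd \<kappa> (pd \<kappa> (eta c) a) e p" for c a e
  proof -
    have "pd \<kappa> (\<lambda>q. pd \<kappa> (eta a) c q - pd \<kappa> (eta c) a q) e p = pd \<kappa> (\<lambda>q. 2 * ?B c a q) e p"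
      by (rule pd_cong[OF sm_diff[OF sm_pd[OF eta_sm] sm_pd[OF eta_sm]] _ p]) (simp add: curl_eta mult.assoc)
    then show ?thesis
      by (simp add: pd_diff[OF p] sm_pd eta_sm pd_mult[OF p sm_const] sm_mult vol_sm FS_sm)
  qed
  have "pd \<kappa> (?B c a) e p + pd \<kappa> (?B a e) c p + pd \<kappa> (?B e c) a p = 0"
    using B[of c a e] B[of a e c] B[of e c a] pd_commute[OF p eta_sm[of a], of c e]
      pd_commute[OF p eta_sm[of c], of a e] pd_commute[OF p eta_sm[of e], of a c] by linarith
  moreover have "pd \<kappa> (?B c a) e p = vol p * (Q e c a - Q e a c + lam e p * F p tX (tZ c) (tZ a))" for c a e
    unfolding Q_def by (rule pd_FZZS[OF p])
  ultimately have "vol p * (lam e p * F p tX (tZ c) (tZ a) + lam c p * F p tX (tZ a) (tZ e)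
      + lam a p * F p tX (tZ e) (tZ c)) = 0"
    using Q[of e c a] Q[of e a c] Q[of a c e] by (simp add: algebra_simps)
  then show ?thesis using vol_pos[OF p] by simp
qed

end

section \<open>The conformal Killing field as a tractor contraction\<close>

context g2_scale_chart
begin

lemma F_tX_Z:
  assumes p: "p \<in> W"
  shows "F p tX (S p) (tZ e) = \<sigma> \<kappa> p * F p tX tY (tZ e) + (\<Sum>d\<in>UNIV. mu p $ d * F p tX (tZ d) (tZ e))"
  unfolding scale_tractor_eq tractor_decomp[of "\<sigma> \<kappa> p"] by (simp add: F_lin[OF p] F_zero[OF p])

text \<open>The conformal metric is parallel, so the divergence of the bivector is the raised trace
  of the Killing-Yano expression \<open>Q\<close>, namely 4 times the trace part. The 1/4 cancels
  it, and the gradient term supplies the part of the contraction that involves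
  \<open>mu\<close>.\<close>

lemma killing_formula_eq:
  assumes \<Phi>: "\<And>q. \<Phi> g \<kappa> q = F q" and p: "p \<in> W"
  shows "killing_formula g \<Phi> \<sigma> \<kappa> p = cinv g \<kappa> p *v (\<chi> e. F p tX (S p) (tZ e))"
proof -
  let ?G = "cmetric g \<kappa>" and ?C = "cinv g \<kappa>"
  define \<phi> where "\<phi> q = proj_part \<Phi> g \<kappa> q" for q
  define U where "U q = proj_bivector \<Phi> g \<kappa> q" for q
  have \<phi>_nth: "\<phi> q $ a $ b = F q tX (tZ a) (tZ b)" for q a b
    by (simp add: \<phi>_def proj_part_def \<Phi> tX_def tZ_def)
  have \<phi>_sm: "sm \<phi>" by (rule sm_matrix) (simp add: \<phi>_nth F_sm)
  have U: "U q = ?C q ** \<phi> q ** ?C q" if "q \<in> W" for q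
    unfolding U_def proj_bivector_def \<phi>_def cinv_sym[OF that] ..
  have U_sm: "sm U"
    by (rule sm_cong[OF sm_matrix_mult[OF sm_matrix_mult[OF cinv_sm \<phi>_sm] cinv_sm]]) (simp add: U)
  have \<phi>U: "\<phi> q = ?G q ** U q ** ?G q" if "q \<in> W" for q
  proof -
    have "?G q ** U q ** ?G q = (?G q ** ?C q) ** \<phi> q ** (?C q ** ?G q)"
      unfolding U[OF that] by (simp only: matrix_mul_assoc)
    then show ?thesis by (simp add: cmetric_cinv[OF that] cinv_cmetric[OF that])
  qed
  define Q where "Q c = (\<chi> e f. F p (tZ c) (tZ e) (tZ f) - ?G p $ c $ e * F p tX tY (tZ f)
      + ?G p $ c $ f * F p tX tY (tZ e))" for c
  define T where "T c = pd \<kappa> U c p + Gam c p ** U p + U p ** transpose (Gam c p) - wc c p *\<^sub>R U p" for c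
  have T: "cd_biv g \<kappa> (- 1) U a b c p = T c $ a $ b" for a b c
    by (simp add: cd_biv_def T_def pd_nth2[OF p U_sm] wconn_eq[of "- 1"] matrix_matrix_mult_def
        transpose_def Gam_def mult.commute)
  have Q: "pd \<kappa> \<phi> c p = Q c + transpose (Gam c p) ** \<phi> p + \<phi> p ** Gam c p - (3 * wc c p) *\<^sub>R \<phi> p" for c
  proof -
    have "pd \<kappa> \<phi> c p $ e $ f = Q c $ e $ f + (\<Sum>d\<in>UNIV. chr g \<kappa> p d c e * \<phi> p $ d $ f)
       + (\<Sum>d\<in>UNIV. chr g \<kappa> p d c f * \<phi> p $ e $ d) - 3 * wc c p * \<phi> p $ e $ f" for e f
      unfolding pd_nth2[OF p \<phi>_sm, symmetric] unfolding \<phi>_nth by (simp add: pd_phi[OF p] Q_def)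
    then show ?thesis
      by (simp add: vec_eq_iff matrix_matrix_mult_def transpose_def Gam_def mult.commute)
  qed
  \<comment> \<open>Differentiating the lowered relation \<open>\<phi>U\<close> uses the derivative
    of the conformal metric and avoids that of its inverse.\<close>
  have GTG: "?G p ** T c ** ?G p = Q c" for c
  proof -
    have "pd \<kappa> \<phi> c p = pd \<kappa> (\<lambda>q. ?G q ** U q ** ?G q) c p"
      by (rule pd_cong[OF \<phi>_sm \<phi>U p])
    also have "\<dots> = ?G p ** U p ** pd \<kappa> ?G c p + (?G p ** pd \<kappa> U c p + pd \<kappa> ?G c p ** U p) ** ?G p"
      by (simp add: pd_matrix_mult[OF p] sm_matrix_mult cmetric_sm U_sm)
    also have "\<dots> = ?G p ** T c ** ?G p + transpose (Gam c p) ** \<phi> p + \<phi> p ** Gam c p - (3 * wc c p) *\<^sub>R \<phi> p"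
      unfolding pd_cmetric[OF p] T_def \<phi>U[OF p]
      by (simp add: matrix_add_ldistrib matrix_add_rdistrib matrix_diff_ldistrib matrix_diff_rdistrib
          matrix_mul_assoc matrix_scalar_ac scalar_matrix_assoc[symmetric] algebra_simps scaleR_left_distrib[symmetric])
    finally show ?thesis unfolding Q by simp
  qed
  have TC: "T c = ?C p ** Q c ** ?C p" for c
  proof -
    have "?C p ** Q c ** ?C p = (?C p ** ?G p) ** T c ** (?G p ** ?C p)"
      unfolding GTG[symmetric] by (simp only: matrix_mul_assoc)
    then show ?thesis by (simp add: cmetric_cinv[OF p] cinv_cmetric[OF p])
  qed
  have Csym: "?C p $ i $ j = ?C p $ j $ i" for i j by (rule transpose_eq_nth[OF cinv_sym[OF p]])
  have GC: "(\<Sum>f\<in>UNIV. ?G p $ i $ f * ?C p $ f $ j) = (if i = j then 1 else 0)" for i j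
    using cmetric_cinv[OF p] by (simp add: vec_eq_iff matrix_matrix_mult_def mat_def)
  \<comment> \<open>The skew term is traceless, the first metric term contributes -1 and the second
    contributes the dimension 5.\<close>
  have tr: "(\<Sum>b\<in>UNIV. \<Sum>f\<in>UNIV. Q b $ e $ f * ?C p $ f $ b) = 4 * F p tX tY (tZ e)" for e
  proof -
    have "(\<Sum>b\<in>UNIV. \<Sum>f\<in>UNIV. F p (tZ b) (tZ e) (tZ f) * ?C p $ f $ b) = 0" (is "?A = 0")
    proof -
      have "?A = (\<Sum>b\<in>UNIV. \<Sum>f\<in>UNIV. F p (tZ f) (tZ e) (tZ b) * ?C p $ b $ f)" by (rule sum.swap)
      also have "\<dots> = (\<Sum>b\<in>UNIV. \<Sum>f\<in>UNIV. - (F p (tZ b) (tZ e) (tZ f) * ?C p $ f $ b))"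
      proof (intro sum.cong refl)
        fix b f
        show "F p (tZ f) (tZ e) (tZ b) * ?C p $ b $ f = - (F p (tZ b) (tZ e) (tZ f) * ?C p $ f $ b)"
          using F_skew(3)[OF p, of "tZ b" "tZ e" "tZ f"] Csym[of b f] by simp
      qed
      also have "\<dots> = - ?A" by (simp add: sum_negf)
      finally show ?thesis by simp
    qed
    moreover have "(\<Sum>b\<in>UNIV. \<Sum>f\<in>UNIV. ?G p $ b $ e * F p tX tY (tZ f) * ?C p $ f $ b) = F p tX tY (tZ e)"
    proof -
      have "(\<Sum>b\<in>UNIV. \<Sum>f\<in>UNIV. ?G p $ b $ e * F p tX tY (tZ f) * ?C p $ f $ b)
         = (\<Sum>f\<in>UNIV. F p tX tY (tZ f) * (\<Sum>b\<in>UNIV. ?G p $ e $ b * ?C p $ b $ f))"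
        unfolding sum_distrib_left
        by (subst sum.swap, intro sum.cong refl)
           (simp add: Csym[of _ _] transpose_eq_nth[OF cmetric_sym[OF p], of e] mult_ac)
      then show ?thesis by (simp add: GC if_distrib cong: if_cong)
    qed
    moreover have "(\<Sum>b\<in>UNIV. \<Sum>f\<in>UNIV. ?G p $ b $ f * F p tX tY (tZ e) * ?C p $ f $ b) = 5 * F p tX tY (tZ e)"
    proof -
      have "(\<Sum>b\<in>UNIV. \<Sum>f\<in>UNIV. ?G p $ b $ f * F p tX tY (tZ e) * ?C p $ f $ b)
         = (\<Sum>b\<in>(UNIV :: 5 set). F p tX tY (tZ e) * (\<Sum>f\<in>UNIV. ?G p $ b $ f * ?C p $ f $ b))"
        unfolding sum_distrib_left by (intro sum.cong refl) simp
      then show ?thesis by (simp add: GC)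
    qed
    ultimately show ?thesis
      by (simp add: Q_def left_diff_distrib distrib_right sum.distrib sum_subtractf)
  qed
  have div: "(\<Sum>b\<in>UNIV. cd_biv g \<kappa> (- 1) U a b b p) = 4 * (\<Sum>e\<in>UNIV. ?C p $ a $ e * F p tX tY (tZ e))" for a
  proof -
    have "T b $ a $ b = (\<Sum>e\<in>UNIV. ?C p $ a $ e * (\<Sum>f\<in>UNIV. Q b $ e $ f * ?C p $ f $ b))" for b
      unfolding TC matrix_mul_assoc[symmetric] by (simp add: matrix_matrix_mult_def)
    then have "(\<Sum>b\<in>UNIV. cd_biv g \<kappa> (- 1) U a b b p)
        = (\<Sum>e\<in>UNIV. ?C p $ a $ e * (\<Sum>b\<in>UNIV. \<Sum>f\<in>UNIV. Q b $ e $ f * ?C p $ f $ b))"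
      unfolding T by (simp add: sum_distrib_left[of "?C p $ a $ _"]) (rule sum.swap)
    then show ?thesis by (simp add: tr sum_distrib_left mult_ac)
  qed
  have Ug: "(\<Sum>b\<in>UNIV. U p $ a $ b * grad p $ b) = (\<Sum>e\<in>UNIV. ?C p $ a $ e * (\<Sum>f\<in>UNIV. \<phi> p $ e $ f * mu p $ f))" for a
  proof -
    have "U p *v grad p = ?C p *v (\<phi> p *v mu p)"
      by (simp add: U[OF p] mu_def matrix_vector_mul_assoc matrix_mul_assoc)
    then show ?thesis by (simp add: vec_eq_iff matrix_vector_mult_def)
  qed
  have FS: "F p tX (S p) (tZ e) = \<sigma> \<kappa> p * F p tX tY (tZ e) - (\<Sum>f\<in>UNIV. \<phi> p $ e $ f * mu p $ f)" for e
    unfolding F_tX_Z[OF p]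
    by (simp add: \<phi>_nth sum_negf[symmetric] F_skew(2)[OF p, of tX "tZ e"] mult.commute)
  have "killing_formula g \<Phi> \<sigma> \<kappa> p $ a = (?C p *v (\<chi> e. F p tX (S p) (tZ e))) $ a" for a
  proof -
    have "killing_formula g \<Phi> \<sigma> \<kappa> p $ a = - (\<Sum>b\<in>UNIV. U p $ a $ b * grad p $ b)
        + (1 / 4) * (\<Sum>b\<in>UNIV. cd_biv g \<kappa> (- 1) U a b b p) * \<sigma> \<kappa> p"
      by (simp add: killing_formula_def Let_def grad_def U_def[abs_def])
    also have "\<dots> = (\<Sum>e\<in>UNIV. ?C p $ a $ e * (\<sigma> \<kappa> p * F p tX tY (tZ e)))
        - (\<Sum>e\<in>UNIV. ?C p $ a $ e * (\<Sum>f\<in>UNIV. \<phi> p $ e $ f * mu p $ f))"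
      unfolding Ug div by (simp add: sum_distrib_left mult_ac)
    finally show ?thesis
      by (simp add: FS matrix_vector_mult_def right_diff_distrib sum_subtractf)
  qed
  then show ?thesis by (simp add: vec_eq_iff)
qed

end

section \<open>Functions annihilated by a distribution\<close>

lemma chart_open_subset:
  assumes "oriented_atlas A" "\<kappa> \<in> A" "open V" "V \<subseteq> dom \<kappa>"
  shows "chart_open \<kappa> V"
proof
  have h: "homeomorphism (dom \<kappa>) (coord \<kappa> ` dom \<kappa>) (coord \<kappa>) (chart_inv \<kappa>)"
    and o: "open (coord \<kappa> ` dom \<kappa>)"
    using assms(1,2) unfolding oriented_atlas_def by blast+
  have "openin (top_of_set (dom \<kappa>)) V" using assms(3,4) by (intro open_subset)
  then have "openin (top_of_set (coord \<kappa> ` dom \<kappa>)) (coord \<kappa> ` V)"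
    by (rule homeomorphism_imp_open_map[OF h])
  then show "open (coord \<kappa> ` V)" using o openin_open_trans by blast
  fix p assume "p \<in> V"
  then show "chart_inv \<kappa> (coord \<kappa> p) = p" using h assms(4) by (auto simp: homeomorphism_def)
qed

lemma chart_open_dom: "oriented_atlas A \<Longrightarrow> \<kappa> \<in> A \<Longrightarrow> chart_open \<kappa> (dom \<kappa>)"
  by (rule chart_open_subset) (auto simp: oriented_atlas_def)

definition annihilates :: "'m chart \<Rightarrow> ('m \<Rightarrow> real) \<Rightarrow> ('m \<Rightarrow> (real ^ 5) set) \<Rightarrow> bool" where
  "annihilates \<kappa> f F \<longleftrightarrow> (\<forall>q\<in>dom \<kappa>. \<forall>x\<in>F q. (\<Sum>c\<in>UNIV. x $ c * pd \<kappa> f c q) = 0)"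

text \<open>The bracket acts on \<open>f\<close> as the commutator of two derivations, each of which
  sends \<open>f\<close> to zero near the point.\<close>

lemma annihilates_bracket_dist:
  fixes \<kappa> :: "'m::topological_space chart"
  assumes at: "oriented_atlas A" "\<kappa> \<in> A" and f: "chart_smooth \<kappa> (dom \<kappa>) f"
    and F: "annihilates \<kappa> f F" and K: "annihilates \<kappa> f K"
  shows "annihilates \<kappa> f (bracket_dist \<kappa> F K)"
  unfolding annihilates_def
proof (intro ballI)
  fix p x assume p: "p \<in> dom \<kappa>" and x: "x \<in> bracket_dist \<kappa> F K p"
  let ?L = "\<lambda>x q. \<Sum>c\<in>UNIV. x $ c * pd \<kappa> f c q"
  have lin: "linear (\<lambda>x. ?L x p)"
    by (rule linearI) (simp_all add: sum.distrib distrib_right sum_distrib_left mult.assoc)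
  have br: "?L (lie_bracket \<kappa> X Y p) p = 0" if X: "local_section \<kappa> F p X" and Y: "local_section \<kappa> K p Y" for X Y
  proof -
    obtain V1 where V1: "open V1" "p \<in> V1" "V1 \<subseteq> dom \<kappa>" "chart_smooth \<kappa> V1 X" "\<And>q. q \<in> V1 \<Longrightarrow> X q \<in> F q"
      using X by (auto simp: local_section_def)
    obtain V2 where V2: "open V2" "p \<in> V2" "V2 \<subseteq> dom \<kappa>" "chart_smooth \<kappa> V2 Y" "\<And>q. q \<in> V2 \<Longrightarrow> Y q \<in> K q"
      using Y by (auto simp: local_section_def)
    define V where "V = V1 \<inter> V2"
    have V: "open V" "V \<subseteq> dom \<kappa>" "p \<in> V" using V1 V2 by (auto simp: V_def)
    interpret chart_open \<kappa> V by (rule chart_open_subset[OF at V(1,2)])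
    have sX: "sm X" and sY: "sm Y" and sf: "sm f"
      using chart_smooth_subset[OF V1(4)] chart_smooth_subset[OF V2(4)] chart_smooth_subset[OF f V(2)]
      by (auto simp: V_def)
    have comm: "pd \<kappa> (pd \<kappa> f c) d p = pd \<kappa> (pd \<kappa> f d) c p" for c d by (rule pd_commute[OF V(3) sf])
    \<comment> \<open>Differentiating \<open>Z f = 0\<close> trades first derivatives of
      \<open>Z\<close> for second derivatives of \<open>f\<close>, which commute.\<close>
    have D: "(\<Sum>c\<in>UNIV. pd \<kappa> Z d p $ c * pd \<kappa> f c p) = - (\<Sum>c\<in>UNIV. Z p $ c * pd \<kappa> (pd \<kappa> f c) d p)"
      if sZ: "sm Z" and Z: "\<And>q. q \<in> V \<Longrightarrow> ?L (Z q) q = 0" for Z d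
    proof -
      have "pd \<kappa> (\<lambda>q. 0) d p = pd \<kappa> (\<lambda>q. ?L (Z q) q) d p"
        by (rule pd_cong[OF sm_const _ V(3)]) (simp add: Z)
      then have "0 = (\<Sum>c\<in>UNIV. Z p $ c * pd \<kappa> (pd \<kappa> f c) d p + pd \<kappa> Z d p $ c * pd \<kappa> f c p)"
        by (simp add: pd_sum[OF V(3)] sm_mult sm_component[OF sZ] sm_pd[OF sf] pd_mult[OF V(3)]
            pd_component[OF V(3) sZ])
      then show ?thesis by (simp add: sum.distrib)
    qed
    have dX: "(\<Sum>c\<in>UNIV. pd \<kappa> X d p $ c * pd \<kappa> f c p) = - (\<Sum>c\<in>UNIV. X p $ c * pd \<kappa> (pd \<kappa> f c) d p)" for d
      by (rule D[OF sX]) (use F V1(3,5) in \<open>auto simp: annihilates_def V_def\<close>)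
    have dY: "(\<Sum>c\<in>UNIV. pd \<kappa> Y d p $ c * pd \<kappa> f c p) = - (\<Sum>c\<in>UNIV. Y p $ c * pd \<kappa> (pd \<kappa> f c) d p)" for d
      by (rule D[OF sY]) (use K V2(3,5) in \<open>auto simp: annihilates_def V_def\<close>)
    have "?L (lie_bracket \<kappa> X Y p) p
        = (\<Sum>d\<in>UNIV. X p $ d * ?L (pd \<kappa> Y d p) p) - (\<Sum>d\<in>UNIV. Y p $ d * ?L (pd \<kappa> X d p) p)"
      unfolding lie_bracket_def dird_eq_sum[OF V(3) sX] dird_eq_sum[OF V(3) sY]
      by (simp only: linear_diff[OF lin] linear_sum[OF lin] linear_cmul[OF lin] real_scaleR_def)
    also have "\<dots> = (\<Sum>d\<in>UNIV. \<Sum>c\<in>UNIV. Y p $ d * (X p $ c * pd \<kappa> (pd \<kappa> f c) d p))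
        - (\<Sum>d\<in>UNIV. \<Sum>c\<in>UNIV. X p $ d * (Y p $ c * pd \<kappa> (pd \<kappa> f c) d p))"
      unfolding dX dY by (simp add: sum_distrib_left sum_negf)
    also have "(\<Sum>d\<in>UNIV. \<Sum>c\<in>UNIV. Y p $ d * (X p $ c * pd \<kappa> (pd \<kappa> f c) d p))
        = (\<Sum>d\<in>UNIV. \<Sum>c\<in>UNIV. X p $ d * (Y p $ c * pd \<kappa> (pd \<kappa> f c) d p))"
      by (subst sum.swap) (simp add: comm[of _ _] mult.left_commute)
    finally show ?thesis by simp
  qed
  have sec: "?L (X p) p = 0" if "local_section \<kappa> G p X" "annihilates \<kappa> f G" for G X
    using that p by (auto simp: local_section_def annihilates_def)
  have "subspace {x. ?L x p = 0}" 
    by (rule subspaceI) (simp_all add: distrib_right sum.distrib mult.assoc sum_distrib_left[symmetric])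
  then have "bracket_dist \<kappa> F K p \<subseteq> {x. ?L x p = 0}"
    unfolding bracket_dist_def by (intro span_minimal) (use sec F K br in auto)
  then show "?L x p = 0" using x by auto
qed

text \<open>Two brackets starting from a (2,3,5) distribution reach the whole tangent space.\<close>

lemma annihilates_235_imp_pd_0:
  fixes \<kappa> :: "'m::topological_space chart"
  assumes at: "oriented_atlas A" "\<kappa> \<in> A" and f: "chart_smooth \<kappa> (dom \<kappa>) f"
    and D: "oriented_235 A D" and ann: "annihilates \<kappa> f (\<lambda>q. plane_of (D \<kappa> q))" and p: "p \<in> dom \<kappa>"
  shows "pd \<kappa> f b p = 0"
proof -
  let ?F = "\<lambda>q. plane_of (D \<kappa> q)"
  have "annihilates \<kappa> f (bracket_dist \<kappa> ?F (bracket_dist \<kappa> ?F ?F))"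
    by (intro annihilates_bracket_dist[OF at f] ann)
  moreover have "bracket_dist \<kappa> ?F (bracket_dist \<kappa> ?F ?F) p = UNIV"
    using D at(2) p by (auto simp: oriented_235_def Let_def)
  ultimately have "(\<Sum>c\<in>UNIV. axis b 1 $ c * pd \<kappa> f c p) = 0"
    using p unfolding annihilates_def by blast
  moreover have "axis b 1 $ c * y = (if c = b then y else 0)" for c and y :: real
    by (simp add: axis_def)
  ultimately show ?thesis by simp
qed

lemma pd_0_imp_locally_constant:
  fixes \<kappa> :: "'m::topological_space chart"
  assumes at: "oriented_atlas A" "\<kappa> \<in> A" and f: "chart_smooth \<kappa> (dom \<kappa>) (f :: 'm \<Rightarrow> real)"
    and z: "\<And>q b. q \<in> dom \<kappa> \<Longrightarrow> pd \<kappa> f b q = 0" and p: "p \<in> dom \<kappa>"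
  shows "\<exists>T. open T \<and> p \<in> T \<and> (\<forall>q\<in>T. q \<in> dom \<kappa> \<and> f q = f p)"
proof -
  interpret chart_open \<kappa> "dom \<kappa>" by (rule chart_open_dom[OF at])
  have h: "homeomorphism (dom \<kappa>) (coord \<kappa> ` dom \<kappa>) (coord \<kappa>) (chart_inv \<kappa>)" and od: "open (dom \<kappa>)"
    using at unfolding oriented_atlas_def by blast+
  obtain e where e: "e > 0" "ball (coord \<kappa> p) e \<subseteq> coord \<kappa> ` dom \<kappa>"
    using open_image p openE by blast
  define T where "T = dom \<kappa> \<inter> coord \<kappa> -` ball (coord \<kappa> p) e"
  have "open T" unfolding T_def
    by (rule continuous_open_preimage[OF _ od open_ball]) (rule homeomorphism_cont1[OF h])
  moreover have "f q = f p" if "q \<in> T" for q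
  proof -
    have "((\<lambda>x. f (chart_inv \<kappa> x)) has_derivative (\<lambda>v. 0)) (at x within ball (coord \<kappa> p) e)"
      if x: "x \<in> ball (coord \<kappa> p) e" for x
    proof -
      obtain r where r: "r \<in> dom \<kappa>" "x = coord \<kappa> r" using e(2) x by blast
      have "dird \<kappa> f v r = 0" for v
        unfolding dird_eq_sum[OF r(1) f] z[OF r(1)] by simp
      then have "frechet_derivative (\<lambda>x. f (chart_inv \<kappa> x)) (at (coord \<kappa> r)) = (\<lambda>v. 0)"
        by (simp add: dird_def comp_def fun_eq_iff)
      with sm_has_derivative[OF f r(1)]
      have "((\<lambda>x. f (chart_inv \<kappa> x)) has_derivative (\<lambda>v. 0)) (at (coord \<kappa> r))" by simp
      then show ?thesis unfolding r(2) by (rule has_derivative_at_withinI)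
    qed
    then have "\<exists>c. \<forall>x\<in>ball (coord \<kappa> p) e. f (chart_inv \<kappa> x) = c"
      by (rule has_derivative_zero_constant[OF convex_ball])
    then obtain k where k: "\<And>x. x \<in> ball (coord \<kappa> p) e \<Longrightarrow> f (chart_inv \<kappa> x) = k" by blast
    show ?thesis
      using k[of "coord \<kappa> q"] k[of "coord \<kappa> p"] that p e(1) by (simp add: T_def inv_coord)
  qed
  moreover have "p \<in> T" "T \<subseteq> dom \<kappa>" using p e(1) by (auto simp: T_def)
  ultimately show ?thesis by blast
qed

section \<open>The scale tractor under changes of chart and metric\<close>

context scale_chart
begin

lemma sqrt_vol_sm: "sm (\<lambda>q. vol q powr (1 / 2))"
  by (rule sm_powr[OF vol_sm vol_pos])

text \<open>The square root of \<open>vol\<close> is parallel of weight -1, so its product with the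
  scale is a function whose ordinary differential is the weighted gradient. Changes of chart or
  metric then need no transformation law for the Christoffel symbols.\<close>

lemma pd_weighted_scale:
  assumes p: "p \<in> W"
  shows "pd \<kappa> (\<lambda>q. vol q powr (1 / 2) * \<sigma> \<kappa> q) b p = vol p powr (1 / 2) * grad p $ b"
proof -
  have "pd \<kappa> (\<lambda>q. vol q powr (1 / 2)) b p = vol p powr (1 / 2) * wc b p"
    unfolding pd_powr[of p vol, OF p vol_sm vol_pos[OF p]] pd_vol[OF p]
    using vol_pos[OF p] by simp
  then show ?thesis
    unfolding pd_mult[OF p sqrt_vol_sm \<sigma>_sm] grad_nth by (simp add: distrib_left)
qed

lemma weighted_scale_sm: "sm (\<lambda>q. vol q powr (1 / 2) * \<sigma> \<kappa> q)"
  by (rule sm_mult[OF sqrt_vol_sm \<sigma>_sm])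

lemma mu_unique:
  assumes "p \<in> W" "cmetric g \<kappa> p *v m = grad p" shows "m = mu p"
  unfolding mu_def assms(2)[symmetric] by (simp add: matrix_vector_mul_assoc cinv_cmetric[OF assms(1)])

end

locale ae_structure =
  fixes A :: "'m::topological_space chart set" and c :: "'m metric set" and \<sigma> :: "'m density"
  assumes atlas: "oriented_atlas A" and conf: "conformal_structure A c" and scale: "almost_einstein A c \<sigma>"
begin

lemma scale_chart:
  assumes g: "g \<in> c" and k: "\<kappa> \<in> A" shows "scale_chart \<kappa> (dom \<kappa>) g \<sigma>"
proof -
  interpret chart_open \<kappa> "dom \<kappa>" by (rule chart_open_dom[OF atlas k])
  have m: "metric23 A g" using conf g by (auto simp: conformal_structure_def)
  show ?thesis
  proof
    show "sm (g \<kappa>)" using m k unfolding metric23_def by blast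
    show "transpose (g \<kappa> p) = g \<kappa> p" "invertible (g \<kappa> p)" if "p \<in> dom \<kappa>" for p
    proof -
      have *: "has_signature 2 3 (g \<kappa> p)" using m k that unfolding metric23_def by blast
      then show "transpose (g \<kappa> p) = g \<kappa> p" by (simp add: has_signature_def)
      show "invertible (g \<kappa> p)" by (rule has_signature_invertible[OF *])
    qed
    show "sm (\<sigma> \<kappa>)" using scale k by (simp add: almost_einstein_def density_def)
    show "ae_tensor g \<kappa> \<sigma> p a b - 1 / 5 * ae_trace g \<kappa> \<sigma> p * cmetric g \<kappa> p $ a $ b = 0"
      if "p \<in> dom \<kappa>" for p a b
      using scale g k that unfolding almost_einstein_def by blast
  qed
qed

lemma g2_scale_chart:
  assumes \<Phi>: "parallel_compatible_G2 A c \<Phi>" and g: "g \<in> c" and k: "\<kappa> \<in> A"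
  shows "g2_scale_chart \<kappa> (dom \<kappa>) g \<sigma> (\<Phi> g \<kappa>)"
proof -
  interpret scale_chart \<kappa> "dom \<kappa>" g \<sigma> by (rule scale_chart[OF g k])
  have t: "tractor_3form A c \<Phi>" and p: "parallel3 A c \<Phi>"
    using \<Phi> by (auto simp: parallel_compatible_G2_def)
  show ?thesis
  proof
    show "alternating3 (\<Phi> g \<kappa> p)" if "p \<in> dom \<kappa>" for p
      using t g k that by (simp add: tractor_3form_def)
    show "sm (\<lambda>p. \<Phi> g \<kappa> p u v w)" for u v w
      using t[unfolded tractor_3form_def, THEN conjunct1] g k by blast
    show "pd \<kappa> (\<lambda>q. \<Phi> g \<kappa> q (S q) (T q) (U q)) b p = \<Phi> g \<kappa> p (tr_nabla g \<kappa> S b p) (T p) (U p)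
        + \<Phi> g \<kappa> p (S p) (tr_nabla g \<kappa> T b p) (U p) + \<Phi> g \<kappa> p (S p) (T p) (tr_nabla g \<kappa> U b p)"
      if "sm S" "sm T" "sm U" "p \<in> dom \<kappa>" for S T U p b
      using p g k that unfolding parallel3_def by blast
  qed
qed

lemma parallel_form_chart:
  assumes "parallel_compatible_G2 A c \<Phi>" "g \<in> c" "\<kappa> \<in> A" "\<kappa>' \<in> A" "p \<in> dom \<kappa>" "p \<in> dom \<kappa>'"
  shows "\<Phi> g \<kappa>' p (tr_chart \<kappa> \<kappa>' p u) (tr_chart \<kappa> \<kappa>' p v) (tr_chart \<kappa> \<kappa>' p w) = \<Phi> g \<kappa> p u v w"
  using assms unfolding parallel_compatible_G2_def tractor_3form_def by blast

lemma parallel_form_split: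
  assumes "parallel_compatible_G2 A c \<Phi>" "g \<in> c" "h \<in> c" "rescaled A \<Omega> g h" "\<kappa> \<in> A" "p \<in> dom \<kappa>"
  shows "\<Phi> h \<kappa> p (tr_split \<Omega> g \<kappa> p u) (tr_split \<Omega> g \<kappa> p v) (tr_split \<Omega> g \<kappa> p w) = \<Phi> g \<kappa> p u v w"
  using assms unfolding parallel_compatible_G2_def tractor_3form_def by blast

section \<open>Change of chart\<close>

lemma jac_det_pos:
  assumes "\<kappa> \<in> A" "\<kappa>' \<in> A" "p \<in> dom \<kappa>" "p \<in> dom \<kappa>'" shows "det (jac \<kappa> \<kappa>' p) > 0"
  using atlas assms unfolding oriented_atlas_def by blast

lemma metric_change_chart:
  assumes "g \<in> c" "\<kappa> \<in> A" "\<kappa>' \<in> A" "p \<in> dom \<kappa>" "p \<in> dom \<kappa>'"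
  shows "g \<kappa> p = transpose (jac \<kappa> \<kappa>' p) ** g \<kappa>' p ** jac \<kappa> \<kappa>' p"
proof -
  have "metric23 A g" using conf assms(1) by (auto simp: conformal_structure_def)
  then show ?thesis using assms unfolding metric23_def by blast
qed

lemma vol_change_chart:
  assumes g: "g \<in> c" and k: "\<kappa> \<in> A" "\<kappa>' \<in> A" "p \<in> dom \<kappa>" "p \<in> dom \<kappa>'"
  shows "\<bar>det (g \<kappa> p)\<bar> powr (1 / 5) = det (jac \<kappa> \<kappa>' p) powr (2 / 5) * \<bar>det (g \<kappa>' p)\<bar> powr (1 / 5)"
proof -
  let ?d = "det (jac \<kappa> \<kappa>' p)"
  have d: "?d > 0" by (rule jac_det_pos[OF k])
  have "\<bar>det (g \<kappa> p)\<bar> = ?d * ?d * \<bar>det (g \<kappa>' p)\<bar>"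
    unfolding metric_change_chart[OF assms] using d by (simp add: det_mul abs_mult)
  then have "\<bar>det (g \<kappa> p)\<bar> powr (1 / 5) = ?d powr (1 / 5) * ?d powr (1 / 5) * \<bar>det (g \<kappa>' p)\<bar> powr (1 / 5)"
    by (simp add: powr_mult)
  then show ?thesis using powr_add[of ?d "1 / 5" "1 / 5"] by simp
qed

lemma cmetric_change_chart:
  assumes "g \<in> c" "\<kappa> \<in> A" "\<kappa>' \<in> A" "p \<in> dom \<kappa>" "p \<in> dom \<kappa>'"
  shows "cmetric g \<kappa> p = det (jac \<kappa> \<kappa>' p) powr (- 2 / 5) *\<^sub>R
     (transpose (jac \<kappa> \<kappa>' p) ** cmetric g \<kappa>' p ** jac \<kappa> \<kappa>' p)"
proof -
  let ?d = "det (jac \<kappa> \<kappa>' p)"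
  have "\<bar>det (g \<kappa> p)\<bar> powr (- 1 / 5) = ?d powr (- 2 / 5) * \<bar>det (g \<kappa>' p)\<bar> powr (- 1 / 5)"
    using vol_change_chart[OF assms] by (simp add: powr_minus[of _ "1 / 5", simplified] powr_minus[of _ "2 / 5", simplified])
  then show ?thesis
    unfolding cmetric_def by (subst metric_change_chart[OF assms])
      (simp add: matrix_scalar_ac scalar_matrix_assoc[symmetric])
qed

text \<open>The gradient slot follows from the chain rule for the function of
  \<open>pd_weighted_scale\<close>. The third slot contains the Schouten tensor; its possible
  discrepancy is left open as \<open>\<delta>\<close>.\<close>

lemma scale_tractor_change_chart_upto_tX:
  assumes g: "g \<in> c" and k: "\<kappa> \<in> A" "\<kappa>' \<in> A" "p \<in> dom \<kappa>" "p \<in> dom \<kappa>'"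
  shows "\<exists>\<delta>. tr_chart \<kappa> \<kappa>' p (scale_tractor g \<kappa> \<sigma> p) = scale_tractor g \<kappa>' \<sigma> p + \<delta> *\<^sub>R tX"
proof -
  interpret K: scale_chart \<kappa> "dom \<kappa>" g \<sigma> by (rule scale_chart[OF g k(1)])
  interpret K': scale_chart \<kappa>' "dom \<kappa>'" g \<sigma> by (rule scale_chart[OF g k(2)])
  define V where "V = dom \<kappa> \<inter> dom \<kappa>'"
  have oV: "open V" and pV: "p \<in> V" and VV: "V \<subseteq> dom \<kappa>" "V \<subseteq> dom \<kappa>'"
    using atlas k by (auto simp: V_def oriented_atlas_def)
  interpret C: chart_open \<kappa> V by (rule chart_open_subset[OF atlas k(1) oV VV(1)])
  interpret C': chart_open \<kappa>' V by (rule chart_open_subset[OF atlas k(2) oV VV(2)])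
  let ?J = "jac \<kappa> \<kappa>' p" and ?d = "det (jac \<kappa> \<kappa>' p)"
  have d: "?d > 0" by (rule jac_det_pos[OF k])
  have vol: "K.vol q = det (jac \<kappa> \<kappa>' q) powr (2 / 5) * K'.vol q" if "q \<in> V" for q
    unfolding K.vol_def K'.vol_def using that by (intro vol_change_chart[OF g k(1,2)]) (auto simp: V_def)
  have sq: "K.vol q powr (1 / 2) = det (jac \<kappa> \<kappa>' q) powr (1 / 5) * K'.vol q powr (1 / 2)" if "q \<in> V" for q
    unfolding vol[OF that] by (simp add: powr_mult powr_powr)
  have \<sigma>: "\<sigma> \<kappa>' q = det (jac \<kappa> \<kappa>' q) powr (1 / 5) * \<sigma> \<kappa> q" if "q \<in> V" for q
    using scale k(1,2) that unfolding almost_einstein_def density_def V_def by blast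
  have csm: "C.sm (coord \<kappa>')" using atlas k(1,2) unfolding oriented_atlas_def V_def by blast
  have grad: "?d powr (1 / 5) *\<^sub>R K.grad p = transpose ?J *v K'.grad p"
  proof -
    have "?d powr (1 / 5) * K.grad p $ b = (transpose ?J *v K'.grad p) $ b" for b
    proof -
      have "K.vol p powr (1 / 2) * K.grad p $ b = pd \<kappa> (\<lambda>q. K.vol q powr (1 / 2) * \<sigma> \<kappa> q) b p"
        by (rule K.pd_weighted_scale[OF k(3), symmetric])
      also have "\<dots> = pd \<kappa> (\<lambda>q. K'.vol q powr (1 / 2) * \<sigma> \<kappa>' q) b p"
        by (rule C.pd_cong[OF chart_smooth_subset[OF K.weighted_scale_sm VV(1)] _ pV]) (simp add: sq \<sigma>)
      also have "\<dots> = (\<Sum>e\<in>UNIV. ?J $ e $ b * pd \<kappa>' (\<lambda>q. K'.vol q powr (1 / 2) * \<sigma> \<kappa>' q) e p)"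
        by (rule pd_chain[OF C.chart_open_axioms C'.chart_open_axioms pV csm
              chart_smooth_subset[OF K'.weighted_scale_sm VV(2)]])
      also have "\<dots> = K'.vol p powr (1 / 2) * (transpose ?J *v K'.grad p) $ b"
        unfolding K'.pd_weighted_scale[OF k(4)]
        by (simp add: matrix_vector_mult_def transpose_def sum_distrib_left mult_ac)
      finally have "K'.vol p powr (1 / 2) * (?d powr (1 / 5) * K.grad p $ b - (transpose ?J *v K'.grad p) $ b) = 0"
        unfolding sq[OF pV] by (simp add: algebra_simps)
      then show ?thesis using K'.vol_pos[OF k(4)] by simp
    qed
    then show ?thesis by (simp add: vec_eq_iff)
  qed
  have "inj ((*v) (transpose ?J))"
    by (rule inj_matrix_vector_mult) (use d in \<open>simp add: invertible_det_nz det_transpose\<close>)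
  moreover have "transpose ?J *v (cmetric g \<kappa>' p *v (?d powr (- 1 / 5) *\<^sub>R (?J *v K.mu p))) = transpose ?J *v K'.grad p"
  proof -
    have "transpose ?J *v (cmetric g \<kappa>' p *v (?J *v K.mu p)) = ?d powr (2 / 5) *\<^sub>R (cmetric g \<kappa> p *v K.mu p)"
      unfolding cmetric_change_chart[OF g k] using d
      by (simp add: matrix_vector_mul_assoc matrix_mul_assoc scaleR_matrix_vector_assoc[symmetric] powr_add[symmetric])
    also have "\<dots> = ?d powr (1 / 5) *\<^sub>R (?d powr (1 / 5) *\<^sub>R K.grad p)"
      using d by (simp add: K.cmetric_mu[OF k(3)] powr_add[symmetric])
    finally have "transpose ?J *v (cmetric g \<kappa>' p *v (?J *v K.mu p)) = ?d powr (1 / 5) *\<^sub>R (transpose ?J *v K'.grad p)"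
      unfolding grad .
    then show ?thesis using d by (simp add: matrix_vector_mult_scaleR powr_add[symmetric])
  qed
  ultimately have "cmetric g \<kappa>' p *v (?d powr (- 1 / 5) *\<^sub>R (?J *v K.mu p)) = K'.grad p"
    by (rule injD)
  then have "?d powr (- 1 / 5) *\<^sub>R (?J *v K.mu p) = K'.mu p" by (rule K'.mu_unique[OF k(4)])
  then show ?thesis
    by (intro exI[of _ "?d powr (- 1 / 5) * K.rho p - K'.rho p"])
       (simp add: K.scale_tractor_eq K'.scale_tractor_eq tr_chart_def Let_def tX_def \<sigma>[OF pV])
qed

lemma tr_chart_tX: "tr_chart \<kappa> \<kappa>' p tX = det (jac \<kappa> \<kappa>' p) powr (- 1 / 5) *\<^sub>R tX"
  by (simp add: tr_chart_def tX_def Let_def)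

lemma tr_chart_tZ:
  "tr_chart \<kappa> \<kappa>' p (tZ a) = det (jac \<kappa> \<kappa>' p) powr (- 1 / 5) *\<^sub>R (\<Sum>e\<in>UNIV. jac \<kappa> \<kappa>' p $ e $ a *\<^sub>R tZ e)"
  unfolding sum_tZ by (simp add: tr_chart_def tZ_def Let_def vec_eq_iff matrix_vector_mul_component inner_axis)

text \<open>The 1-form \<open>eta\<close> does not see the third slot and so transforms as a
  covector, its curl as a 2-form. By \<open>curl_eta\<close> this curl also contains the third slot,
  and comparing the two charts yields \<open>\<delta>\<close> times a nonzero component of
  \<open>\<phi>\<close> equal to 0.\<close>

lemma scale_tractor_change_chart:
  assumes \<Phi>: "parallel_compatible_G2 A c \<Phi>" and g: "g \<in> c"
    and k: "\<kappa> \<in> A" "\<kappa>' \<in> A" "p \<in> dom \<kappa>" "p \<in> dom \<kappa>'"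
    and nz: "\<Phi> g \<kappa> p tX (tZ i) (tZ j) \<noteq> 0"
  shows "tr_chart \<kappa> \<kappa>' p (scale_tractor g \<kappa> \<sigma> p) = scale_tractor g \<kappa>' \<sigma> p"
proof -
  interpret K: g2_scale_chart \<kappa> "dom \<kappa>" g \<sigma> "\<Phi> g \<kappa>" by (rule g2_scale_chart[OF \<Phi> g k(1)])
  interpret K': g2_scale_chart \<kappa>' "dom \<kappa>'" g \<sigma> "\<Phi> g \<kappa>'" by (rule g2_scale_chart[OF \<Phi> g k(2)])
  define V where "V = dom \<kappa> \<inter> dom \<kappa>'"
  have oV: "open V" and pV: "p \<in> V" and VV: "V \<subseteq> dom \<kappa>" "V \<subseteq> dom \<kappa>'"
    using atlas k by (auto simp: V_def oriented_atlas_def)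
  interpret C: chart_open \<kappa> V by (rule chart_open_subset[OF atlas k(1) oV VV(1)])
  interpret C': chart_open \<kappa>' V by (rule chart_open_subset[OF atlas k(2) oV VV(2)])
  define J where "J q = jac \<kappa> \<kappa>' q" for q
  define d where "d q = det (J q)" for q
  have dpos: "d q > 0" if "q \<in> V" for q
    unfolding d_def J_def using that by (intro jac_det_pos[OF k(1,2)]) (auto simp: V_def)
  have vol: "K.vol q = d q powr (2 / 5) * K'.vol q" if "q \<in> V" for q
    unfolding K.vol_def K'.vol_def d_def J_def
    using that by (intro vol_change_chart[OF g k(1,2)]) (auto simp: V_def)
  have csm: "C.sm (coord \<kappa>')" using atlas k(1,2) unfolding oriented_atlas_def V_def by blast
  have J_nth: "J q $ e $ a = pd \<kappa> (\<lambda>r. coord \<kappa>' r $ e) a q" if "q \<in> V" for q e a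
    using C.pd_component[OF that csm, of e a] by (simp add: J_def jac_def matrix_def pd_def)
  have J_sm: "C.sm (\<lambda>q. J q $ e $ a)" for e a
    by (rule C.sm_cong[OF C.sm_pd[OF C.sm_component[OF csm]]]) (simp add: J_nth)
  have J_inv: "invertible (J q)" if "q \<in> V" for q
    using dpos[OF that] by (simp add: invertible_det_nz d_def)
  have tX: "tr_chart \<kappa> \<kappa>' q tX = d q powr (- 1 / 5) *\<^sub>R tX"
    and tZ: "tr_chart \<kappa> \<kappa>' q (tZ a) = d q powr (- 1 / 5) *\<^sub>R (\<Sum>e\<in>UNIV. J q $ e $ a *\<^sub>R tZ e)" for q a
    unfolding d_def J_def by (rule tr_chart_tX tr_chart_tZ)+
  \<comment> \<open>The weights of two frame vectors cancel against that of
    \<open>vol\<close>.\<close>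
  have pw: "d q powr (- 1 / 5) * d q powr (- 1 / 5) * d q powr (2 / 5) = 1" if "q \<in> V" for q
    using dpos[OF that] by (simp add: powr_add[symmetric])
  have trans: "\<Phi> g \<kappa> q u v w = \<Phi> g \<kappa>' q (tr_chart \<kappa> \<kappa>' q u) (tr_chart \<kappa> \<kappa>' q v) (tr_chart \<kappa> \<kappa>' q w)"
    if "q \<in> V" for q u v w
    using parallel_form_chart[OF \<Phi> g k(1,2), of q] that by (simp add: V_def)
  have eta: "K.eta a q = (\<Sum>e\<in>UNIV. J q $ e $ a * K'.eta e q)" if q: "q \<in> V" for a q
  proof -
    have q': "q \<in> dom \<kappa>'" using q by (simp add: V_def)
    obtain \<delta> where \<delta>: "tr_chart \<kappa> \<kappa>' q (K.S q) = K'.S q + \<delta> *\<^sub>R tX"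
      using scale_tractor_change_chart_upto_tX[OF g k(1,2), of q] q by (auto simp: V_def)
    have "\<Phi> g \<kappa> q tX (tZ a) (K.S q) = d q powr (- 1 / 5) * (d q powr (- 1 / 5) *
        (\<Sum>e\<in>UNIV. J q $ e $ a * \<Phi> g \<kappa>' q tX (tZ e) (K'.S q)))"
      unfolding trans[OF q] tX tZ \<delta> by (simp add: K'.F_lin[OF q'] K'.F_zero[OF q'] sum_distrib_left mult_ac)
    then have "K.eta a q = (d q powr (- 1 / 5) * d q powr (- 1 / 5) * d q powr (2 / 5)) *
        (K'.vol q * (\<Sum>e\<in>UNIV. J q $ e $ a * \<Phi> g \<kappa>' q tX (tZ e) (K'.S q)))"
      unfolding K.eta_def vol[OF q] by (simp only: mult_ac)
    then show ?thesis
      unfolding pw[OF q] by (simp add: K'.eta_def sum_distrib_left mult_ac)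
  qed
  \<comment> \<open>Smoothness of \<open>K'.eta\<close> is so far known in its own chart; in the
    other chart it comes from inverting the Jacobian in the relation \<open>eta\<close>.\<close>
  have eta'_sm: "C.sm (K'.eta e)" for e
  proof (rule C.sm_cong)
    show "C.sm (\<lambda>q. \<Sum>a\<in>UNIV. matrix_inv (J q) $ a $ e * K.eta a q)"
      by (intro C.sm_sum C.sm_mult C.sm_matrix_inv J_sm J_inv chart_smooth_subset[OF K.eta_sm VV(1)])
    fix q assume q: "q \<in> V"
    have "(\<Sum>a\<in>UNIV. matrix_inv (J q) $ a $ e * K.eta a q)
        = (\<Sum>f\<in>UNIV. (J q ** matrix_inv (J q)) $ f $ e * K'.eta f q)"
      unfolding eta[OF q] by (simp add: matrix_matrix_mult_def sum_distrib_left sum_distrib_right mult_ac)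
        (rule sum.swap)
    then show "(\<Sum>a\<in>UNIV. matrix_inv (J q) $ a $ e * K.eta a q) = K'.eta e q"
      by (simp add: matrix_inv_right[OF J_inv[OF q]] mat_def if_distrib[of "\<lambda>x. x * _"] cong: if_cong)
  qed
  have pd_eta: "pd \<kappa> (K.eta a) b p = (\<Sum>e\<in>UNIV. \<Sum>f\<in>UNIV. J p $ e $ a * J p $ f $ b * pd \<kappa>' (K'.eta e) f p)
      + (\<Sum>e\<in>UNIV. pd \<kappa> (pd \<kappa> (\<lambda>r. coord \<kappa>' r $ e) a) b p * K'.eta e p)" for a b
  proof -
    have "pd \<kappa> (K.eta a) b p = pd \<kappa> (\<lambda>q. \<Sum>e\<in>UNIV. J q $ e $ a * K'.eta e q) b p"
      by (rule C.pd_cong[OF chart_smooth_subset[OF K.eta_sm VV(1)] eta pV])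
    also have "\<dots> = (\<Sum>e\<in>UNIV. J p $ e $ a * pd \<kappa> (K'.eta e) b p + pd \<kappa> (\<lambda>q. J q $ e $ a) b p * K'.eta e p)"
      by (simp add: C.pd_sum[OF pV] C.sm_mult J_sm eta'_sm C.pd_mult[OF pV])
    also have "\<dots> = (\<Sum>e\<in>UNIV. J p $ e $ a * (\<Sum>f\<in>UNIV. J p $ f $ b * pd \<kappa>' (K'.eta e) f p)
        + pd \<kappa> (pd \<kappa> (\<lambda>r. coord \<kappa>' r $ e) a) b p * K'.eta e p)"
    proof (intro sum.cong refl arg_cong2[of _ _ _ _ "(+)"] arg_cong2[of _ _ _ _ "(*)"])
      show "pd \<kappa> (K'.eta e) b p = (\<Sum>f\<in>UNIV. J p $ f $ b * pd \<kappa>' (K'.eta e) f p)" for e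
        unfolding J_def
        by (rule pd_chain[OF C.chart_open_axioms C'.chart_open_axioms pV csm chart_smooth_subset[OF K'.eta_sm VV(2)]])
      show "pd \<kappa> (\<lambda>q. J q $ e $ a) b p = pd \<kappa> (pd \<kappa> (\<lambda>r. coord \<kappa>' r $ e) a) b p" for e
        by (rule C.pd_cong[OF J_sm J_nth pV])
    qed
    finally show ?thesis by (simp add: sum.distrib sum_distrib_left mult.assoc)
  qed
  obtain \<delta> where \<delta>: "tr_chart \<kappa> \<kappa>' p (K.S p) = K'.S p + \<delta> *\<^sub>R tX"
    using scale_tractor_change_chart_upto_tX[OF g k] by blast
  let ?dd = "d p powr (- 1 / 5) * d p powr (- 1 / 5)"
  define B where "B w = (\<Sum>f\<in>UNIV. \<Sum>e\<in>UNIV. J p $ f $ i * (J p $ e $ j * \<Phi> g \<kappa>' p (tZ f) (tZ e) w))" for w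
  have B: "\<Phi> g \<kappa>' p (tr_chart \<kappa> \<kappa>' p (tZ i)) (tr_chart \<kappa> \<kappa>' p (tZ j)) w = ?dd * B w" for w
    unfolding tZ B_def
    by (simp only: K'.F_lin(7,8)[OF k(4)], simp only: K'.F_lin(13)[OF k(4)],
        simp only: K'.F_lin(7,8,14)[OF k(4)], simp only: sum_distrib_left mult_ac)
  have 1: "2 * K.vol p * \<Phi> g \<kappa> p (tZ i) (tZ j) (K.S p) = 2 * K'.vol p * B (K'.S p)"
  proof -
    \<comment> \<open>Second derivatives of the transition map are symmetric and drop out of the
      curl.\<close>
    have "pd \<kappa> (pd \<kappa> (\<lambda>r. coord \<kappa>' r $ e) j) i p = pd \<kappa> (pd \<kappa> (\<lambda>r. coord \<kappa>' r $ e) i) j p" for e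
      by (rule C.pd_commute[OF pV C.sm_component[OF csm]])
    then have "2 * K.vol p * \<Phi> g \<kappa> p (tZ i) (tZ j) (K.S p)
      = (\<Sum>e\<in>UNIV. \<Sum>f\<in>UNIV. J p $ e $ j * J p $ f $ i * pd \<kappa>' (K'.eta e) f p)
      - (\<Sum>e\<in>UNIV. \<Sum>f\<in>UNIV. J p $ e $ i * J p $ f $ j * pd \<kappa>' (K'.eta e) f p)"
      unfolding K.curl_eta[OF k(3), symmetric] pd_eta by simp
    also have "(\<Sum>e\<in>UNIV. \<Sum>f\<in>UNIV. J p $ e $ i * J p $ f $ j * pd \<kappa>' (K'.eta e) f p)
      = (\<Sum>e\<in>UNIV. \<Sum>f\<in>UNIV. J p $ e $ j * J p $ f $ i * pd \<kappa>' (K'.eta f) e p)"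
      by (subst sum.swap) (simp add: mult_ac)
    finally show ?thesis
      unfolding B_def
      by (subst sum.swap) (simp add: K'.curl_eta[OF k(4)] right_diff_distrib[symmetric] sum_subtractf[symmetric]
          sum_distrib_left mult_ac)
  qed
  have "2 * K.vol p * \<Phi> g \<kappa> p (tZ i) (tZ j) (K.S p) = (?dd * d p powr (2 / 5)) * (2 * K'.vol p * (B (K'.S p) + \<delta> * B tX))"
    unfolding trans[OF pV] \<delta> vol[OF pV]
    by (simp add: K'.F_lin(3,9)[OF k(4)] B algebra_simps)
  then have "\<delta> * B tX = 0"
    unfolding 1 pw[OF pV] using K'.vol_pos[OF k(4)] by simp
  moreover have "\<Phi> g \<kappa> p (tZ i) (tZ j) tX = d p powr (- 1 / 5) * (?dd * B tX)"
    unfolding trans[OF pV] tX by (simp add: K'.F_lin(9)[OF k(4)] B)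
  moreover have "\<Phi> g \<kappa> p (tZ i) (tZ j) tX \<noteq> 0"
    using nz K.F_skew(3)[OF k(3), of tX "tZ j" "tZ i"] K.F_skew(2)[OF k(3), of tX "tZ i" "tZ j"] by simp
  ultimately have "\<delta> = 0" by auto
  then show ?thesis using \<delta> by simp
qed

section \<open>Change of metric in the conformal class\<close>

lemma rescaled_cmetric:
  assumes "g \<in> c" "rescaled A \<Omega> g h" "\<kappa> \<in> A" "p \<in> dom \<kappa>"
  shows "cmetric h \<kappa> p = cmetric g \<kappa> p" "\<bar>det (h \<kappa> p)\<bar> powr (1 / 5) = \<Omega> p * \<Omega> p * \<bar>det (g \<kappa> p)\<bar> powr (1 / 5)"
proof -
  have h: "h \<kappa> p = (\<Omega> p)\<^sup>2 *\<^sub>R g \<kappa> p" and o: "\<Omega> p > 0"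
    using assms unfolding rescaled_def by blast+
  have "det (h \<kappa> p) = \<Omega> p ^ 10 * det (g \<kappa> p)"
    unfolding h using det_scaleR[of "(\<Omega> p)\<^sup>2" "g \<kappa> p"] by (simp add: power_mult[symmetric])
  then have "\<bar>det (h \<kappa> p)\<bar> = \<Omega> p ^ 10 * \<bar>det (g \<kappa> p)\<bar>" using o by (simp add: abs_mult)
  moreover have "(\<Omega> p ^ 10) powr a = \<Omega> p powr (10 * a)" for a
    using powr_realpow[OF o, of 10] by (simp add: powr_powr[of "\<Omega> p" 10 a, symmetric])
  ultimately have *: "\<bar>det (h \<kappa> p)\<bar> powr a = \<Omega> p powr (10 * a) * \<bar>det (g \<kappa> p)\<bar> powr a" for a
    by (simp add: powr_mult)
  have 2: "\<Omega> p powr 2 = \<Omega> p * \<Omega> p" using o by (simp add: powr_numeral power2_eq_square)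
  show "\<bar>det (h \<kappa> p)\<bar> powr (1 / 5) = \<Omega> p * \<Omega> p * \<bar>det (g \<kappa> p)\<bar> powr (1 / 5)"
    unfolding *[of "1 / 5"] by (simp add: 2)
  have c: "\<bar>det (h \<kappa> p)\<bar> powr (- 1 / 5) = \<Omega> p powr (- 2) * \<bar>det (g \<kappa> p)\<bar> powr (- 1 / 5)"
    using *[of "- 1 / 5"] by simp
  have "\<Omega> p powr (- 2) * (\<Omega> p)\<^sup>2 = 1"
    using o by (simp add: powr_minus 2 power2_eq_square field_simps)
  then show "cmetric h \<kappa> p = cmetric g \<kappa> p"
    unfolding cmetric_def c unfolding h by (simp add: mult_ac)
qed

text \<open>As for charts, the curl of \<open>eta\<close> detects the third slot. Now
  \<open>eta\<close> is multiplied by the square of \<open>\<Omega>\<close>; the additional term of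
  the curl is exactly what the change of the frame vectors \<open>tZ\<close> produces.\<close>

lemma scale_tractor_rescaled:
  assumes \<Phi>: "parallel_compatible_G2 A c \<Phi>" and g: "g \<in> c" and h: "h \<in> c"
    and \<Omega>: "rescaled A \<Omega> g h" and k: "\<kappa> \<in> A" and p: "p \<in> dom \<kappa>"
    and nz: "\<Phi> g \<kappa> p tX (tZ i) (tZ j) \<noteq> 0"
  shows "tr_split \<Omega> g \<kappa> p (scale_tractor g \<kappa> \<sigma> p) = scale_tractor h \<kappa> \<sigma> p"
proof -
  interpret K: g2_scale_chart \<kappa> "dom \<kappa>" g \<sigma> "\<Phi> g \<kappa>" by (rule g2_scale_chart[OF \<Phi> g k])
  interpret H: g2_scale_chart \<kappa> "dom \<kappa>" h \<sigma> "\<Phi> h \<kappa>" by (rule g2_scale_chart[OF \<Phi> h k])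
  have O: "K.sm \<Omega>" and opos: "\<Omega> q > 0" for q using \<Omega> k unfolding rescaled_def smooth_fun_def by blast+
  define U where "U q = (\<chi> b. pd \<kappa> (\<lambda>q. ln (\<Omega> q)) b q)" for q
  have U: "pd \<kappa> \<Omega> b q = \<Omega> q * U q $ b" if "q \<in> dom \<kappa>" for b q
    using opos[of q] by (simp add: U_def K.pd_ln[OF that O opos])
  have vol: "H.vol q = \<Omega> q * \<Omega> q * K.vol q" if "q \<in> dom \<kappa>" for q
    unfolding K.vol_def H.vol_def by (rule rescaled_cmetric(2)[OF g \<Omega> k that])
  have upto: "\<exists>\<delta>. tr_split \<Omega> g \<kappa> q (K.S q) = H.S q + \<delta> *\<^sub>R tX" if q: "q \<in> dom \<kappa>" for q
  proof -
    have "H.grad q $ b = K.grad q $ b + \<sigma> \<kappa> q * U q $ b" for b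
    proof -
      have sq: "H.vol r powr (1 / 2) = \<Omega> r * K.vol r powr (1 / 2)" if "r \<in> dom \<kappa>" for r
        unfolding vol[OF that] using opos[of r] by (simp add: powr_mult powr_half_sqrt)
      have "H.vol q powr (1 / 2) * H.grad q $ b = pd \<kappa> (\<lambda>r. H.vol r powr (1 / 2) * \<sigma> \<kappa> r) b q"
        by (rule H.pd_weighted_scale[OF q, symmetric])
      also have "\<dots> = pd \<kappa> (\<lambda>r. \<Omega> r * (K.vol r powr (1 / 2) * \<sigma> \<kappa> r)) b q"
        by (rule K.pd_cong[OF H.weighted_scale_sm _ q]) (simp add: sq)
      also have "\<dots> = \<Omega> q * (K.vol q powr (1 / 2) * K.grad q $ b) + \<Omega> q * U q $ b * (K.vol q powr (1 / 2) * \<sigma> \<kappa> q)"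
        unfolding K.pd_mult[OF q O K.weighted_scale_sm] K.pd_weighted_scale[OF q] U[OF q] ..
      finally have "(\<Omega> q * K.vol q powr (1 / 2)) * (H.grad q $ b - (K.grad q $ b + \<sigma> \<kappa> q * U q $ b)) = 0"
        unfolding sq[OF q] by (simp add: algebra_simps)
      then show ?thesis using opos[of q] K.vol_pos[OF q] by simp
    qed
    then have "H.grad q = K.grad q + \<sigma> \<kappa> q *\<^sub>R U q" by (simp add: vec_eq_iff)
    then have "H.mu q = K.mu q + \<sigma> \<kappa> q *\<^sub>R (cinv g \<kappa> q *v U q)"
      by (simp add: H.mu_def K.mu_def cinv_def rescaled_cmetric(1)[OF g \<Omega> k q]
          matrix_vector_right_distrib matrix_vector_mult_scaleR)
    then show ?thesis
      by (intro exI[of _ "snd (snd (tr_split \<Omega> g \<kappa> q (K.S q))) - H.rho q"])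
         (simp add: K.scale_tractor_eq H.scale_tractor_eq tr_split_def Let_def tX_def U_def)
  qed
  have tX: "tr_split \<Omega> g \<kappa> q tX = tX" for q by (simp add: tr_split_def tX_def Let_def)
  \<comment> \<open>The vector that becomes \<open>tZ a\<close> in the new splitting; its
    \<open>tX\<close> part disappears whenever \<open>tX\<close> is inserted as well.\<close>
  have tZ: "tr_split \<Omega> g \<kappa> q (tZ a + U q $ a *\<^sub>R tX) = tZ a" for q a
    by (simp add: tr_split_def tX_def tZ_def Let_def U_def inner_axis)
  have trans: "\<Phi> h \<kappa> q (tr_split \<Omega> g \<kappa> q u) (tr_split \<Omega> g \<kappa> q v) (tr_split \<Omega> g \<kappa> q w) = \<Phi> g \<kappa> q u v w"
    if "q \<in> dom \<kappa>" for q u v w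
    using parallel_form_split[OF \<Phi> g h \<Omega> k that] .
  have eta: "H.eta a q = \<Omega> q * \<Omega> q * K.eta a q" if q: "q \<in> dom \<kappa>" for a q
  proof -
    obtain \<delta> where \<delta>: "tr_split \<Omega> g \<kappa> q (K.S q) = H.S q + \<delta> *\<^sub>R tX" using upto[OF q] by blast
    have "\<Phi> h \<kappa> q tX (tZ a) (H.S q + \<delta> *\<^sub>R tX) = \<Phi> g \<kappa> q tX (tZ a + U q $ a *\<^sub>R tX) (K.S q)"
      using trans[OF q, of tX "tZ a + U q $ a *\<^sub>R tX" "K.S q"] by (simp only: tX tZ \<delta>)
    then have "\<Phi> h \<kappa> q tX (tZ a) (H.S q) = \<Phi> g \<kappa> q tX (tZ a) (K.S q)"
      by (simp add: H.F_lin[OF q] H.F_zero[OF q] K.F_lin[OF q] K.F_zero[OF q])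
    then show ?thesis by (simp add: H.eta_def K.eta_def vol[OF q])
  qed
  have pd_eta: "pd \<kappa> (H.eta a) b p = \<Omega> p * \<Omega> p * (pd \<kappa> (K.eta a) b p + 2 * U p $ b * K.eta a p)" for a b
  proof -
    have "pd \<kappa> (H.eta a) b p = pd \<kappa> (\<lambda>q. \<Omega> q * \<Omega> q * K.eta a q) b p"
      by (rule K.pd_cong[OF H.eta_sm eta p])
    then show ?thesis
      by (simp add: K.pd_mult[OF p] K.sm_mult O K.eta_sm U[OF p] algebra_simps)
  qed
  obtain \<delta> where \<delta>: "tr_split \<Omega> g \<kappa> p (K.S p) = H.S p + \<delta> *\<^sub>R tX" using upto[OF p] by blast
  have F1: "\<Phi> h \<kappa> p (tZ i) (tZ j) (H.S p) + \<delta> * \<Phi> h \<kappa> p (tZ i) (tZ j) tX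
     = \<Phi> g \<kappa> p (tZ i) (tZ j) (K.S p) + U p $ i * \<Phi> g \<kappa> p tX (tZ j) (K.S p) - U p $ j * \<Phi> g \<kappa> p tX (tZ i) (K.S p)"
  proof -
    have "\<Phi> h \<kappa> p (tZ i) (tZ j) (H.S p + \<delta> *\<^sub>R tX)
        = \<Phi> g \<kappa> p (tZ i + U p $ i *\<^sub>R tX) (tZ j + U p $ j *\<^sub>R tX) (K.S p)"
      using trans[OF p, of "tZ i + U p $ i *\<^sub>R tX" "tZ j + U p $ j *\<^sub>R tX" "K.S p"] by (simp only: tZ \<delta>)
    moreover have "\<Phi> g \<kappa> p (tZ i) tX (K.S p) = - \<Phi> g \<kappa> p tX (tZ i) (K.S p)" by (rule K.F_skew(1)[OF p])
    ultimately show ?thesis by (simp add: H.F_lin[OF p] K.F_lin[OF p] K.F_zero[OF p])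
  qed
  have "2 * H.vol p * \<Phi> h \<kappa> p (tZ i) (tZ j) (H.S p)
      = \<Omega> p * \<Omega> p * (2 * K.vol p * \<Phi> g \<kappa> p (tZ i) (tZ j) (K.S p) + 2 * U p $ i * K.eta j p - 2 * U p $ j * K.eta i p)"
    unfolding H.curl_eta[OF p, symmetric] K.curl_eta[OF p, symmetric] pd_eta by (simp add: algebra_simps)
  also have "\<dots> = 2 * H.vol p * (\<Phi> g \<kappa> p (tZ i) (tZ j) (K.S p) + U p $ i * \<Phi> g \<kappa> p tX (tZ j) (K.S p)
      - U p $ j * \<Phi> g \<kappa> p tX (tZ i) (K.S p))"
    unfolding vol[OF p] K.eta_def by (simp add: algebra_simps)
  finally have "\<delta> * \<Phi> h \<kappa> p (tZ i) (tZ j) tX = 0"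
    unfolding F1[symmetric] using H.vol_pos[OF p] by simp
  moreover have "\<Phi> h \<kappa> p (tZ i) (tZ j) tX = \<Phi> g \<kappa> p (tZ i) (tZ j) tX"
    using trans[OF p, of "tZ i + U p $ i *\<^sub>R tX" "tZ j + U p $ j *\<^sub>R tX" tX]
    by (simp add: tX tZ K.F_lin[OF p] K.F_zero[OF p])
  moreover have "\<Phi> g \<kappa> p (tZ i) (tZ j) tX \<noteq> 0"
    using nz K.F_skew(3)[OF p, of tX "tZ j" "tZ i"] K.F_skew(2)[OF p, of tX "tZ i" "tZ j"] by simp
  ultimately have "\<delta> = 0" by simp
  then show ?thesis using \<delta> by simp
qed

section \<open>Invariance of the tractor metric\<close>

lemma tr_H_tr_chart:
  assumes "g \<in> c" "\<kappa> \<in> A" "\<kappa>' \<in> A" "p \<in> dom \<kappa>" "p \<in> dom \<kappa>'"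
  shows "tr_H (cmetric g \<kappa>' p) (tr_chart \<kappa> \<kappa>' p u) (tr_chart \<kappa> \<kappa>' p u) = tr_H (cmetric g \<kappa> p) u u"
proof -
  obtain s m r where u: "u = (s, m, r)" by (cases u)
  let ?J = "jac \<kappa> \<kappa>' p" and ?d = "det (jac \<kappa> \<kappa>' p)"
  have d: "?d > 0" by (rule jac_det_pos[OF assms(2-5)])
  have 1: "?d powr (1 / 5) * ?d powr (- 1 / 5) = 1" "?d powr (- 1 / 5) * ?d powr (- 1 / 5) = ?d powr (- 2 / 5)"
    using d by (simp_all add: powr_add[symmetric])
  have "m \<bullet> ((transpose ?J ** cmetric g \<kappa>' p ** ?J) *v m) = (?J *v m) \<bullet> (cmetric g \<kappa>' p *v (?J *v m))"
    using inner_transpose_mult[of m ?J "cmetric g \<kappa>' p *v (?J *v m)"]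
    by (simp add: matrix_vector_mul_assoc matrix_mul_assoc)
  then have "tr_H (cmetric g \<kappa> p) u u = 2 * (s * r) + ?d powr (- 2 / 5) * ((?J *v m) \<bullet> (cmetric g \<kappa>' p *v (?J *v m)))"
    unfolding u tr_H_self cmetric_change_chart[OF assms] by (simp add: scaleR_matrix_vector_assoc[symmetric])
  moreover have "tr_H (cmetric g \<kappa>' p) (tr_chart \<kappa> \<kappa>' p u) (tr_chart \<kappa> \<kappa>' p u)
     = 2 * ((?d powr (1 / 5) * ?d powr (- 1 / 5)) * (s * r))
       + (?d powr (- 1 / 5) * ?d powr (- 1 / 5)) * ((?J *v m) \<bullet> (cmetric g \<kappa>' p *v (?J *v m)))"
    unfolding u tr_chart_def by (simp add: Let_def tr_H_self matrix_vector_mult_scaleR mult_ac)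
  ultimately show ?thesis unfolding 1 by simp
qed

lemma tr_H_tr_split:
  assumes "g \<in> c" "rescaled A \<Omega> g h" "\<kappa> \<in> A" "p \<in> dom \<kappa>"
  shows "tr_H (cmetric h \<kappa> p) (tr_split \<Omega> g \<kappa> p u) (tr_split \<Omega> g \<kappa> p u) = tr_H (cmetric g \<kappa> p) u u"
proof -
  interpret K: scale_chart \<kappa> "dom \<kappa>" g \<sigma> by (rule scale_chart[OF assms(1,3)])
  obtain s m r where u: "u = (s, m, r)" by (cases u)
  define U where "U = (\<chi> b. pd \<kappa> (\<lambda>q. ln (\<Omega> q)) b p)"
  define V where "V = cinv g \<kappa> p *v U"
  let ?G = "cmetric g \<kappa> p"
  have GV: "?G *v V = U"
    by (simp add: V_def matrix_vector_mul_assoc K.cmetric_cinv[OF assms(4)])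
  have mV: "V \<bullet> (?G *v m) = U \<bullet> m"
    using inner_transpose_mult[of V ?G m] K.cmetric_sym[OF assms(4)] by (simp add: GV)
  have "tr_split \<Omega> g \<kappa> p u = (s, m + s *\<^sub>R V, r - U \<bullet> m - (1 / 2) * (U \<bullet> V) * s)"
    by (simp add: u tr_split_def Let_def U_def V_def)
  then show ?thesis
    unfolding u rescaled_cmetric(1)[OF assms]
    by (simp add: tr_H_self matrix_vector_right_distrib matrix_vector_mult_scaleR GV mV
        inner_add_left inner_add_right inner_commute[of _ U] algebra_simps)
qed

end

section \<open>Oriented planes and their bivectors\<close>

lemma independent_pair:
  fixes u v :: "'a::real_vector"
  assumes "u \<noteq> v" "independent {u, v}" "a *\<^sub>R u = b *\<^sub>R v" shows "a = 0" "b = 0"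
proof -
  have i: "u \<notin> span {v}" "v \<noteq> 0"
    using assms(1,2) by (auto simp: independent_insert dependent_single split: if_splits)
  have "u = (b / a) *\<^sub>R v" if "a \<noteq> 0"
  proof -
    have "(1 / a) *\<^sub>R (a *\<^sub>R u) = (1 / a) *\<^sub>R (b *\<^sub>R v)" using assms(3) by simp
    then show ?thesis using that by simp
  qed
  then show "a = 0" using i(1) by (metis insertI1 span_base span_scale)
  then show "b = 0" using assms(3) i(2) by simp
qed

lemma bivector_spans_nonzero:
  assumes "bivector_spans \<phi> Q" shows "\<phi> \<noteq> 0"
proof
  assume "\<phi> = 0"
  obtain u v where uv: "u \<noteq> v" "independent {u, v}" "\<phi> = (\<chi> a b. u $ a * v $ b - u $ b * v $ a)"
    using assms by (auto simp: bivector_spans_def)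
  have eq: "v $ b *\<^sub>R u = u $ b *\<^sub>R v" for b
    using \<open>\<phi> = 0\<close> uv(3) by (simp add: vec_eq_iff mult.commute)
  have "v $ b = 0" for b by (rule independent_pair(1)[OF uv(1,2) eq])
  then have "v = 0" by (simp add: vec_eq_iff)
  then show False using uv(2) dependent_zero by blast
qed

text \<open>A change between positive frames of a plane multiplies their bivector by its positive
  determinant.\<close>

lemma bivector_spans_ratio:
  assumes "bivector_spans \<phi> Q" "bivector_spans \<psi> Q" shows "\<exists>f>0. \<psi> = f *\<^sub>R \<phi>"
proof -
  obtain u v where uv: "\<phi> = (\<chi> a b. u $ a * v $ b - u $ b * v $ a)" "Q = oriented_plane u v"
    using assms(1) by (auto simp: bivector_spans_def)
  obtain u' v' where uv': "\<psi> = (\<chi> a b. u' $ a * v' $ b - u' $ b * v' $ a)" "Q = oriented_plane u' v'"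
    using assms(2) by (auto simp: bivector_spans_def)
  have "(1 *\<^sub>R u' + 0 *\<^sub>R v', 0 *\<^sub>R u' + 1 *\<^sub>R v') \<in> oriented_plane u' v'"
    unfolding oriented_plane_def mem_Collect_eq
    by (rule exI[of _ 1], rule exI[of _ 0], rule exI[of _ 0], rule exI[of _ 1]) simp
  then have "(u', v') \<in> oriented_plane u v" using uv(2) uv'(2) by simp
  then obtain a b a' b' where e: "u' = a *\<^sub>R u + b *\<^sub>R v" "v' = a' *\<^sub>R u + b' *\<^sub>R v" "a * b' - b * a' > 0"
    by (auto simp: oriented_plane_def)
  have "\<psi> = (a * b' - b * a') *\<^sub>R \<phi>"
    unfolding uv(1) uv'(1) e(1,2) by (simp add: vec_eq_iff algebra_simps)
  then show ?thesis using e(3) by blast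
qed

text \<open>Contracting \<open>l\<close> with the bivector of \<open>u\<close> and \<open>v\<close>
  gives \<open>l(u) v - l(v) u\<close>; independence makes both coefficients vanish.\<close>

lemma bivector_spans_annihilator:
  assumes "bivector_spans \<phi> Q" "\<And>f. (\<Sum>e\<in>UNIV. l e * \<phi> $ e $ f) = 0" "x \<in> plane_of Q"
  shows "(\<Sum>e\<in>UNIV. x $ e * l e) = 0"
proof -
  obtain u v where uv: "u \<noteq> v" "independent {u, v}" "\<phi> = (\<chi> a b. u $ a * v $ b - u $ b * v $ a)"
    "Q = oriented_plane u v"
    using assms(1) by (auto simp: bivector_spans_def)
  let ?l = "\<lambda>x :: real ^ 5. \<Sum>e\<in>UNIV. x $ e * l e"
  have "?l v *\<^sub>R u = ?l u *\<^sub>R v"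
  proof -
    have "?l u * v $ f - ?l v * u $ f = 0" for f
    proof -
      have "(\<Sum>e\<in>UNIV. l e * \<phi> $ e $ f) = ?l u * v $ f - ?l v * u $ f"
        by (simp add: uv(3) right_diff_distrib sum_subtractf sum_distrib_left mult_ac)
      then show ?thesis using assms(2)[of f] by simp
    qed
    then show ?thesis by (simp add: vec_eq_iff)
  qed
  note z = independent_pair[OF uv(1,2) this]
  have lin: "?l (a *\<^sub>R x + b *\<^sub>R y) = a * ?l x + b * ?l y" for a b x y
    by (simp add: distrib_right sum.distrib sum_distrib_left mult.assoc)
  have "subspace {x. ?l x = 0}"
    by (rule subspaceI) (simp_all add: distrib_right sum.distrib mult.assoc sum_distrib_left[symmetric])
  moreover have "fst ` oriented_plane u v \<subseteq> {x. ?l x = 0}"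
    using z lin by (auto simp: oriented_plane_def)
  ultimately have "plane_of Q \<subseteq> {x. ?l x = 0}"
    unfolding plane_of_def uv(4) by (intro span_minimal)
  then show ?thesis using assms(3) by blast
qed

section \<open>The square norm of the scale tractor\<close>

lemma (in scale_chart) norm_scale_tractor_sm:
  "sm (\<lambda>q. tr_H (cmetric g \<kappa> q) (scale_tractor g \<kappa> \<sigma> q) (scale_tractor g \<kappa> \<sigma> q))"
proof (rule sm_cong)
  show "sm (\<lambda>q. 2 * (\<sigma> \<kappa> q * rho q) + (\<Sum>a\<in>UNIV. mu q $ a * grad q $ a))"
    by (intro sm_add sm_mult sm_const sm_sum \<sigma>_sm rho_sm sm_component[OF mu_sm] sm_component[OF grad_sm])
qed (simp add: scale_tractor_eq tr_H_self cmetric_mu inner_vec_def)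

context ae_structure
begin

lemma proj_part_nth: "proj_part \<Phi> g \<kappa> p $ a $ b = \<Phi> g \<kappa> p tX (tZ a) (tZ b)"
  by (simp add: proj_part_def tX_def tZ_def)

lemma proj_part_eq:
  assumes "g \<in> c" "\<kappa> \<in> A" "p \<in> dom \<kappa>"
  shows "proj_part \<Phi> g \<kappa> p = cmetric g \<kappa> p ** proj_bivector \<Phi> g \<kappa> p ** cmetric g \<kappa> p"
proof -
  interpret K: scale_chart \<kappa> "dom \<kappa>" g \<sigma> by (rule scale_chart[OF assms(1,2)])
  have "cmetric g \<kappa> p ** proj_bivector \<Phi> g \<kappa> p ** cmetric g \<kappa> p
      = (cmetric g \<kappa> p ** cinv g \<kappa> p) ** proj_part \<Phi> g \<kappa> p ** (cinv g \<kappa> p ** cmetric g \<kappa> p)"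
    unfolding proj_bivector_def K.cinv_sym[OF assms(3)] by (simp only: matrix_mul_assoc)
  then show ?thesis by (simp add: K.cmetric_cinv[OF assms(3)] K.cinv_cmetric[OF assms(3)])
qed

lemma G2_of_distD:
  assumes "G2_of_dist A c D \<Phi>"
  shows "parallel_compatible_G2 A c \<Phi>"
    "g \<in> c \<Longrightarrow> \<kappa> \<in> A \<Longrightarrow> p \<in> dom \<kappa> \<Longrightarrow> bivector_spans (proj_bivector \<Phi> g \<kappa> p) (D \<kappa> p)"
    "g \<in> c \<Longrightarrow> \<kappa> \<in> A \<Longrightarrow> p \<in> dom \<kappa> \<Longrightarrow> compatible_G2 (cmetric g \<kappa> p) (\<Phi> g \<kappa> p)"
  using assms unfolding G2_of_dist_def spans_dist_def parallel_compatible_G2_def by blast+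

lemma phi_nonzero:
  assumes \<Phi>: "G2_of_dist A c D \<Phi>" and g: "g \<in> c" "\<kappa> \<in> A" "p \<in> dom \<kappa>"
  shows "\<exists>a b. \<Phi> g \<kappa> p tX (tZ a) (tZ b) \<noteq> 0"
proof (rule ccontr)
  assume "\<not> ?thesis"
  then have "proj_part \<Phi> g \<kappa> p = 0" by (simp add: vec_eq_iff proj_part_nth)
  then have "proj_bivector \<Phi> g \<kappa> p = 0" by (simp add: proj_bivector_def matrix_matrix_mult_def vec_eq_iff)
  then show False using bivector_spans_nonzero[OF G2_of_distD(2)[OF \<Phi> g]] by simp
qed

text \<open>Both bivectors represent the same oriented planes, hence are positive multiples of each
  other. This positivity is what excludes the factor -1.\<close>

lemma G2_of_dist_unique:
  assumes \<Phi>: "G2_of_dist A c D \<Phi>" and \<Psi>: "G2_of_dist A c D \<Psi>" and g: "g \<in> c" "\<kappa> \<in> A" "p \<in> dom \<kappa>"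
  shows "\<Psi> g \<kappa> p u v w = \<Phi> g \<kappa> p u v w"
proof -
  interpret K: g2_scale_chart \<kappa> "dom \<kappa>" g \<sigma> "\<Phi> g \<kappa>" by (rule g2_scale_chart[OF G2_of_distD(1)[OF \<Phi>] g(1,2)])
  interpret L: g2_scale_chart \<kappa> "dom \<kappa>" g \<sigma> "\<Psi> g \<kappa>" by (rule g2_scale_chart[OF G2_of_distD(1)[OF \<Psi>] g(1,2)])
  have "\<exists>f>0. \<forall>u v w. \<Psi> g \<kappa> p u v w = f * \<Phi> g \<kappa> p u v w"
  proof (rule parallel_form_determined[OF K.g2_chart_axioms L.g2_chart_axioms _ phi_nonzero[OF \<Phi> g(1,2)] g(3)])
    fix q assume q: "q \<in> dom \<kappa>"
    obtain f where f: "f > 0" "proj_bivector \<Psi> g \<kappa> q = f *\<^sub>R proj_bivector \<Phi> g \<kappa> q"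
      using bivector_spans_ratio[OF G2_of_distD(2)[OF \<Phi> g(1,2) q] G2_of_distD(2)[OF \<Psi> g(1,2) q]] by blast
    have "proj_part \<Psi> g \<kappa> q = f *\<^sub>R proj_part \<Phi> g \<kappa> q"
      unfolding proj_part_eq[OF g(1,2) q] f(2) by (simp add: matrix_scalar_ac scalar_matrix_assoc[symmetric])
    then show "\<exists>f>0. \<forall>a b. \<Psi> g \<kappa> q tX (tZ a) (tZ b) = f * \<Phi> g \<kappa> q tX (tZ a) (tZ b)"
      using f(1) by (auto simp: vec_eq_iff proj_part_nth)
  qed
  then obtain f where f: "f > 0" "\<And>u v w. \<Psi> g \<kappa> p u v w = f * \<Phi> g \<kappa> p u v w" by blast
  have "f = 1"
    by (rule compatible_G2_scale_unique[OF G2_of_distD(3)[OF \<Phi> g] G2_of_distD(3)[OF \<Psi> g] f(2,1)])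
       (rule tr_H_sym[OF K.cmetric_sym[OF g(3)]])
  then show ?thesis using f(2) by simp
qed

text \<open>
  The derivative \<open>2 \<sigma> \<lambda>\<close> of the norm is annihilated by \<open>D\<close>, since \<open>\<lambda> \<and> \<phi> = 0\<close> and \<open>D\<close> is totally null;
  as \<open>D\<close> is bracket generating, the norm is constant.
\<close>

lemma pd_norm_scale_tractor_0:
  assumes D: "oriented_235 A D" and \<Phi>: "G2_of_dist A c D \<Phi>" and g: "g \<in> c" "\<kappa> \<in> A" "p \<in> dom \<kappa>"
  shows "pd \<kappa> (\<lambda>q. tr_H (cmetric g \<kappa> q) (scale_tractor g \<kappa> \<sigma> q) (scale_tractor g \<kappa> \<sigma> q)) b p = 0"
proof -
  interpret K: g2_scale_chart \<kappa> "dom \<kappa>" g \<sigma> "\<Phi> g \<kappa>" by (rule g2_scale_chart[OF G2_of_distD(1)[OF \<Phi>] g(1,2)])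
  show ?thesis
  proof (rule annihilates_235_imp_pd_0[OF atlas g(2) K.norm_scale_tractor_sm D _ g(3)], unfold annihilates_def, intro ballI)
    fix q x assume q: "q \<in> dom \<kappa>" and x: "x \<in> plane_of (D \<kappa> q)"
    let ?\<phi> = "proj_part \<Phi> g \<kappa> q" and ?U = "proj_bivector \<Phi> g \<kappa> q"
    have "?\<phi> ** cinv g \<kappa> q ** ?\<phi> = 0"
      unfolding cinv_def
      by (rule compatible_G2_phi_null[OF G2_of_distD(3)[OF \<Phi> g(1,2) q] K.alt[OF q] K.cmetric_sym[OF q] K.cmetric_inv[OF q]])
         (simp add: vec_eq_iff proj_part_nth)
    moreover have "?\<phi> ** ?U = (?\<phi> ** cinv g \<kappa> q ** ?\<phi>) ** cinv g \<kappa> q"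
      unfolding proj_bivector_def K.cinv_sym[OF q] by (simp only: matrix_mul_assoc)
    ultimately have "?\<phi> ** ?U = 0" by (simp add: matrix_matrix_mult_def vec_eq_iff)
    then have null: "(\<Sum>e\<in>UNIV. ?\<phi> $ a $ e * ?U $ e $ f) = 0" for a f
      by (simp add: matrix_matrix_mult_def vec_eq_iff)
    obtain i j where ij: "?\<phi> $ i $ j \<noteq> 0" using phi_nonzero[OF \<Phi> g(1,2) q] by (auto simp: proj_part_nth)
    \<comment> \<open>With a fixed nonzero component \<open>i j\<close>, the equation
      \<open>lam\<close> wedge \<open>\<phi>\<close> = 0 expresses \<open>lam\<close> through rows
      of \<open>\<phi>\<close>, which are killed by the bivector because the planes are
      null.\<close>
    have lam: "(\<Sum>e\<in>UNIV. K.lam e q * ?U $ e $ f) = 0" for f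
    proof -
      have "?\<phi> $ e $ i = - ?\<phi> $ i $ e" for e unfolding proj_part_nth by (rule K.F_skew(2)[OF q])
      then have "K.lam e q * ?\<phi> $ i $ j + K.lam i q * ?\<phi> $ j $ e - K.lam j q * ?\<phi> $ i $ e = 0" for e
        using K.lam_wedge_phi[OF q, of e i j] by (simp add: proj_part_nth)
      then have "0 = (\<Sum>e\<in>UNIV. (K.lam e q * ?\<phi> $ i $ j + K.lam i q * ?\<phi> $ j $ e - K.lam j q * ?\<phi> $ i $ e) * ?U $ e $ f)"
        by simp
      also have "\<dots> = ?\<phi> $ i $ j * (\<Sum>e\<in>UNIV. K.lam e q * ?U $ e $ f)
          + K.lam i q * (\<Sum>e\<in>UNIV. ?\<phi> $ j $ e * ?U $ e $ f) - K.lam j q * (\<Sum>e\<in>UNIV. ?\<phi> $ i $ e * ?U $ e $ f)"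
        by (simp add: sum_distrib_left sum.distrib sum_subtractf algebra_simps)
      finally show ?thesis using ij by (simp add: null)
    qed
    have "(\<Sum>e\<in>UNIV. x $ e * K.lam e q) = 0"
      by (rule bivector_spans_annihilator[OF G2_of_distD(2)[OF \<Phi> g(1,2) q] lam x])
    then have "2 * \<sigma> \<kappa> q * (\<Sum>e\<in>UNIV. x $ e * K.lam e q) = 0" by simp
    then show "(\<Sum>b\<in>UNIV. x $ b * pd \<kappa> (\<lambda>q. tr_H (cmetric g \<kappa> q) (K.S q) (K.S q)) b q) = 0"
      unfolding K.pd_tr_H_scale_tractor[OF q] by (simp add: sum_distrib_left mult_ac)
  qed
qed

lemma conf_rescaled: "g \<in> c \<Longrightarrow> h \<in> c \<Longrightarrow> \<exists>\<Omega>. rescaled A \<Omega> g h"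
  using conf unfolding conformal_structure_def by blast

text \<open>The derivative vanishes in each chart, so independence of chart and metric together with
  connectedness makes the norm one global constant. The single \<open>\<epsilon>\<close> in
  \<open>family\<close> requires this.\<close>

lemma norm_scale_tractor_constant:
  assumes conn: "connected (UNIV :: 'm set)" and D: "oriented_235 A D" and \<Phi>: "G2_of_dist A c D \<Phi>"
  shows "\<exists>k. \<forall>g\<in>c. \<forall>\<kappa>\<in>A. \<forall>p\<in>dom \<kappa>.
    tr_H (cmetric g \<kappa> p) (scale_tractor g \<kappa> \<sigma> p) (scale_tractor g \<kappa> \<sigma> p) = k"
proof -
  define N where "N g \<kappa> p = tr_H (cmetric g \<kappa> p) (scale_tractor g \<kappa> \<sigma> p) (scale_tractor g \<kappa> \<sigma> p)" for g \<kappa> p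
  note par = G2_of_distD(1)[OF \<Phi>]
  obtain g0 where g0: "g0 \<in> c" using conf unfolding conformal_structure_def by blast
  have chart: "N g \<kappa>' p = N g \<kappa> p" if a: "g \<in> c" "\<kappa> \<in> A" "\<kappa>' \<in> A" "p \<in> dom \<kappa>" "p \<in> dom \<kappa>'" for g \<kappa> \<kappa>' p
  proof -
    obtain i j where nz: "\<Phi> g \<kappa> p tX (tZ i) (tZ j) \<noteq> 0" using phi_nonzero[OF \<Phi> a(1,2,4)] by blast
    show ?thesis unfolding N_def scale_tractor_change_chart[OF par a nz, symmetric] by (rule tr_H_tr_chart[OF a])
  qed
  have split: "N h \<kappa> p = N g \<kappa> p" if a: "g \<in> c" "h \<in> c" "\<kappa> \<in> A" "p \<in> dom \<kappa>" for g h \<kappa> p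
  proof -
    obtain i j where nz: "\<Phi> g \<kappa> p tX (tZ i) (tZ j) \<noteq> 0" using phi_nonzero[OF \<Phi> a(1,3,4)] by blast
    obtain \<Omega> where \<Omega>: "rescaled A \<Omega> g h" using conf_rescaled[OF a(1,2)] by blast
    show ?thesis unfolding N_def scale_tractor_rescaled[OF par a(1,2) \<Omega> a(3,4) nz, symmetric]
      by (rule tr_H_tr_split[OF a(1) \<Omega> a(3,4)])
  qed
  \<comment> \<open>A chart chosen at each point turns the norm into a function on the manifold, to
    which connectedness can be applied.\<close>
  define ch where "ch p = (SOME \<kappa>. \<kappa> \<in> A \<and> p \<in> dom \<kappa>)" for p
  have ch: "ch p \<in> A \<and> p \<in> dom (ch p)" for p
  proof -
    have "p \<in> (\<Union>\<kappa>\<in>A. dom \<kappa>)" using atlas unfolding oriented_atlas_def by blast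
    then have "\<exists>\<kappa>. \<kappa> \<in> A \<and> p \<in> dom \<kappa>" by blast
    then show ?thesis unfolding ch_def by (rule someI_ex)
  qed
  have "(\<lambda>p. N g0 (ch p) p) constant_on UNIV"
  proof (rule locally_constant_imp_constant[OF conn])
    fix p
    interpret K: scale_chart "ch p" "dom (ch p)" g0 \<sigma> by (rule scale_chart[OF g0]) (simp add: ch)
    have "\<exists>T. open T \<and> p \<in> T \<and> (\<forall>q\<in>T. q \<in> dom (ch p) \<and> N g0 (ch p) q = N g0 (ch p) p)"
    proof (rule pd_0_imp_locally_constant[OF atlas])
      show "K.sm (N g0 (ch p))" unfolding N_def[abs_def] by (rule K.norm_scale_tractor_sm)
      show "pd (ch p) (N g0 (ch p)) b q = 0" if "q \<in> dom (ch p)" for q b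
        unfolding N_def[abs_def] by (rule pd_norm_scale_tractor_0[OF D \<Phi> g0 _ that]) (simp add: ch)
    qed (simp_all add: ch)
    then obtain T where T: "open T" "p \<in> T" "\<And>q. q \<in> T \<Longrightarrow> q \<in> dom (ch p)"
      "\<And>q. q \<in> T \<Longrightarrow> N g0 (ch p) q = N g0 (ch p) p" by blast
    have "N g0 (ch q) q = N g0 (ch p) p" if "q \<in> T" for q
      unfolding T(4)[OF that, symmetric] by (rule chart[OF g0 _ _ T(3)[OF that]]) (simp_all add: ch)
    moreover have "openin (top_of_set UNIV) T" using T(1) by simp
    ultimately show "\<exists>T. openin (top_of_set UNIV) T \<and> p \<in> T \<and> (\<forall>x\<in>T. N g0 (ch x) x = N g0 (ch p) p)"
      using T(2) by blast
  qed
  then obtain k where k: "\<And>p. N g0 (ch p) p = k" unfolding constant_on_def by blast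
  have "N g \<kappa> p = k" if "g \<in> c" and "\<kappa> \<in> A" and "p \<in> dom \<kappa>" for g \<kappa> p
  proof -
    have "N g \<kappa> p = N g0 \<kappa> p" by (rule split[OF g0 that])
    also have "\<dots> = N g0 (ch p) p" by (rule chart[OF g0 _ that(2) _ that(3)]) (simp_all add: ch)
    finally show ?thesis by (simp only: k)
  qed
  then show ?thesis unfolding N_def by (intro exI[of _ k] ballI)
qed

text \<open>The trivial deformation \<open>a = b = 0\<close> leaves the 3-form as it is, so only the
  normalisation of the parallel tractor has to be provided.\<close>

lemma self_in_family:
  assumes conn: "connected (UNIV :: 'm set)" and D: "oriented_235 A D" and N: "nurowski A c D"
  shows "D \<in> family A c D \<sigma>"
proof -
  obtain \<Phi> where \<Phi>: "G2_of_dist A c D \<Phi>" using N by (auto simp: nurowski_def)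
  obtain h where h: "\<And>g \<kappa> p. g \<in> c \<Longrightarrow> \<kappa> \<in> A \<Longrightarrow> p \<in> dom \<kappa> \<Longrightarrow>
      tr_H (cmetric g \<kappa> p) (scale_tractor g \<kappa> \<sigma> p) (scale_tractor g \<kappa> \<sigma> p) = h"
    using norm_scale_tractor_constant[OF conn D \<Phi>] by blast
  \<comment> \<open>Scaling by \<open>k\<close> multiplies the norm by \<open>k * k\<close>, so it
    becomes the sign of \<open>h\<close>; for \<open>h = 0\<close> the value 1 is an arbitrary
    positive choice.\<close>
  define k where "k = (if h = 0 then 1 else 1 / sqrt \<bar>h\<bar>)"
  have k: "k > 0" by (simp add: k_def)
  have kh: "- (k * k * h) = - sgn h"
    by (auto simp: k_def sgn_if)
  have e: "- sgn h \<in> {- 1, 0, 1}" by (auto simp: sgn_if)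
  have H: "- sgn h = - tr_H (cmetric g \<kappa> p) (k *\<^sub>R scale_tractor g \<kappa> \<sigma> p) (k *\<^sub>R scale_tractor g \<kappa> \<sigma> p)"
    if "g \<in> c" "\<kappa> \<in> A" "p \<in> dom \<kappa>" for g \<kappa> p
    using h[OF that] kh bilinear_lmul[OF bilinear_tr_H] bilinear_rmul[OF bilinear_tr_H] by (simp add: mult.assoc)
  have d: "deform3 G 0 0 S F = F" for G S F by (simp add: deform3_def fun_eq_iff)
  have "\<exists>\<Phi> \<Phi>' k \<epsilon> a b. G2_of_dist A c D \<Phi> \<and> k > 0 \<and> \<epsilon> \<in> {-1, 0, 1} \<and>
        (\<forall>g\<in>c. \<forall>\<kappa>\<in>A. \<forall>p\<in>dom \<kappa>. let S = k *\<^sub>R scale_tractor g \<kappa> \<sigma> p in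
           \<epsilon> = - tr_H (cmetric g \<kappa> p) S S) \<and>
        - \<epsilon> * a\<^sup>2 + 2 * a + b\<^sup>2 = 0 \<and>
        (\<forall>g\<in>c. \<forall>\<kappa>\<in>A. \<forall>p\<in>dom \<kappa>. \<Phi>' g \<kappa> p =
           deform3 (cmetric g \<kappa> p) a b (k *\<^sub>R scale_tractor g \<kappa> \<sigma> p) (\<Phi> g \<kappa> p)) \<and>
        parallel_compatible_G2 A c \<Phi>' \<and> spans_dist A c \<Phi>' D"
    using \<Phi> k e H d
    by (intro exI[of _ \<Phi>] exI[of _ k] exI[of _ "- sgn h"] exI[of _ 0]) (simp add: Let_def G2_of_dist_def)
  then show ?thesis using D by (simp add: family_def)
qed

section \<open>Invariance of the conformal Killing field\<close>

lemma killing_formula_contraction: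
  assumes \<Phi>: "parallel_compatible_G2 A c \<Phi>" and g: "g \<in> c" "\<kappa> \<in> A" "p \<in> dom \<kappa>"
  shows "killing_formula g \<Phi> \<sigma> \<kappa> p = cinv g \<kappa> p *v (\<chi> e. \<Phi> g \<kappa> p tX (scale_tractor g \<kappa> \<sigma> p) (tZ e))"
proof -
  interpret K: g2_scale_chart \<kappa> "dom \<kappa>" g \<sigma> "\<Phi> g \<kappa>" by (rule g2_scale_chart[OF \<Phi> g(1,2)])
  show ?thesis by (rule K.killing_formula_eq[of \<Phi> p]) (use g in simp_all)
qed

text \<open>Two fields may be computed with different metrics. Passing to the other splitting adds a
  multiple of \<open>tX\<close> to the free slot, where it is killed by the \<open>tX\<close>
  already inserted.\<close>

lemma killing_formula_metric_independent:
  assumes \<Phi>: "G2_of_dist A c D \<Phi>" and g: "g \<in> c" "h \<in> c" "\<kappa> \<in> A" "p \<in> dom \<kappa>"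
  shows "killing_formula h \<Phi> \<sigma> \<kappa> p = killing_formula g \<Phi> \<sigma> \<kappa> p"
proof -
  note par = G2_of_distD(1)[OF \<Phi>]
  interpret K: g2_scale_chart \<kappa> "dom \<kappa>" g \<sigma> "\<Phi> g \<kappa>" by (rule g2_scale_chart[OF par g(1,3)])
  obtain i j where nz: "\<Phi> g \<kappa> p tX (tZ i) (tZ j) \<noteq> 0" using phi_nonzero[OF \<Phi> g(1,3,4)] by blast
  obtain \<Omega> where \<Omega>: "rescaled A \<Omega> g h" using conf_rescaled[OF g(1,2)] by blast
  define U where "U = (\<chi> b. pd \<kappa> (\<lambda>q. ln (\<Omega> q)) b p)"
  have tX: "tr_split \<Omega> g \<kappa> p tX = tX" by (simp add: tr_split_def tX_def Let_def)
  have tZ: "tr_split \<Omega> g \<kappa> p (tZ a + U $ a *\<^sub>R tX) = tZ a" for a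
    by (simp add: tr_split_def tX_def tZ_def Let_def U_def inner_axis)
  have S: "tr_split \<Omega> g \<kappa> p (K.S p) = scale_tractor h \<kappa> \<sigma> p"
    by (rule scale_tractor_rescaled[OF par g(1,2) \<Omega> g(3,4) nz])
  have "\<Phi> h \<kappa> p tX (scale_tractor h \<kappa> \<sigma> p) (tZ e) = \<Phi> g \<kappa> p tX (K.S p) (tZ e + U $ e *\<^sub>R tX)" for e
    using parallel_form_split[OF par g(1,2) \<Omega> g(3,4), of tX "K.S p" "tZ e + U $ e *\<^sub>R tX"] by (simp only: tX tZ S)
  then have "\<Phi> h \<kappa> p tX (scale_tractor h \<kappa> \<sigma> p) (tZ e) = \<Phi> g \<kappa> p tX (K.S p) (tZ e)" for e
    by (simp add: K.F_lin[OF g(4)] K.F_zero[OF g(4)])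
  then show ?thesis
    by (simp add: killing_formula_contraction[OF par] g cinv_def rescaled_cmetric(1)[OF g(1) \<Omega> g(3,4)])
qed

text \<open>Both correction terms of the deformation are contracted twice with \<open>S\<close>.\<close>

lemma deform3_contraction:
  assumes "alternating3 F" shows "deform3 G a b S F u S w = F u S w"
proof -
  have "tr_vol G [x, y, z, S, u, S, w] = 0" for x y z
    unfolding tr_vol_def by (subst wedge_repeated[of 3 5]) simp_all
  then have "hodge3 G F S u S w = 0" by (simp add: hodge3_def)
  moreover have "wedge13 (tr_H G S) F S u S w = 0"
    using alternating3_skew(1)[OF assms, of u S w] by (simp add: wedge13_def alternating3_zero[OF assms])
  ultimately show ?thesis by (simp add: deform3_def)
qed

text \<open>The forms chosen in \<open>family\<close> and in \<open>determined_field\<close> may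
  differ a priori; uniqueness identifies them for \<open>D\<close> and for \<open>D'\<close>
  separately, and the deformation links the two.\<close>

lemma determined_field_family:
  assumes D': "D' \<in> family A c D \<sigma>"
    and \<xi>: "determined_field A c D \<sigma> \<xi>" and \<xi>': "determined_field A c D' \<sigma> \<xi>'"
  shows "coincide A \<xi> \<xi>'"
  unfolding coincide_def
proof (intro ballI)
  fix \<kappa> p assume k: "\<kappa> \<in> A" and p: "p \<in> dom \<kappa>"
  obtain \<Phi> \<Phi>' and k0 a b :: real where \<Phi>: "G2_of_dist A c D \<Phi>" and k0: "k0 > 0"
    and def: "\<And>g \<kappa> p. g \<in> c \<Longrightarrow> \<kappa> \<in> A \<Longrightarrow> p \<in> dom \<kappa> \<Longrightarrow> \<Phi>' g \<kappa> p =
       deform3 (cmetric g \<kappa> p) a b (k0 *\<^sub>R scale_tractor g \<kappa> \<sigma> p) (\<Phi> g \<kappa> p)"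
    and \<Phi>': "G2_of_dist A c D' \<Phi>'"
    using D' unfolding family_def G2_of_dist_def by blast
  obtain \<Psi> g where \<Psi>: "G2_of_dist A c D \<Psi>" and g: "g \<in> c" and \<xi>p: "\<xi> \<kappa> p = killing_formula g \<Psi> \<sigma> \<kappa> p"
    using \<xi> k p unfolding determined_field_def by blast
  obtain \<Psi>' h where \<Psi>': "G2_of_dist A c D' \<Psi>'" and h: "h \<in> c" and \<xi>'p: "\<xi>' \<kappa> p = killing_formula h \<Psi>' \<sigma> \<kappa> p"
    using \<xi>' k p unfolding determined_field_def by blast
  interpret K: g2_scale_chart \<kappa> "dom \<kappa>" g \<sigma> "\<Phi> g \<kappa>" by (rule g2_scale_chart[OF G2_of_distD(1)[OF \<Phi>] g k])
  interpret K': g2_scale_chart \<kappa> "dom \<kappa>" g \<sigma> "\<Phi>' g \<kappa>" by (rule g2_scale_chart[OF G2_of_distD(1)[OF \<Phi>'] g k])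
  have "\<Phi>' g \<kappa> p tX (K.S p) (tZ e) = \<Phi> g \<kappa> p tX (K.S p) (tZ e)" for e
  proof -
    \<comment> \<open>The deformation is built from the normalised tractor; the positive factor
      \<open>k0\<close> cancels by linearity.\<close>
    have "\<Phi>' g \<kappa> p tX (k0 *\<^sub>R K.S p) (tZ e) = \<Phi> g \<kappa> p tX (k0 *\<^sub>R K.S p) (tZ e)"
      unfolding def[OF g k p] by (rule deform3_contraction[OF K.alt[OF p]])
    then show ?thesis using k0 by (simp add: K.F_lin[OF p] K'.F_lin[OF p])
  qed
  then have "\<Psi> g \<kappa> p tX (K.S p) (tZ e) = \<Psi>' g \<kappa> p tX (K.S p) (tZ e)" for e
    using G2_of_dist_unique[OF \<Phi> \<Psi> g k p] G2_of_dist_unique[OF \<Phi>' \<Psi>' g k p] by simp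
  then have "killing_formula g \<Psi> \<sigma> \<kappa> p = killing_formula g \<Psi>' \<sigma> \<kappa> p"
    by (simp add: killing_formula_contraction[OF G2_of_distD(1)[OF \<Psi>] g k p]
        killing_formula_contraction[OF G2_of_distD(1)[OF \<Psi>'] g k p])
  then show "\<xi> \<kappa> p = \<xi>' \<kappa> p"
    unfolding \<xi>p \<xi>'p using killing_formula_metric_independent[OF \<Psi>' g h k p] by simp
qed

end

lemma coincide_imp_fields_eq:
  assumes "coincide A \<xi> \<xi>'"
  shows "nonzero_locus A \<xi> = nonzero_locus A \<xi>'"
    and "\<kappa> \<in> A \<Longrightarrow> p \<in> dom \<kappa> \<Longrightarrow> line_field \<xi> \<kappa> p = line_field \<xi>' \<kappa> p"
    and "\<kappa> \<in> A \<Longrightarrow> p \<in> dom \<kappa> \<Longrightarrow> hyperplane_field c \<xi> \<kappa> p = hyperplane_field c \<xi>' \<kappa> p"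
proof -
  have *: "\<xi> \<kappa> p = \<xi>' \<kappa> p" if "\<kappa> \<in> A" "p \<in> dom \<kappa>" for \<kappa> p
    using assms that unfolding coincide_def by blast
  show "nonzero_locus A \<xi> = nonzero_locus A \<xi>'"
    unfolding nonzero_locus_def using * by (intro Collect_cong bex_cong refl) auto
  show "line_field \<xi> \<kappa> p = line_field \<xi>' \<kappa> p" if "\<kappa> \<in> A" "p \<in> dom \<kappa>"
    unfolding line_field_def *[OF that] ..
  then show "hyperplane_field c \<xi> \<kappa> p = hyperplane_field c \<xi>' \<kappa> p" if "\<kappa> \<in> A" "p \<in> dom \<kappa>"
    unfolding hyperplane_field_def using that by simp
qed

theorem proposition4p6:
  fixes A :: "'m::{t2_space, second_countable_topology} chart set"
    and c :: "'m metric set" and D :: "'m dist2" and \<sigma> :: "'m density"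
  assumes "oriented_atlas A" and "connected (UNIV :: 'm set)"
    and "oriented_235 A D" and "nurowski A c D"
    and "almost_einstein A c \<sigma>" and "\<exists>\<kappa>\<in>A. \<exists>p\<in>dom \<kappa>. \<sigma> \<kappa> p \<noteq> 0"
  shows "(\<forall>D'\<in>family A c D \<sigma>. \<forall>\<xi> \<xi>'.
            determined_field A c D \<sigma> \<xi> \<and> determined_field A c D' \<sigma> \<xi>' \<longrightarrow> coincide A \<xi> \<xi>')
       \<and> (\<forall>D1 \<xi> \<xi>1. oriented_235 A D1 \<and> nurowski A c D1 \<and> family A c D1 \<sigma> = family A c D \<sigma> \<and>
            determined_field A c D \<sigma> \<xi> \<and> determined_field A c D1 \<sigma> \<xi>1 \<longrightarrow>
            coincide A \<xi> \<xi>1 \<and>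
            nonzero_locus A \<xi> = nonzero_locus A \<xi>1 \<and>
            (\<forall>\<kappa>\<in>A. \<forall>p\<in>nonzero_locus A \<xi> \<inter> dom \<kappa>.
               line_field \<xi> \<kappa> p = line_field \<xi>1 \<kappa> p \<and>
               hyperplane_field c \<xi> \<kappa> p = hyperplane_field c \<xi>1 \<kappa> p))"
proof -
  have "conformal_structure A c" using assms(4) by (simp add: nurowski_def)
  then interpret ae_structure A c \<sigma> by (rule ae_structure.intro[OF assms(1) _ assms(5)])
  have 1: "coincide A \<xi> \<xi>'"
    if "D' \<in> family A c D \<sigma>" "determined_field A c D \<sigma> \<xi>" "determined_field A c D' \<sigma> \<xi>'" for D' \<xi> \<xi>'
    by (rule determined_field_family[OF that])
  \<comment> \<open>\<open>D1\<close> belongs to its own family, which by assumption is the family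
    of \<open>D\<close>, so the first part applies to it.\<close>
  have 2: "coincide A \<xi> \<xi>1"
    if "oriented_235 A D1" "nurowski A c D1" "family A c D1 \<sigma> = family A c D \<sigma>"
      "determined_field A c D \<sigma> \<xi>" "determined_field A c D1 \<sigma> \<xi>1" for D1 \<xi> \<xi>1
    using self_in_family[OF assms(2) that(1,2)] unfolding that(3) by (rule 1) (rule that)+
  show ?thesis
  proof (intro conjI allI impI ballI)
    fix D1 \<xi> \<xi>1
    assume "oriented_235 A D1 \<and> nurowski A c D1 \<and> family A c D1 \<sigma> = family A c D \<sigma> \<and>
      determined_field A c D \<sigma> \<xi> \<and> determined_field A c D1 \<sigma> \<xi>1"
    then show co: "coincide A \<xi> \<xi>1" using 2 by blast
    show "nonzero_locus A \<xi> = nonzero_locus A \<xi>1" by (rule coincide_imp_fields_eq(1)[OF co])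
    fix \<kappa> p
    assume "\<kappa> \<in> A" "p \<in> nonzero_locus A \<xi> \<inter> dom \<kappa>"
    then show "line_field \<xi> \<kappa> p = line_field \<xi>1 \<kappa> p"
      "hyperplane_field c \<xi> \<kappa> p = hyperplane_field c \<xi>1 \<kappa> p"
      using coincide_imp_fields_eq(2,3)[OF co] by blast+
  qed (use 1 in blast)
qed

end
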